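(* Let $\ell>-2$ be real, let $\Omega\subseteq\overline{\mathbb R^{n+1}_+}$ be a backward time connected domain, and let $f=f(x,t)$ be a function defined on $\Omega$. Suppose that the function $w(x,r;b)\in C^{m,2,0}_{x,r,t}$ (the third variable being $b$) satisfies $$w_{rr}-A(x,\partial_x)w=0\quad\text{for all }(x,r)\in\Omega_\phi\text{ and }(x,b)\in\Omega,$$ $$w(x,0;b)=f(x,b)\quad\text{for all }(x,b)\in\Omega.$$ Then the function $$u(x,t)=c_\ell\int_0^t db\int_0^{|\phi(t)-\phi(b)|}\left((\phi(t)+\phi(b))^2-r^2\right)^{-\gamma}F\left(\gamma,\gamma;1;\frac{(\phi(t)-\phi(b))^2-r^2}{(\phi(t)+\phi(b))^2-r^2}\right)w(x,r;b)\,dr,$$ defined on $\Omega$, is continuous and satisfies $$u_{tt}-t^\ell A(x,\partial_x)u=f(x,t)+c_\ell(\phi'(t))^2\int_0^t(\phi(t)+\phi(b))^{-2\gamma}F\left(\gamma,\gamma;1;\frac{(\phi(t)-\phi(b))^2}{(\phi(t)+\phi(b))^2}\right)w_r(x,0;b)\,db$$ in the sense of distributions $\mathcal D'(\Omega)$. The function $u$ takes the vanishing initial value $u(x,0)=0$ for all $x\in\widetilde\Omega$. If, additionally, $\ell<4$, then $u_t$ is continuous in $\Omega$ and $u_t(x,0)=0$ for all $x\in\widetilde\Omega$.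
   Context: $\mathbb R^{n+1}_+=\{(x,t): x\in\mathbb R^n,\ t>0\}$. A set $\Omega\subseteq\overline{\mathbb R^{n+1}_+}$ is backward time (line-)connected (to $t=0$) if for every $(x,t)\in\Omega$ the segment $\{(x,s): s\in(0,t]\}$ is contained in $\Omega$. A domain is a connected (relatively) open set. $\widetilde\Omega=\pi_x(\Omega)\subseteq\mathbb R^n$ is the projection of $\Omega$ to the $x$-space. Values at $t=0$ are understood as values of the continuous extension to $t=0$. $\phi(t)=\frac{2}{\ell+2}t^{(\ell+2)/2}$, $\gamma=\frac{\ell}{2(\ell+2)}$, $c_\ell=\left(\frac{\ell+2}{4}\right)^{-\ell/(\ell+2)}$. $F(a,b;c;z)$ is Gauss's hypergeometric function. The $\phi$-image of $\Omega$ is $\Omega_\phi=\bigcup_{(x,t)\in\Omega}\{(x,\tau):\tau\in(0,\phi(t)]\}$. $A(x,\partial_x)=\sum_{|\alpha|\le m}a_\alpha(x)\partial_x^\alpha$ is a linear partial differential operator of order $m$ in $x$ with coefficients $a_\alpha\in C^\infty(\widetilde\Omega)$. $C^{m,2,0}_{x,r,t}$ denotes functions that are continuous together with their partial derivatives up to order $m$ in $x$, up to order $2$ in $r$, and merely continuous in the third variable (here $b$). For $w$ this is meant up to $r=0$ and $b=0$: every $(x_0,t_0)\in\Omega$ with $t_0>0$ has a neighborhood $U_{x_0}$ of $x_0$ such that $w\in C^{m,2,0}_{x,r,t}(U_{x_0}\times[0,\phi(t_0)]\times[0,t_0])$. *)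

theory Defs
  imports "HOL-Analysis.Analysis"
begin

section \<open>Partial derivatives and classes of differentiability\<close>

text \<open>
  The derivative of \<open>f\<close> at \<open>p\<close> in direction \<open>e\<close>, using only values of \<open>f\<close> on \<open>S\<close>; for boundary
  points of \<open>S\<close> it may be one-sided.
\<close>

definition partial_within ::
    "'a::real_normed_vector set \<Rightarrow> 'a \<Rightarrow> ('a \<Rightarrow> 'b::real_normed_vector) \<Rightarrow> 'a \<Rightarrow> 'b" where
  "partial_within S e f p =
     vector_derivative (\<lambda>s. f (p + s *\<^sub>R e)) (at 0 within {s. p + s *\<^sub>R e \<in> S})"

abbreviation partial :: "'a::real_normed_vector \<Rightarrow> ('a \<Rightarrow> 'b::real_normed_vector) \<Rightarrow> 'a \<Rightarrow> 'b" where
  "partial \<equiv> partial_within UNIV"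

text \<open>
  \<open>Ck_along D k S f\<close>: all iterated derivatives of \<open>f\<close> of order at most \<open>k\<close> in directions from
  \<open>D\<close> exist and are continuous on \<open>S\<close> (jointly in all variables).
\<close>

primrec Ck_along ::
    "'a::real_normed_vector set \<Rightarrow> nat \<Rightarrow> 'a set \<Rightarrow> ('a \<Rightarrow> 'b::real_normed_vector) \<Rightarrow> bool" where
  "Ck_along D 0 S f \<longleftrightarrow> continuous_on S f"
| "Ck_along D (Suc k) S f \<longleftrightarrow>
     continuous_on S f \<and>
     (\<forall>e\<in>D. (\<forall>p\<in>S. (\<lambda>s. f (p + s *\<^sub>R e)) differentiable (at 0 within {s. p + s *\<^sub>R e \<in> S}))
            \<and> Ck_along D k S (partial_within S e f))"

definition smooth_on :: "'a::euclidean_space set \<Rightarrow> ('a \<Rightarrow> 'b::real_normed_vector) \<Rightarrow> bool" where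
  "smooth_on S f \<longleftrightarrow> (\<forall>k. Ck_along Basis k S f)"

text \<open>
  The class \<open>C\<^sup>m\<^sup>,\<^sup>2\<^sup>,\<^sup>0\<close> in the variables \<open>(x, r, b)\<close>: pure \<open>x\<close>-derivatives up to order \<open>m\<close> and
  pure \<open>r\<close>-derivatives up to order 2 are continuous; mixed \<open>x\<close>-\<open>r\<close>-derivatives are not required.
\<close>

definition Cm20_on ::
    "nat \<Rightarrow> ((real^'n) \<times> real \<times> real) set \<Rightarrow> (real^'n \<Rightarrow> real \<Rightarrow> real \<Rightarrow> complex) \<Rightarrow> bool" where
  "Cm20_on m S w \<longleftrightarrow>
     Ck_along {(axis i 1, 0, 0) | i. True} m S (\<lambda>(x, r, b). w x r b) \<and>
     Ck_along {(0, 1, 0)} 2 S (\<lambda>(x, r, b). w x r b)"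


section \<open>The operator \<open>A(x, \<partial>\<^sub>x)\<close>\<close>

text \<open>
  A multi-index is a function \<open>\<alpha> :: 'n \<Rightarrow> nat\<close>. Since the finite index type \<open>'n\<close> carries no order,
  a numbering of the coordinates is fixed by choice; \<open>multi_pow D \<alpha>\<close> then composes the operators
  \<open>(D i)\<close>, each \<open>\<alpha> i\<close> times, in this order. Every use below is for commuting operators.
\<close>

definition coords :: "'n::finite list" where
  "coords = (SOME is. distinct is \<and> set is = UNIV)"

definition multi_pow :: "('n::finite \<Rightarrow> 'f \<Rightarrow> 'f) \<Rightarrow> ('n \<Rightarrow> nat) \<Rightarrow> 'f \<Rightarrow> 'f" where
  "multi_pow D \<alpha> g = foldr (\<lambda>i. (D i) ^^ (\<alpha> i)) coords g"

definition multi_indices :: "nat \<Rightarrow> ('n::finite \<Rightarrow> nat) set" where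
  "multi_indices m = {\<alpha>. (\<Sum>i\<in>UNIV. \<alpha> i) \<le> m}"

definition diff_op ::
    "nat \<Rightarrow> (('n::finite \<Rightarrow> nat) \<Rightarrow> real^'n \<Rightarrow> complex) \<Rightarrow> (real^'n \<Rightarrow> complex) \<Rightarrow> real^'n \<Rightarrow> complex" where
  "diff_op m a g x =
     (\<Sum>\<alpha>\<in>multi_indices m. a \<alpha> x * multi_pow (\<lambda>i. partial (axis i 1)) \<alpha> g x)"


section \<open>Distributions\<close>

definition test_functions :: "'a::euclidean_space set \<Rightarrow> ('a \<Rightarrow> complex) set" where
  "test_functions V =
     {\<psi>. smooth_on UNIV \<psi> \<and> compact (closure {p. \<psi> p \<noteq> 0}) \<and> closure {p. \<psi> p \<noteq> 0} \<subseteq> V}"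

definition locally_integrable_on :: "'a::euclidean_space set \<Rightarrow> ('a \<Rightarrow> complex) \<Rightarrow> bool" where
  "locally_integrable_on V g \<longleftrightarrow> (\<forall>K. compact K \<and> K \<subseteq> V \<longrightarrow> set_integrable lborel K g)"

text \<open>
  Distributions on an open set \<open>V\<close> are represented by functionals on all functions; only their
  values on \<open>test_functions V\<close> are meaningful.
\<close>

definition regular_dist :: "'a::euclidean_space set \<Rightarrow> ('a \<Rightarrow> complex) \<Rightarrow> ('a \<Rightarrow> complex) \<Rightarrow> complex" where
  "regular_dist V g \<psi> = (LINT p:V|lborel. g p * \<psi> p)"

definition dist_partial ::
    "'a::euclidean_space \<Rightarrow> (('a \<Rightarrow> complex) \<Rightarrow> complex) \<Rightarrow> ('a \<Rightarrow> complex) \<Rightarrow> complex" where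
  "dist_partial e T \<psi> = - T (partial e \<psi>)"

definition dist_mult ::
    "('a::euclidean_space \<Rightarrow> complex) \<Rightarrow> (('a \<Rightarrow> complex) \<Rightarrow> complex) \<Rightarrow> ('a \<Rightarrow> complex) \<Rightarrow> complex" where
  "dist_mult h T \<psi> = T (\<lambda>p. h p * \<psi> p)"

definition dist_diff_op ::
    "nat \<Rightarrow> (('n::finite \<Rightarrow> nat) \<Rightarrow> real^'n \<Rightarrow> complex)
      \<Rightarrow> (((real^'n) \<times> real \<Rightarrow> complex) \<Rightarrow> complex) \<Rightarrow> ((real^'n) \<times> real \<Rightarrow> complex) \<Rightarrow> complex" where
  "dist_diff_op m a T \<psi> =
     (\<Sum>\<alpha>\<in>multi_indices m.
        dist_mult (\<lambda>(x, t). a \<alpha> x) (multi_pow (\<lambda>i. dist_partial (axis i 1, 0)) \<alpha> T) \<psi>)"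


section \<open>Domains\<close>

definition upper_halfspace :: "((real^'n) \<times> real) set" where
  "upper_halfspace = {(x, t). t > 0}"

definition closed_upper_halfspace :: "((real^'n) \<times> real) set" where
  "closed_upper_halfspace = {(x, t). t \<ge> 0}"

definition halfspace_domain :: "((real^'n) \<times> real) set \<Rightarrow> bool" where
  "halfspace_domain \<Omega> \<longleftrightarrow> openin (top_of_set closed_upper_halfspace) \<Omega> \<and> connected \<Omega>"

definition backward_time_connected :: "((real^'n) \<times> real) set \<Rightarrow> bool" where
  "backward_time_connected \<Omega> \<longleftrightarrow> (\<forall>(x, t)\<in>\<Omega>. \<forall>s\<in>{0<..t}. (x, s) \<in> \<Omega>)"

text \<open>
  The continuous extension of \<open>g\<close> from \<open>\<Omega>\<close> to \<open>t = 0\<close> takes the value \<open>0\<close> at every point of the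
  projection of \<open>\<Omega>\<close> to the \<open>x\<close>-space; \<open>(x, 0)\<close> itself need not belong to \<open>\<Omega>\<close>.
\<close>

definition vanishes_initially ::
    "((real^'n) \<times> real) set \<Rightarrow> ((real^'n) \<times> real \<Rightarrow> complex) \<Rightarrow> bool" where
  "vanishes_initially \<Omega> g \<longleftrightarrow>
     (\<forall>x\<in>fst ` \<Omega>. (g \<longlongrightarrow> 0) (at (x, 0) within \<Omega>) \<and> ((x, 0) \<in> \<Omega> \<longrightarrow> g (x, 0) = 0))"


section \<open>The integral transform\<close>

definition phi :: "real \<Rightarrow> real \<Rightarrow> real" where
  "phi l t = 2 / (l + 2) * t powr ((l + 2) / 2)"

definition gam :: "real \<Rightarrow> real" where
  "gam l = l / (2 * (l + 2))"

definition c_const :: "real \<Rightarrow> real" where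
  "c_const l = ((l + 2) / 4) powr (- l / (l + 2))"

definition hypergeo_F :: "real \<Rightarrow> real \<Rightarrow> real \<Rightarrow> real \<Rightarrow> real" where
  "hypergeo_F a b c z = eval_fps (fps_hypergeo [a, b] [c] 1) z"

definition phi_image :: "real \<Rightarrow> ((real^'n) \<times> real) set \<Rightarrow> ((real^'n) \<times> real) set" where
  "phi_image l \<Omega> = (\<Union>(x, t)\<in>\<Omega>. {(x, \<tau>) | \<tau>. \<tau> \<in> {0<..phi l t}})"

definition kernel :: "real \<Rightarrow> real \<Rightarrow> real \<Rightarrow> real \<Rightarrow> real" where
  "kernel l t b r =
     ((phi l t + phi l b)\<^sup>2 - r\<^sup>2) powr (- gam l) *
     hypergeo_F (gam l) (gam l) 1
       (((phi l t - phi l b)\<^sup>2 - r\<^sup>2) / ((phi l t + phi l b)\<^sup>2 - r\<^sup>2))"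

definition inner_transform ::
    "real \<Rightarrow> (real^'n \<Rightarrow> real \<Rightarrow> real \<Rightarrow> complex) \<Rightarrow> real^'n \<Rightarrow> real \<Rightarrow> real \<Rightarrow> complex" where
  "inner_transform l w x t b =
     (LINT r:{0..\<bar>phi l t - phi l b\<bar>}|lborel. kernel l t b r *\<^sub>R w x r b)"

definition transform ::
    "real \<Rightarrow> (real^'n \<Rightarrow> real \<Rightarrow> real \<Rightarrow> complex) \<Rightarrow> (real^'n) \<times> real \<Rightarrow> complex" where
  "transform l w = (\<lambda>(x, t). c_const l *\<^sub>R (LINT b:{0..t}|lborel. inner_transform l w x t b))"

text \<open>
  Well-definedness of \<open>transform l w\<close> at \<open>(x, t)\<close>: the integrals converge. (At \<open>b = 0\<close>, a null set,
  the hypergeometric function is evaluated at \<open>z = 1\<close>.)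
\<close>

definition transform_exists ::
    "real \<Rightarrow> (real^'n \<Rightarrow> real \<Rightarrow> real \<Rightarrow> complex) \<Rightarrow> (real^'n) \<times> real \<Rightarrow> bool" where
  "transform_exists l w = (\<lambda>(x, t).
     (\<forall>b\<in>{0<..t}. set_integrable lborel {0..\<bar>phi l t - phi l b\<bar>} (\<lambda>r. kernel l t b r *\<^sub>R w x r b)) \<and>
     set_integrable lborel {0..t} (inner_transform l w x t))"

text \<open>
  The derivative \<open>w\<^sub>r(x, 0; b)\<close> is taken from the right, as \<open>w\<close> is only given for \<open>r \<ge> 0\<close>.
\<close>

definition rhs_integrand ::
    "real \<Rightarrow> (real^'n \<Rightarrow> real \<Rightarrow> real \<Rightarrow> complex) \<Rightarrow> real^'n \<Rightarrow> real \<Rightarrow> real \<Rightarrow> complex" where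
  "rhs_integrand l w x t b =
     ((phi l t + phi l b) powr (- 2 * gam l) *
      hypergeo_F (gam l) (gam l) 1 ((phi l t - phi l b)\<^sup>2 / (phi l t + phi l b)\<^sup>2))
     *\<^sub>R partial_within {0..} 1 (\<lambda>r. w x r b) 0"

definition transform_rhs ::
    "real \<Rightarrow> (real^'n \<Rightarrow> real \<Rightarrow> complex) \<Rightarrow> (real^'n \<Rightarrow> real \<Rightarrow> real \<Rightarrow> complex)
      \<Rightarrow> (real^'n) \<times> real \<Rightarrow> complex" where
  "transform_rhs l f w = (\<lambda>(x, t).
     f x t + (c_const l * (deriv (phi l) t)\<^sup>2) *\<^sub>R (LINT b:{0..t}|lborel. rhs_integrand l w x t b))"

end

theory Submission
  imports Defs
begin

text \<open>
  The kernel is Riemann's function of the operator \<open>\<partial>\<^sub>t\<^sup>2 - t\<^sup>l \<partial>\<^sub>r\<^sup>2\<close>. In the variables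
  \<open>\<tau> = \<phi>(t)\<close> and \<open>q = \<phi>(b)\<close> this operator is, up to the factor \<open>t\<^sup>l = \<phi>'(t)\<^sup>2\<close>, the
  Euler-Poisson-Darboux operator \<open>\<partial>\<^sub>\<tau>\<^sup>2 + (2\<gamma>/\<tau>) \<partial>\<^sub>\<tau> - \<partial>\<^sub>r\<^sup>2\<close>, and Gauss's differential equation
  says that the kernel \<open>k\<close> is annihilated by it (\<open>riem_pde\<close>). On the characteristic
  \<open>r = \<tau> - q\<close> the kernel equals \<open>(4\<tau>q)\<^sup>-\<^sup>\<gamma>\<close>, which solves the transport equation that makes all
  boundary terms there cancel (\<open>riem_characteristic\<close>). Hence, for fixed \<open>b > 0\<close>, the integral
  \<open>v(x, t; b)\<close> of \<open>k w\<close> over \<open>0 < r < \<phi>(t) - \<phi>(b)\<close> is a classical solution of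
  \<open>v\<^sub>t\<^sub>t = t\<^sup>l (\<integral> k w\<^sub>r\<^sub>r dr + k w\<^sub>r|\<^sub>r\<^sub>=\<^sub>0)\<close> for \<open>t \<ge> b\<close>, with \<open>v = 0\<close> and \<open>c v\<^sub>t = f\<close> at \<open>t = b\<close>
  (\<open>epd_t_deriv\<close>, \<open>vt_deriv\<close>, \<open>vt_initial\<close>). The operator \<open>A\<close> acts in \<open>x\<close> alone and
  \<open>w\<^sub>r\<^sub>r = A w\<close>, so \<open>v\<^sub>t\<^sub>t - t\<^sup>l A v\<close> is \<open>t\<^sup>l k w\<^sub>r\<close> at \<open>r = 0\<close>.

  The transform is \<open>u = c \<integral>\<^sub>0\<^sup>t v db\<close>. It is tested with \<open>\<psi>\<close> one value of \<open>b\<close> at a time: integration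
  by parts over \<open>t \<ge> b\<close> moves all derivatives from \<open>\<psi>\<close> to \<open>v\<close>, the edge \<open>t = b\<close> contributes
  \<open>\<integral> f \<psi> dx\<close> (\<open>slice_identity\<close>), and Fubini's theorem in \<open>b\<close> gives the equation for \<open>u\<close>
  (\<open>weak_equation\<close>). This argument differentiates
  neither in \<open>b\<close> nor the function \<open>u\<close>; that matters because for \<open>l \<ge> 4\<close> the integral of \<open>v\<^sub>t\<close> over \<open>b\<close> may diverge at
  \<open>b = 0\<close>.

  Continuity rests on homogeneity. The coefficients of \<open>F(\<gamma>, \<gamma>; 1; z)\<close> are nonnegative and, since
  \<open>\<gamma> < 1/2\<close>, summable, so that \<open>0 \<le> F \<le> F(1)\<close> and \<open>(1 - z) F'(z) \<le> F(1)\<close> on \<open>[0, 1)\<close>. This gives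
  \<open>|v| \<le> C t sup |w|\<close> and \<open>|v\<^sub>t| \<le> C (t/b)\<^sup>e sup |w|\<close>, with some \<open>e < 1\<close> if \<open>l < 4\<close>. After the substitution
  \<open>b = t \<beta>\<close> dominated convergence yields the continuity of \<open>u\<close> and, for \<open>l < 4\<close>, of
  \<open>\<integral>\<^sub>0\<^sup>t v\<^sub>t db\<close>, both down to \<open>t = 0\<close>, where they vanish. By Fubini's theorem on the triangle
  \<open>0 < b < s < t\<close>, the second one is the time derivative of \<open>\<integral>\<^sub>0\<^sup>t v db\<close>.
\<close>


section \<open>Gauss's hypergeometric series F(g, g; 1; z)\<close>

abbreviation hyp_fps :: "real \<Rightarrow> real fps" where
  "hyp_fps g \<equiv> fps_hypergeo [g, g] [1] 1"

definition hypF :: "real \<Rightarrow> real \<Rightarrow> real" where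
  "hypF g = eval_fps (hyp_fps g)"
definition hypF1 :: "real \<Rightarrow> real \<Rightarrow> real" where
  "hypF1 g = eval_fps (fps_deriv (hyp_fps g))"
definition hypF2 :: "real \<Rightarrow> real \<Rightarrow> real" where
  "hypF2 g = eval_fps (fps_deriv (fps_deriv (hyp_fps g)))"

lemma hyp_nth: "fps_nth (hyp_fps g) n = (pochhammer g n / fact n)\<^sup>2"
  by (simp add: power2_eq_square pochhammer_fact[symmetric] field_simps)

declare fps_hypergeo_nth [simp del]

lemma hyp_nth_rec: "(real n + 1)\<^sup>2 * fps_nth (hyp_fps g) (Suc n) = (real n + g)\<^sup>2 * fps_nth (hyp_fps g) n"
proof -
  have "(real n + 1) * (pochhammer g (Suc n) / fact (Suc n)) = (real n + g) * (pochhammer g n / fact n)"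
    by (simp add: pochhammer_rec' divide_simps) (simp add: algebra_simps)
  then show ?thesis unfolding hyp_nth by (metis power_mult_distrib)
qed

lemma hyp_nth_nonneg: "fps_nth (hyp_fps g) n \<ge> 0"
  unfolding hyp_nth by simp

text \<open>
  The ratio of successive coefficients is \<open>((n + g)/(n + 1))\<^sup>2\<close>. It makes \<open>n c\<^sub>n - (n + 1) c\<^sub>n\<^sub>+\<^sub>1\<close>
  comparable to \<open>(1 - 2g) c\<^sub>n\<close>, so that the partial sums telescope. This also covers the case of
  vanishing coefficients, in which the series is a polynomial.
\<close>

lemma hyp_summable:
  assumes g: "g < 1/2"
  shows "summable (fps_nth (hyp_fps g))"
proof -
  let ?c = "fps_nth (hyp_fps g)"
  have tele: "(real n + 1) * (real n * ?c n - (real n + 1) * ?c (Suc n)) = ((1 - 2*g) * real n - g\<^sup>2) * ?c n" for n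
  proof -
    have "(real n + 1) * (real n * ?c n - (real n + 1) * ?c (Suc n)) = (real n + 1) * real n * ?c n - (real n + 1)\<^sup>2 * ?c (Suc n)"
      by (simp add: algebra_simps power2_eq_square)
    also have "\<dots> = (real n + 1) * real n * ?c n - (real n + g)\<^sup>2 * ?c n"
      by (simp only: hyp_nth_rec)
    finally show ?thesis by (simp add: algebra_simps power2_eq_square)
  qed
  \<comment> \<open>Half of the limit \<open>1 - 2g\<close>; the other half absorbs \<open>g\<^sup>2\<close> once \<open>n \<ge> N\<close>.\<close>
  define d where "d = (1 - 2*g) / 2"
  have d: "d > 0" using g by (simp add: d_def)
  obtain N :: nat where N: "real N \<ge> (d + g\<^sup>2) / d" by (meson real_arch_simple)
  have step: "d * ?c n \<le> real n * ?c n - real (Suc n) * ?c (Suc n)" if "n \<ge> N" for n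
  proof -
    have "real n \<ge> (d + g\<^sup>2) / d" using that N by linarith
    then have "d * real n \<ge> d + g\<^sup>2" using d by (simp add: field_simps)
    then have "d * (real n + 1) \<le> (1 - 2*g) * real n - g\<^sup>2" by (simp add: d_def field_simps)
    then have "d * (real n + 1) * ?c n \<le> ((1 - 2*g) * real n - g\<^sup>2) * ?c n"
      using hyp_nth_nonneg by (rule mult_right_mono)
    then have "(real n + 1) * (d * ?c n) \<le> (real n + 1) * (real n * ?c n - (real n + 1) * ?c (Suc n))"
      unfolding tele by (simp add: algebra_simps)
    then show ?thesis by (simp add: add.commute)
  qed
  have bound: "(\<Sum>i<n. d * ?c (i + N)) \<le> real N * ?c N - real (n + N) * ?c (n + N)" for n
  proof (induction n)
    case (Suc n)
    then show ?case using step[of "n + N"] by simp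
  qed simp
  have "summable (\<lambda>i. d * ?c (i + N))"
  proof (rule summableI_nonneg_bounded)
    show "0 \<le> d * ?c (n + N)" for n using d hyp_nth_nonneg by simp
    show "(\<Sum>i<n. d * ?c (i + N)) \<le> real N * ?c N" for n
      using bound[of n] hyp_nth_nonneg[of g "n + N"] 
      by (smt (verit) mult_nonneg_nonneg of_nat_0_le_iff)
  qed
  then have "summable (\<lambda>i. ?c (i + N))" using d by (subst (asm) summable_cmult_iff) auto
  then show ?thesis by (simp only: summable_iff_shift)
qed

lemma hyp_conv_radius:
  assumes "g < 1/2"
  shows "fps_conv_radius (hyp_fps g) \<ge> 1"
  using conv_radius_geI[of "fps_nth (hyp_fps g)" 1] hyp_summable[OF assms]
  by (simp add: fps_conv_radius_def one_ereal_def)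

lemma
  assumes g: "g < 1/2" and z: "\<bar>z\<bar> < 1"
  shows hypF_deriv: "(hypF g has_real_derivative hypF1 g z) (at z within S)"
    and hypF1_deriv: "(hypF1 g has_real_derivative hypF2 g z) (at z within S)"
    and isCont_hypF2: "isCont (hypF2 g) z"
proof -
  have z': "ereal (norm z) < 1" using z by simp
  have r0: "ereal (norm z) < fps_conv_radius (hyp_fps g)"
    using hyp_conv_radius[OF g] z' by (rule less_le_trans[rotated])
  have r1: "ereal (norm z) < fps_conv_radius (fps_deriv (hyp_fps g))"
    using fps_conv_radius_deriv[of "hyp_fps g"] r0 by (rule less_le_trans[rotated])
  have r2: "ereal (norm z) < fps_conv_radius (fps_deriv (fps_deriv (hyp_fps g)))"
    using fps_conv_radius_deriv[of "fps_deriv (hyp_fps g)"] r1 by (rule less_le_trans[rotated])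
  show "(hypF g has_real_derivative hypF1 g z) (at z within S)"
    unfolding hypF_def hypF1_def by (rule has_field_derivative_eval_fps[OF r0])
  show "(hypF1 g has_real_derivative hypF2 g z) (at z within S)"
    unfolding hypF2_def hypF1_def by (rule has_field_derivative_eval_fps[OF r1])
  show "isCont (hypF2 g) z"
    unfolding hypF2_def by (rule DERIV_isCont[OF has_field_derivative_eval_fps[OF r2]])
qed

text \<open>
  Gauss's equation, read off from the recursion of the coefficients.
\<close>

lemma hyp_ode:
  assumes g: "g < 1/2" and z: "\<bar>z\<bar> < 1"
  shows "z * (1 - z) * hypF2 g z + (1 - (2*g + 1) * z) * hypF1 g z - g\<^sup>2 * hypF g z = 0"
proof -
  let ?f = "hyp_fps g"
  let ?f1 = "fps_deriv ?f"
  let ?f2 = "fps_deriv ?f1"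
  have z': "ereal (norm z) < 1" using z by simp
  have r0: "ereal (norm z) < fps_conv_radius ?f"
    using hyp_conv_radius[OF g] z' by (rule less_le_trans[rotated])
  have r1: "ereal (norm z) < fps_conv_radius ?f1"
    using fps_conv_radius_deriv[of ?f] r0 by (rule less_le_trans[rotated])
  have r2: "ereal (norm z) < fps_conv_radius ?f2"
    using fps_conv_radius_deriv[of ?f1] r1 by (rule less_le_trans[rotated])
  have co: "fps_nth (fps_X * ?f2) n - fps_nth (fps_X * (fps_X * ?f2)) n + fps_nth ?f1 n
       - (2*g+1) * fps_nth (fps_X * ?f1) n - g\<^sup>2 * fps_nth ?f n = 0" for n
  proof (cases n)
    case 0
    then show ?thesis using hyp_nth_rec[of 0 g] by (simp)
  next
    case (Suc k)
    have "fps_nth (fps_X * (fps_X * ?f2)) n = real n * (real n - 1) * fps_nth ?f n"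
      using Suc by (cases k) (simp_all add: algebra_simps)
    moreover have "fps_nth (fps_X * ?f2) n = real n * (real n + 1) * fps_nth ?f (Suc n)"
      using Suc by (simp add: algebra_simps)
    moreover have "fps_nth ?f1 n = (real n + 1) * fps_nth ?f (Suc n)"
      by (simp add: algebra_simps)
    moreover have "fps_nth (fps_X * ?f1) n = real n * fps_nth ?f n"
      using Suc by (simp add: algebra_simps)
    ultimately have "fps_nth (fps_X * ?f2) n - fps_nth (fps_X * (fps_X * ?f2)) n + fps_nth ?f1 n
       - (2*g+1) * fps_nth (fps_X * ?f1) n - g\<^sup>2 * fps_nth ?f n
       = (real n + 1)\<^sup>2 * fps_nth ?f (Suc n) - (real n + g)\<^sup>2 * fps_nth ?f n"
      by (simp only: power2_eq_square) (simp add: algebra_simps)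
    then show ?thesis by (simp only: hyp_nth_rec)
  qed
  have X1: "fps_conv_radius (fps_X * h) \<ge> fps_conv_radius h" for h :: "real fps"
    by (rule order_trans[OF _ fps_conv_radius_mult]) simp
  have evX: "eval_fps (fps_X * h) z = z * eval_fps h z"
    if "ereal (norm z) < fps_conv_radius h" for h :: "real fps"
    using that by (subst eval_fps_mult) simp_all
  have x2: "ereal (norm z) < fps_conv_radius (fps_X * ?f2)" using X1 r2 by (rule less_le_trans[rotated])
  have xx2: "ereal (norm z) < fps_conv_radius (fps_X * (fps_X * ?f2))" using X1 x2 by (rule less_le_trans[rotated])
  have x1: "ereal (norm z) < fps_conv_radius (fps_X * ?f1)" using X1 r1 by (rule less_le_trans[rotated])
  have S: "(\<lambda>n. (fps_nth (fps_X * ?f2) n) * z ^ n - (fps_nth (fps_X * (fps_X * ?f2)) n) * z ^ n + fps_nth ?f1 n * z ^ n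
       - (2*g+1) * (fps_nth (fps_X * ?f1) n * z ^ n) - g\<^sup>2 * (fps_nth ?f n * z ^ n)) sums
      (eval_fps (fps_X * ?f2) z - eval_fps (fps_X * (fps_X * ?f2)) z + eval_fps ?f1 z
       - (2*g+1) * eval_fps (fps_X * ?f1) z - g\<^sup>2 * eval_fps ?f z)"
    by (intro sums_add sums_diff sums_mult sums_eval_fps r0 r1 x1 x2 xx2)
  have Z: "(\<lambda>n. (fps_nth (fps_X * ?f2) n) * z ^ n - (fps_nth (fps_X * (fps_X * ?f2)) n) * z ^ n + fps_nth ?f1 n * z ^ n
       - (2*g+1) * (fps_nth (fps_X * ?f1) n * z ^ n) - g\<^sup>2 * (fps_nth ?f n * z ^ n)) = (\<lambda>n. 0)"
  proof
    fix n
    have "(fps_nth (fps_X * ?f2) n) * z ^ n - (fps_nth (fps_X * (fps_X * ?f2)) n) * z ^ n + fps_nth ?f1 n * z ^ n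
       - (2*g+1) * (fps_nth (fps_X * ?f1) n * z ^ n) - g\<^sup>2 * (fps_nth ?f n * z ^ n)
       = (fps_nth (fps_X * ?f2) n - fps_nth (fps_X * (fps_X * ?f2)) n + fps_nth ?f1 n
       - (2*g+1) * fps_nth (fps_X * ?f1) n - g\<^sup>2 * fps_nth ?f n) * z ^ n"
      by (simp only: left_diff_distrib distrib_right mult.assoc)
    then show "(fps_nth (fps_X * ?f2) n) * z ^ n - (fps_nth (fps_X * (fps_X * ?f2)) n) * z ^ n + fps_nth ?f1 n * z ^ n
       - (2*g+1) * (fps_nth (fps_X * ?f1) n * z ^ n) - g\<^sup>2 * (fps_nth ?f n * z ^ n) = 0"
      by (simp only: co mult_zero_left)
  qed
  have "eval_fps (fps_X * ?f2) z - eval_fps (fps_X * (fps_X * ?f2)) z + eval_fps ?f1 z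
       - (2*g+1) * eval_fps (fps_X * ?f1) z - g\<^sup>2 * eval_fps ?f z = 0"
    by (rule sums_unique2[OF S[unfolded Z] sums_zero])
  moreover have "eval_fps (fps_X * ?f2) z = z * hypF2 g z"
    unfolding hypF2_def by (rule evX[OF r2])
  moreover have "eval_fps (fps_X * (fps_X * ?f2)) z = z * (z * hypF2 g z)"
    unfolding evX[OF x2] evX[OF r2] hypF2_def ..
  moreover have "eval_fps (fps_X * ?f1) z = z * hypF1 g z"
    unfolding hypF1_def by (rule evX[OF r1])
  ultimately show ?thesis unfolding hypF_def[symmetric] hypF1_def[symmetric]
    by (simp add: algebra_simps)
qed

lemma
  assumes g: "g < 1/2" and z: "0 \<le> z" "z \<le> 1"
  shows hypF_nonneg: "0 \<le> hypF g z"
    and hypF_le: "hypF g z \<le> hypF g 1"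
proof -
  let ?c = "fps_nth (hyp_fps g)"
  have le: "?c n * z ^ n \<le> ?c n" for n
    using hyp_nth_nonneg[of g n] z by (simp add: mult_left_le power_le_one)
  have nn: "0 \<le> ?c n * z ^ n" for n
    using hyp_nth_nonneg[of g n] z by (simp)
  have s: "summable (\<lambda>n. ?c n * z ^ n)"
    by (rule summable_comparison_test[OF _ hyp_summable[OF g]])
       (use le nn in \<open>auto\<close>)
  show "0 \<le> hypF g z" unfolding hypF_def eval_fps_def using nn s by (rule suminf_nonneg[rotated])
  show "hypF g z \<le> hypF g 1" unfolding hypF_def eval_fps_def
    using suminf_le[OF le s hyp_summable[OF g]] by (simp)
qed

lemma hypF1_nonneg_mono:
  assumes g: "g < 1/2" and z: "0 \<le> y" "y \<le> z" "z < 1"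
  shows "0 \<le> hypF1 g y" and "hypF1 g y \<le> hypF1 g z"
proof -
  let ?d = "fps_nth (fps_deriv (hyp_fps g))"
  have nn: "0 \<le> ?d n" for n
    using hyp_nth_nonneg[of g "Suc n"] by (simp del: of_nat_Suc)
  have s: "summable (\<lambda>n. ?d n * t ^ n)" if "0 \<le> t" "t < 1" for t
  proof (rule summable_fps)
    have "ereal (norm t) < 1" using that by simp
    then have "ereal (norm t) < fps_conv_radius (hyp_fps g)"
      using hyp_conv_radius[OF g] by (rule less_le_trans)
    then show "ereal (norm t) < fps_conv_radius (fps_deriv (hyp_fps g))"
      using fps_conv_radius_deriv by (rule less_le_trans)
  qed
  show "0 \<le> hypF1 g y" unfolding hypF1_def eval_fps_def
    by (rule suminf_nonneg[OF s]) (use nn z in \<open>auto simp del: fps_deriv_nth\<close>)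
  show "hypF1 g y \<le> hypF1 g z" unfolding hypF1_def eval_fps_def
    by (rule suminf_le[OF _ s s])
       (use nn z in \<open>auto simp del: fps_deriv_nth intro!: mult_left_mono power_mono\<close>)
qed

text \<open>
  The coefficients are nonnegative, so the function is convex on \<open>[0, 1)\<close>: its increment from \<open>z\<close> to \<open>1\<close>
  is at least \<open>(1 - z) F'(z)\<close>. Although \<open>F'\<close> may be unbounded at \<open>1\<close>, this bound is all that the
  estimate of the time derivative needs.
\<close>

lemma hypF1_bound:
  assumes g: "g < 1/2" and z: "0 \<le> z" "z < 1"
  shows "(1 - z) * hypF1 g z \<le> hypF g 1"
proof -
  have le: "(y - z) * hypF1 g z \<le> hypF g 1" if y: "z < y" "y < 1" for y
  proof -
    obtain t where t: "z < t" "t < y" "hypF g y - hypF g z = (y - z) * hypF1 g t"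
      using MVT2[of z y "hypF g" "hypF1 g"] hypF_deriv[OF g] y z by force
    have "(y - z) * hypF1 g z \<le> (y - z) * hypF1 g t"
      using hypF1_nonneg_mono(2)[OF g, of z t] t y z by (intro mult_left_mono) auto
    also have "\<dots> \<le> hypF g y" using t(3) hypF_nonneg[OF g, of z] z by simp
    also have "\<dots> \<le> hypF g 1" using hypF_le[OF g, of y] y z by simp
    finally show ?thesis .
  qed
  have "((\<lambda>y. (y - z) * hypF1 g z) \<longlongrightarrow> (1 - z) * hypF1 g z) (at_left 1)"
    by (intro tendsto_intros)
  moreover have "eventually (\<lambda>y. (y - z) * hypF1 g z \<le> hypF g 1) (at_left 1)"
    using eventually_at_left_real[of z 1] z by (auto elim!: eventually_mono intro: le)
  ultimately show ?thesis by (rule tendsto_upperbound) simp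
qed

lemma hypergeo_F_eq: "hypergeo_F g g 1 z = hypF g z"
  by (simp add: hypergeo_F_def hypF_def)

lemma hypF_0 [simp]: "hypF g 0 = 1"
  by (simp add: hypF_def eval_fps_at_0)

section \<open>The Riemann function of the Euler-Poisson-Darboux equation\<close>

definition riem_S :: "real \<Rightarrow> real \<Rightarrow> real \<Rightarrow> real" where
  "riem_S \<tau> q r = (\<tau> + q)\<^sup>2 - r\<^sup>2"
definition riem_z :: "real \<Rightarrow> real \<Rightarrow> real \<Rightarrow> real" where
  "riem_z \<tau> q r = ((\<tau> - q)\<^sup>2 - r\<^sup>2) / riem_S \<tau> q r"

text \<open>
  The kernel of the transform with \<open>\<tau> = \<phi>(t)\<close> and \<open>q = \<phi>(b)\<close>. The suffixes of the
  following functions name the partial derivatives that they turn out to be.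
\<close>

definition riem :: "real \<Rightarrow> real \<Rightarrow> real \<Rightarrow> real \<Rightarrow> real" where
  "riem g \<tau> q r = riem_S \<tau> q r powr (- g) * hypF g (riem_z \<tau> q r)"

definition riem_t :: "real \<Rightarrow> real \<Rightarrow> real \<Rightarrow> real \<Rightarrow> real" where
  "riem_t g \<tau> q r = riem_S \<tau> q r powr (- g) *
     (- (2 * g * (\<tau> + q) / riem_S \<tau> q r) * hypF g (riem_z \<tau> q r)
      + 4 * q * (\<tau>\<^sup>2 - q\<^sup>2 + r\<^sup>2) / (riem_S \<tau> q r)\<^sup>2 * hypF1 g (riem_z \<tau> q r))"

definition riem_r :: "real \<Rightarrow> real \<Rightarrow> real \<Rightarrow> real \<Rightarrow> real" where
  "riem_r g \<tau> q r = riem_S \<tau> q r powr (- g) *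
     (2 * g * r / riem_S \<tau> q r * hypF g (riem_z \<tau> q r)
      - 8 * \<tau> * q * r / (riem_S \<tau> q r)\<^sup>2 * hypF1 g (riem_z \<tau> q r))"

definition riem_rr :: "real \<Rightarrow> real \<Rightarrow> real \<Rightarrow> real \<Rightarrow> real" where
  "riem_rr g \<tau> q r = (let S = riem_S \<tau> q r; z = riem_z \<tau> q r in S powr (- g) *
     ((4 * g\<^sup>2 * r\<^sup>2 / S\<^sup>2 + 2 * g / S + 4 * g * r\<^sup>2 / S\<^sup>2) * hypF g z
      - (32 * g * \<tau> * q * r\<^sup>2 / S ^ 3 + 8 * \<tau> * q / S\<^sup>2 + 32 * \<tau> * q * r\<^sup>2 / S ^ 3) * hypF1 g z
      + 64 * \<tau>\<^sup>2 * q\<^sup>2 * r\<^sup>2 / S ^ 4 * hypF2 g z))"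

definition riem_tt :: "real \<Rightarrow> real \<Rightarrow> real \<Rightarrow> real \<Rightarrow> real" where
  "riem_tt g \<tau> q r = (let S = riem_S \<tau> q r; z = riem_z \<tau> q r; A = \<tau> + q; B = \<tau>\<^sup>2 - q\<^sup>2 + r\<^sup>2 in S powr (- g) *
     ((4 * g\<^sup>2 * A\<^sup>2 / S\<^sup>2 - 2 * g / S + 4 * g * A\<^sup>2 / S\<^sup>2) * hypF g z
      + (- (16 * g * q * A * B / S ^ 3) + 8 * q * \<tau> / S\<^sup>2 - 16 * q * A * B / S ^ 3) * hypF1 g z
      + 16 * q\<^sup>2 * B\<^sup>2 / S ^ 4 * hypF2 g z))"

text \<open>
  A region around \<open>0 \<le> r \<le> \<tau>\<close> on which \<open>S\<close> is positive and the argument \<open>z\<close> lies in \<open>(-1, 1)\<close>, so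
  that the kernel is smooth there, in particular up to and across the characteristic \<open>r = \<tau> - q\<close>.
\<close>

definition riem_dom :: "(real \<times> real \<times> real) set" where
  "riem_dom = {(\<tau>, q, r). 0 < \<tau> \<and> 0 < q \<and> r\<^sup>2 < \<tau>\<^sup>2 + q\<^sup>2}"

lemma riem_dom_iff: "(\<tau>, q, r) \<in> riem_dom \<longleftrightarrow> 0 < \<tau> \<and> 0 < q \<and> r\<^sup>2 < \<tau>\<^sup>2 + q\<^sup>2"
  by (simp add: riem_dom_def)

lemma riem_dom_I: "0 < \<tau> \<Longrightarrow> 0 < q \<Longrightarrow> 0 \<le> r \<Longrightarrow> r \<le> \<tau> \<Longrightarrow> (\<tau>, q, r) \<in> riem_dom"
  unfolding riem_dom_iff using power_mono[of r \<tau> 2] zero_less_power[of q 2] by linarith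

lemma riem_S_pos: "(\<tau>, q, r) \<in> riem_dom \<Longrightarrow> 0 < riem_S \<tau> q r"
proof -
  assume D: "(\<tau>, q, r) \<in> riem_dom"
  then have "0 < 2 * \<tau> * q" by (simp add: riem_dom_iff)
  moreover have "r\<^sup>2 < \<tau>\<^sup>2 + q\<^sup>2" using D by (simp add: riem_dom_iff)
  ultimately show ?thesis unfolding riem_S_def power2_sum by linarith
qed

lemma riem_z_eq: "(\<tau>, q, r) \<in> riem_dom \<Longrightarrow> 1 - riem_z \<tau> q r = 4 * \<tau> * q / riem_S \<tau> q r"
  using riem_S_pos[of \<tau> q r] by (simp add: riem_z_def field_simps) (simp add: riem_S_def power2_eq_square algebra_simps)

lemma riem_z_less: "(\<tau>, q, r) \<in> riem_dom \<Longrightarrow> \<bar>riem_z \<tau> q r\<bar> < 1"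
proof -
  assume D: "(\<tau>, q, r) \<in> riem_dom"
  have "riem_z \<tau> q r < 1"
  proof -
    have "0 < 4 * \<tau> * q / riem_S \<tau> q r" using riem_S_pos[OF D] D by (simp add: riem_dom_iff)
    then show ?thesis using riem_z_eq[OF D] by linarith
  qed
  moreover have "- 1 < riem_z \<tau> q r"
    using riem_S_pos[OF D] D by (simp add: riem_z_def field_simps) (simp add: riem_dom_iff riem_S_def power2_eq_square algebra_simps)
  ultimately show ?thesis by linarith
qed

lemma riem_S_deriv_t: "((\<lambda>\<tau>. riem_S \<tau> q r) has_real_derivative 2 * (\<tau> + q)) (at \<tau> within T)"
  unfolding riem_S_def by (auto intro!: derivative_eq_intros simp: power2_eq_square)

lemma riem_S_deriv_r: "((\<lambda>r. riem_S \<tau> q r) has_real_derivative - 2 * r) (at r within T)"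
  unfolding riem_S_def by (auto intro!: derivative_eq_intros simp: power2_eq_square)

lemma riem_z_deriv_t:
  assumes D: "(\<tau>, q, r) \<in> riem_dom"
  shows "((\<lambda>\<tau>. riem_z \<tau> q r) has_real_derivative 4 * q * (\<tau>\<^sup>2 - q\<^sup>2 + r\<^sup>2) / (riem_S \<tau> q r)\<^sup>2) (at \<tau> within T)"
proof -
  have S: "riem_S \<tau> q r \<noteq> 0" using riem_S_pos[OF D] by simp
  have "((\<lambda>\<tau>. riem_z \<tau> q r) has_real_derivative
     (2 * (\<tau> - q) * riem_S \<tau> q r - ((\<tau> - q)\<^sup>2 - r\<^sup>2) * (2 * (\<tau> + q))) / (riem_S \<tau> q r * riem_S \<tau> q r)) (at \<tau> within T)"
    unfolding riem_z_def by (rule derivative_eq_intros riem_S_deriv_t S refl | simp)+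
  also have "2 * (\<tau> - q) * riem_S \<tau> q r - ((\<tau> - q)\<^sup>2 - r\<^sup>2) * (2 * (\<tau> + q)) = 4 * q * (\<tau>\<^sup>2 - q\<^sup>2 + r\<^sup>2)"
    unfolding riem_S_def by algebra
  finally show ?thesis by (simp add: power2_eq_square)
qed

lemma riem_z_deriv_r:
  assumes D: "(\<tau>, q, r) \<in> riem_dom"
  shows "((\<lambda>r. riem_z \<tau> q r) has_real_derivative - 8 * \<tau> * q * r / (riem_S \<tau> q r)\<^sup>2) (at r within T)"
proof -
  have S: "riem_S \<tau> q r \<noteq> 0" using riem_S_pos[OF D] by simp
  have "((\<lambda>r. riem_z \<tau> q r) has_real_derivative
     ((- 2 * r) * riem_S \<tau> q r - ((\<tau> - q)\<^sup>2 - r\<^sup>2) * (- 2 * r)) / (riem_S \<tau> q r * riem_S \<tau> q r)) (at r within T)"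
    unfolding riem_z_def by (rule derivative_eq_intros riem_S_deriv_r S refl | simp)+
  also have "(- 2 * r) * riem_S \<tau> q r - ((\<tau> - q)\<^sup>2 - r\<^sup>2) * (- 2 * r) = - 8 * \<tau> * q * r"
    unfolding riem_S_def by algebra
  finally show ?thesis by (simp add: power2_eq_square)
qed

context
  fixes g :: real assumes g: "g < 1/2"
begin

lemma hypF_rZ_deriv:
  assumes D: "(\<tau>, q, r) \<in> riem_dom"
  shows "((\<lambda>\<tau>. hypF g (riem_z \<tau> q r)) has_real_derivative
            hypF1 g (riem_z \<tau> q r) * (4 * q * (\<tau>\<^sup>2 - q\<^sup>2 + r\<^sup>2) / (riem_S \<tau> q r)\<^sup>2)) (at \<tau> within T)"
    and "((\<lambda>r. hypF g (riem_z \<tau> q r)) has_real_derivative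
            hypF1 g (riem_z \<tau> q r) * (- 8 * \<tau> * q * r / (riem_S \<tau> q r)\<^sup>2)) (at r within T)"
    and "((\<lambda>\<tau>. hypF1 g (riem_z \<tau> q r)) has_real_derivative
            hypF2 g (riem_z \<tau> q r) * (4 * q * (\<tau>\<^sup>2 - q\<^sup>2 + r\<^sup>2) / (riem_S \<tau> q r)\<^sup>2)) (at \<tau> within T)"
    and "((\<lambda>r. hypF1 g (riem_z \<tau> q r)) has_real_derivative
            hypF2 g (riem_z \<tau> q r) * (- 8 * \<tau> * q * r / (riem_S \<tau> q r)\<^sup>2)) (at r within T)"
  by (rule DERIV_chain2[OF _ riem_z_deriv_t[OF D]] DERIV_chain2[OF _ riem_z_deriv_r[OF D]]
        hypF_deriv[OF g riem_z_less[OF D]] hypF1_deriv[OF g riem_z_less[OF D]])+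

lemma riem_S_powr_deriv:
  assumes D: "(\<tau>, q, r) \<in> riem_dom"
  shows "((\<lambda>\<tau>. riem_S \<tau> q r powr (- g)) has_real_derivative
            riem_S \<tau> q r powr (- g) * (- (2 * g * (\<tau> + q) / riem_S \<tau> q r))) (at \<tau> within T)"
    and "((\<lambda>r. riem_S \<tau> q r powr (- g)) has_real_derivative
            riem_S \<tau> q r powr (- g) * (2 * g * r / riem_S \<tau> q r)) (at r within T)"
proof -
  have S: "riem_S \<tau> q r > 0" using riem_S_pos[OF D] .
  have P: "riem_S \<tau> q r powr (- g - 1) = riem_S \<tau> q r powr (- g) / riem_S \<tau> q r"
    using S by (simp add: powr_diff)
  show "((\<lambda>\<tau>. riem_S \<tau> q r powr (- g)) has_real_derivative
            riem_S \<tau> q r powr (- g) * (- (2 * g * (\<tau> + q) / riem_S \<tau> q r))) (at \<tau> within T)"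
    by (rule DERIV_cong[OF DERIV_chain2[OF has_real_derivative_powr[OF S] riem_S_deriv_t]]) (simp add: P)
  show "((\<lambda>r. riem_S \<tau> q r powr (- g)) has_real_derivative
            riem_S \<tau> q r powr (- g) * (2 * g * r / riem_S \<tau> q r)) (at r within T)"
    by (rule DERIV_cong[OF DERIV_chain2[OF has_real_derivative_powr[OF S] riem_S_deriv_r]]) (simp add: P)
qed

lemma riem_deriv_t:
  assumes D: "(\<tau>, q, r) \<in> riem_dom"
  shows "((\<lambda>\<tau>. riem g \<tau> q r) has_real_derivative riem_t g \<tau> q r) (at \<tau> within T)"
  unfolding riem_def
  by (rule DERIV_cong[OF DERIV_mult[OF riem_S_powr_deriv(1)[OF D] hypF_rZ_deriv(1)[OF D]]])
     (simp add: riem_t_def algebra_simps)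

lemma riem_deriv_r:
  assumes D: "(\<tau>, q, r) \<in> riem_dom"
  shows "((\<lambda>r. riem g \<tau> q r) has_real_derivative riem_r g \<tau> q r) (at r within T)"
  unfolding riem_def
  by (rule DERIV_cong[OF DERIV_mult[OF riem_S_powr_deriv(2)[OF D] hypF_rZ_deriv(2)[OF D]]])
     (simp add: riem_r_def algebra_simps)

lemma riem_t_deriv_t:
  assumes D: "(\<tau>, q, r) \<in> riem_dom"
  shows "((\<lambda>\<tau>. riem_t g \<tau> q r) has_real_derivative riem_tt g \<tau> q r) (at \<tau> within T)"
proof -
  let ?S = "riem_S \<tau> q r" and ?A = "\<tau> + q" and ?B = "\<tau>\<^sup>2 - q\<^sup>2 + r\<^sup>2"
  let ?P = "?S powr (- g)"
  have S: "?S \<noteq> 0" using riem_S_pos[OF D] by simp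
  have a: "((\<lambda>\<tau>. - (2 * g * (\<tau> + q) / riem_S \<tau> q r)) has_real_derivative
        - (2 * g / ?S) + 4 * g * ?A\<^sup>2 / ?S\<^sup>2) (at \<tau> within T)"
    by (rule derivative_eq_intros riem_S_deriv_t S refl | simp)+
       (simp add: divide_simps S power2_eq_square, (simp add: algebra_simps)?)
  have b: "((\<lambda>\<tau>. 4 * q * (\<tau>\<^sup>2 - q\<^sup>2 + r\<^sup>2) / (riem_S \<tau> q r)\<^sup>2) has_real_derivative
        8 * q * \<tau> / ?S\<^sup>2 - 16 * q * ?A * ?B / ?S ^ 3) (at \<tau> within T)"
    by (rule derivative_eq_intros riem_S_deriv_t S refl | simp add: S)+
       (simp add: divide_simps S power2_eq_square power3_eq_cube power4_eq_xxxx, (simp add: algebra_simps)?)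
  show ?thesis
    unfolding riem_t_def
    by (rule DERIV_cong[OF DERIV_mult[OF riem_S_powr_deriv(1)[OF D] DERIV_add[OF
        DERIV_mult[OF a hypF_rZ_deriv(1)[OF D]] DERIV_mult[OF b hypF_rZ_deriv(3)[OF D]]]]])
       (simp add: riem_tt_def Let_def divide_simps S power2_eq_square power3_eq_cube power4_eq_xxxx,
        simp add: algebra_simps)
qed

lemma riem_r_deriv_r:
  assumes D: "(\<tau>, q, r) \<in> riem_dom"
  shows "((\<lambda>r. riem_r g \<tau> q r) has_real_derivative riem_rr g \<tau> q r) (at r within T)"
proof -
  let ?S = "riem_S \<tau> q r"
  let ?P = "?S powr (- g)"
  have S: "?S \<noteq> 0" using riem_S_pos[OF D] by simp
  have a: "((\<lambda>r. 2 * g * r / riem_S \<tau> q r) has_real_derivative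
        2 * g / ?S + 4 * g * r\<^sup>2 / ?S\<^sup>2) (at r within T)"
    by (rule derivative_eq_intros riem_S_deriv_r S refl | simp)+
       (simp add: divide_simps S power2_eq_square, (simp add: algebra_simps)?)
  have b: "((\<lambda>r. 8 * \<tau> * q * r / (riem_S \<tau> q r)\<^sup>2) has_real_derivative
        8 * \<tau> * q / ?S\<^sup>2 + 32 * \<tau> * q * r\<^sup>2 / ?S ^ 3) (at r within T)"
    by (rule derivative_eq_intros riem_S_deriv_r S refl | simp add: S)+
       (simp add: divide_simps S power2_eq_square power3_eq_cube power4_eq_xxxx, (simp add: algebra_simps)?)
  show ?thesis
    unfolding riem_r_def
    by (rule DERIV_cong[OF DERIV_mult[OF riem_S_powr_deriv(2)[OF D] DERIV_diff[OF
        DERIV_mult[OF a hypF_rZ_deriv(2)[OF D]] DERIV_mult[OF b hypF_rZ_deriv(4)[OF D]]]]])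
       (simp add: riem_rr_def Let_def divide_simps S power2_eq_square power3_eq_cube power4_eq_xxxx,
        simp add: algebra_simps)
qed

text \<open>
  By the chain rule both sides are combinations of \<open>F\<close>, \<open>F'\<close>, \<open>F''\<close>. Their difference is
  \<open>4q/(S\<tau>)\<close> times Gauss's equation; the three coefficients are compared separately.
\<close>

lemma riem_pde:
  assumes D: "(\<tau>, q, r) \<in> riem_dom"
  shows "riem_tt g \<tau> q r + 2 * g / \<tau> * riem_t g \<tau> q r = riem_rr g \<tau> q r"
proof -
  define S where "S = riem_S \<tau> q r"
  define z where "z = riem_z \<tau> q r"
  define B where "B = \<tau>\<^sup>2 - q\<^sup>2 + r\<^sup>2"
  define A where "A = \<tau> + q"
  define N where "N = (\<tau> - q)\<^sup>2 - r\<^sup>2"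
  have S: "S \<noteq> 0" using riem_S_pos[OF D] by (simp add: S_def)
  have t: "\<tau> \<noteq> 0" using D by (auto simp: riem_dom_iff)
  have zN: "z = N / S" by (simp add: z_def riem_z_def S_def N_def)
  have z1: "1 - z = 4 * \<tau> * q / S" using riem_z_eq[OF D] by (simp add: z_def S_def)
  have zz: "z * (1 - z) = N / S * (4 * \<tau> * q / S)" unfolding z1 by (simp add: zN)
  have ode: "z * (1 - z) * hypF2 g z + (1 - (2*g + 1) * z) * hypF1 g z - g\<^sup>2 * hypF g z = 0"
    unfolding z_def by (rule hyp_ode[OF g riem_z_less[OF D]])
  have SA: "S = A\<^sup>2 - r\<^sup>2" by (simp add: S_def riem_S_def A_def)
  \<comment> \<open>The coefficients of \<open>F''\<close>, \<open>F'\<close> and \<open>F\<close>; each is a polynomial identity after clearing \<open>S\<close> and \<open>\<tau>\<close>.\<close>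
  have p2: "B\<^sup>2 - 4 * \<tau>\<^sup>2 * r\<^sup>2 = N * S"
    unfolding SA B_def N_def A_def by algebra
  have c2: "16 * q\<^sup>2 * B\<^sup>2 / S ^ 4 - 64 * \<tau>\<^sup>2 * q\<^sup>2 * r\<^sup>2 / S ^ 4 = 4 * q / (S * \<tau>) * (z * (1 - z))"
  proof -
    have "16 * q\<^sup>2 * B\<^sup>2 / S ^ 4 - 64 * \<tau>\<^sup>2 * q\<^sup>2 * r\<^sup>2 / S ^ 4 = 16 * q\<^sup>2 * (B\<^sup>2 - 4 * \<tau>\<^sup>2 * r\<^sup>2) / S ^ 4"
      by (simp add: diff_divide_distrib right_diff_distrib)
    also have "\<dots> = 4 * q / (S * \<tau>) * (z * (1 - z))"
      unfolding p2 zz using S t by (simp add: field_simps power2_eq_square power4_eq_xxxx)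
    finally show ?thesis .
  qed
  have p1: "- 4 * g * \<tau> * A * B + 2 * \<tau>\<^sup>2 * S - 4 * \<tau> * A * B + 2 * g * B * S + 8 * g * \<tau>\<^sup>2 * r\<^sup>2 + 2 * \<tau>\<^sup>2 * S + 8 * \<tau>\<^sup>2 * r\<^sup>2
     = S\<^sup>2 - (2 * g + 1) * N * S"
    unfolding SA B_def N_def A_def by algebra
  have c1: "- (16 * g * q * A * B / S ^ 3) + 8 * q * \<tau> / S\<^sup>2 - 16 * q * A * B / S ^ 3
      + 2 * g / \<tau> * (4 * q * B / S\<^sup>2)
      + (32 * g * \<tau> * q * r\<^sup>2 / S ^ 3 + 8 * \<tau> * q / S\<^sup>2 + 32 * \<tau> * q * r\<^sup>2 / S ^ 3)
      = 4 * q / (S * \<tau>) * (1 - (2*g + 1) * z)" (is "?l = ?r")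
  proof -
    have "?l = 4 * q / (S ^ 3 * \<tau>) * (- 4 * g * \<tau> * A * B + 2 * \<tau>\<^sup>2 * S - 4 * \<tau> * A * B + 2 * g * B * S + 8 * g * \<tau>\<^sup>2 * r\<^sup>2 + 2 * \<tau>\<^sup>2 * S + 8 * \<tau>\<^sup>2 * r\<^sup>2)"
      using S t by (simp add: divide_simps power2_eq_square power3_eq_cube) (simp add: algebra_simps)
    also have "\<dots> = ?r" unfolding p1 zN
      using S t by (simp add: divide_simps power2_eq_square power3_eq_cube) (simp add: algebra_simps)
    finally show ?thesis .
  qed
  have p0: "4 * g\<^sup>2 * A\<^sup>2 * \<tau> - 2 * g * S * \<tau> + 4 * g * A\<^sup>2 * \<tau> - 4 * g\<^sup>2 * A * S - (4 * g\<^sup>2 * r\<^sup>2 * \<tau> + 2 * g * S * \<tau> + 4 * g * r\<^sup>2 * \<tau>) = - 4 * q * g\<^sup>2 * S"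
    unfolding SA A_def by algebra
  have c0: "4 * g\<^sup>2 * A\<^sup>2 / S\<^sup>2 - 2 * g / S + 4 * g * A\<^sup>2 / S\<^sup>2 - 2 * g / \<tau> * (2 * g * A / S)
      - (4 * g\<^sup>2 * r\<^sup>2 / S\<^sup>2 + 2 * g / S + 4 * g * r\<^sup>2 / S\<^sup>2) = 4 * q / (S * \<tau>) * (- g\<^sup>2)" (is "?l = ?r")
  proof -
    have "?l = (4 * g\<^sup>2 * A\<^sup>2 * \<tau> - 2 * g * S * \<tau> + 4 * g * A\<^sup>2 * \<tau> - 4 * g\<^sup>2 * A * S - (4 * g\<^sup>2 * r\<^sup>2 * \<tau> + 2 * g * S * \<tau> + 4 * g * r\<^sup>2 * \<tau>)) / (S\<^sup>2 * \<tau>)"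
      using S t by (simp add: divide_simps power2_eq_square) (simp add: algebra_simps)
    also have "\<dots> = ?r" unfolding p0
      using S t by (simp add: divide_simps power2_eq_square)
    finally show ?thesis .
  qed
  have "riem_tt g \<tau> q r + 2 * g / \<tau> * riem_t g \<tau> q r - riem_rr g \<tau> q r = S powr (- g) *
    ((4 * g\<^sup>2 * A\<^sup>2 / S\<^sup>2 - 2 * g / S + 4 * g * A\<^sup>2 / S\<^sup>2 - 2 * g / \<tau> * (2 * g * A / S)
      - (4 * g\<^sup>2 * r\<^sup>2 / S\<^sup>2 + 2 * g / S + 4 * g * r\<^sup>2 / S\<^sup>2)) * hypF g z
     + (- (16 * g * q * A * B / S ^ 3) + 8 * q * \<tau> / S\<^sup>2 - 16 * q * A * B / S ^ 3
      + 2 * g / \<tau> * (4 * q * B / S\<^sup>2)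
      + (32 * g * \<tau> * q * r\<^sup>2 / S ^ 3 + 8 * \<tau> * q / S\<^sup>2 + 32 * \<tau> * q * r\<^sup>2 / S ^ 3)) * hypF1 g z
     + (16 * q\<^sup>2 * B\<^sup>2 / S ^ 4 - 64 * \<tau>\<^sup>2 * q\<^sup>2 * r\<^sup>2 / S ^ 4) * hypF2 g z)"
    unfolding riem_tt_def riem_t_def riem_rr_def Let_def S_def[symmetric] z_def[symmetric] B_def[symmetric] A_def[symmetric]
    by algebra
  also have "\<dots> = S powr (- g) * (4 * q / (S * \<tau>)) *
     (z * (1 - z) * hypF2 g z + (1 - (2*g + 1) * z) * hypF1 g z - g\<^sup>2 * hypF g z)"
    unfolding c0 c1 c2 by (simp only: algebra_simps)
  finally show ?thesis unfolding ode by simp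
qed

text \<open>
  The argument \<open>z\<close> vanishes on the characteristic. The second identity is the transport equation:
  the derivative of \<open>k\<close> along the characteristic is that of \<open>(4\<tau>q)\<^sup>-\<^sup>g\<close>.
\<close>

lemma riem_characteristic:
  assumes "0 < q" "q \<le> \<tau>"
  shows "riem g \<tau> q (\<tau> - q) = (4 * \<tau> * q) powr (- g)"
    and "riem_t g \<tau> q (\<tau> - q) + riem_r g \<tau> q (\<tau> - q) = - (g / \<tau>) * riem g \<tau> q (\<tau> - q)"
proof -
  have S: "riem_S \<tau> q (\<tau> - q) = 4 * \<tau> * q" by (simp add: riem_S_def power2_eq_square algebra_simps)
  have Z: "riem_z \<tau> q (\<tau> - q) = 0" by (simp add: riem_z_def)
  show "riem g \<tau> q (\<tau> - q) = (4 * \<tau> * q) powr (- g)" by (simp add: riem_def S Z)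
  have t: "\<tau> > 0" using assms by linarith
  have "riem_t g \<tau> q (\<tau> - q) + riem_r g \<tau> q (\<tau> - q) = (4 * \<tau> * q) powr (- g) *
    ((- (2 * g * (\<tau> + q) / (4 * \<tau> * q)) + 2 * g * (\<tau> - q) / (4 * \<tau> * q))
      + (4 * q * (\<tau>\<^sup>2 - q\<^sup>2 + (\<tau> - q)\<^sup>2) - 8 * \<tau> * q * (\<tau> - q)) / (4 * \<tau> * q)\<^sup>2 * hypF1 g 0)"
    unfolding riem_t_def riem_r_def S Z hypF_0 diff_divide_distrib by algebra
  also have "4 * q * (\<tau>\<^sup>2 - q\<^sup>2 + (\<tau> - q)\<^sup>2) - 8 * \<tau> * q * (\<tau> - q) = 0" by algebra
  also have "- (2 * g * (\<tau> + q) / (4 * \<tau> * q)) + 2 * g * (\<tau> - q) / (4 * \<tau> * q) = - (g / \<tau>)"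
    using t assms by (simp add: field_simps)
  finally show "riem_t g \<tau> q (\<tau> - q) + riem_r g \<tau> q (\<tau> - q) = - (g / \<tau>) * riem g \<tau> q (\<tau> - q)"
    by (simp add: riem_def S Z)
qed

lemma riem_r_0 [simp]: "riem_r g \<tau> q 0 = 0"
  by (simp add: riem_r_def)

lemma hyp_continuous_on:
  "continuous_on {-1<..<1} (hypF g)" "continuous_on {-1<..<1} (hypF1 g)" "continuous_on {-1<..<1} (hypF2 g)"
  using DERIV_isCont[OF hypF_deriv[OF g]] DERIV_isCont[OF hypF1_deriv[OF g]] isCont_hypF2[OF g]
  by (auto intro!: continuous_at_imp_continuous_on)

lemma riem_S_continuous: "continuous_on riem_dom (\<lambda>(\<tau>, q, r). riem_S \<tau> q r)"
  unfolding riem_S_def case_prod_unfold by (intro continuous_intros)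

lemma riem_z_continuous: "continuous_on riem_dom (\<lambda>(\<tau>, q, r). riem_z \<tau> q r)"
  unfolding riem_z_def case_prod_unfold
  by (intro continuous_intros riem_S_continuous[unfolded case_prod_unfold])
     (use riem_S_pos in \<open>fastforce\<close>)

lemma riem_S_powr_continuous: "continuous_on riem_dom (\<lambda>(\<tau>, q, r). riem_S \<tau> q r powr (- g))"
  unfolding case_prod_unfold
  by (intro continuous_on_powr continuous_intros riem_S_continuous[unfolded case_prod_unfold])
     (use riem_S_pos in \<open>fastforce\<close>)

lemma hyp_rZ_continuous:
  "continuous_on riem_dom (\<lambda>p. hypF g (riem_z (fst p) (fst (snd p)) (snd (snd p))))"
  "continuous_on riem_dom (\<lambda>p. hypF1 g (riem_z (fst p) (fst (snd p)) (snd (snd p))))"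
  "continuous_on riem_dom (\<lambda>p. hypF2 g (riem_z (fst p) (fst (snd p)) (snd (snd p))))"
proof -
  have im: "(\<lambda>p. riem_z (fst p) (fst (snd p)) (snd (snd p))) ` riem_dom \<subseteq> {-1<..<1}"
    using riem_z_less by (force simp: abs_less_iff)
  note c = continuous_on_compose2[OF _ riem_z_continuous[unfolded case_prod_unfold] im]
  show "continuous_on riem_dom (\<lambda>p. hypF g (riem_z (fst p) (fst (snd p)) (snd (snd p))))"
    "continuous_on riem_dom (\<lambda>p. hypF1 g (riem_z (fst p) (fst (snd p)) (snd (snd p))))"
    "continuous_on riem_dom (\<lambda>p. hypF2 g (riem_z (fst p) (fst (snd p)) (snd (snd p))))"
    by (rule c hyp_continuous_on)+
qed

lemma riem_continuous:
  "continuous_on riem_dom (\<lambda>(\<tau>, q, r). riem g \<tau> q r)"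
  "continuous_on riem_dom (\<lambda>(\<tau>, q, r). riem_t g \<tau> q r)"
  "continuous_on riem_dom (\<lambda>(\<tau>, q, r). riem_tt g \<tau> q r)"
  "continuous_on riem_dom (\<lambda>(\<tau>, q, r). riem_rr g \<tau> q r)"
  unfolding riem_def riem_t_def riem_tt_def riem_rr_def Let_def case_prod_unfold
  by (intro continuous_intros riem_S_continuous[unfolded case_prod_unfold] hyp_rZ_continuous
        riem_S_powr_continuous[unfolded case_prod_unfold]; use riem_S_pos in \<open>fastforce\<close>)+

lemma riem_z_bounds:
  assumes "0 < q" "q \<le> \<tau>" "0 \<le> r" "r \<le> \<tau> - q"
  shows "0 \<le> riem_z \<tau> q r" "riem_z \<tau> q r < 1" "4 * \<tau> * q \<le> riem_S \<tau> q r"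
proof -
  have D: "(\<tau>, q, r) \<in> riem_dom" using assms by (intro riem_dom_I) auto
  have r2: "r\<^sup>2 \<le> (\<tau> - q)\<^sup>2" using assms by (intro power_mono) auto
  show "0 \<le> riem_z \<tau> q r" unfolding riem_z_def using r2 riem_S_pos[OF D] by simp
  show "riem_z \<tau> q r < 1" using riem_z_less[OF D] by simp
  show "4 * \<tau> * q \<le> riem_S \<tau> q r" using r2 by (simp add: riem_S_def power2_eq_square algebra_simps)
qed

lemma riem_bound:
  assumes "0 < q" "q \<le> \<tau>" "0 \<le> r" "r \<le> \<tau> - q"
  shows "\<bar>riem g \<tau> q r\<bar> \<le> hypF g 1 * riem_S \<tau> q r powr (- g)"
  using hypF_nonneg[OF g, of "riem_z \<tau> q r"] hypF_le[OF g, of "riem_z \<tau> q r"] riem_z_bounds[OF assms]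
  unfolding riem_def abs_mult mult.commute[of "hypF g 1"]
  by (auto intro!: mult_mono)

text \<open>
  Since \<open>1 - z = 4\<tau>q/S\<close>, the factor \<open>q\<close> in front of \<open>F'\<close> is exactly what makes
  \<open>(1 - z) F'(z) \<le> F(1)\<close> applicable.
\<close>

lemma riem_t_bound:
  assumes "0 < q" "q \<le> \<tau>" "0 \<le> r" "r \<le> \<tau> - q"
  shows "\<bar>riem_t g \<tau> q r\<bar> \<le> (4 * \<bar>g\<bar> + 2) * hypF g 1 * \<tau> * riem_S \<tau> q r powr (- g - 1)"
proof -
  let ?S = "riem_S \<tau> q r" and ?z = "riem_z \<tau> q r"
  have D: "(\<tau>, q, r) \<in> riem_dom" using assms by (intro riem_dom_I) auto
  note S = riem_S_pos[OF D]
  have t: "\<tau> > 0" using assms by linarith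
  have F: "0 \<le> hypF g ?z" "hypF g ?z \<le> hypF g 1" "0 \<le> hypF1 g ?z"
    using hypF_nonneg[OF g, of ?z] hypF_le[OF g, of ?z] hypF1_nonneg_mono[OF g, of ?z ?z] riem_z_bounds[OF assms]
    by auto
  have "(1 - ?z) * hypF1 g ?z \<le> hypF g 1" by (rule hypF1_bound[OF g]) (use riem_z_bounds[OF assms] in auto)
  then have F1: "4 * \<tau> * q / ?S * hypF1 g ?z \<le> hypF g 1" unfolding riem_z_eq[OF D] .
  have "\<bar>- (2 * g * (\<tau> + q) / ?S) * hypF g ?z\<bar> = (2 * \<bar>g\<bar> * hypF g ?z) * (\<tau> + q) / ?S"
    using F S assms by (simp add: abs_mult)
  also have "\<dots> \<le> (2 * \<bar>g\<bar> * hypF g 1) * (2 * \<tau>) / ?S"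
    using F S assms by (intro divide_right_mono mult_mono) auto
  finally have a: "\<bar>- (2 * g * (\<tau> + q) / ?S) * hypF g ?z\<bar> \<le> 4 * \<bar>g\<bar> * hypF g 1 * \<tau> / ?S" by simp
  have r2: "r\<^sup>2 \<le> \<tau>\<^sup>2" "q\<^sup>2 \<le> \<tau>\<^sup>2" using assms by (auto intro!: power_mono)
  have B: "0 \<le> \<tau>\<^sup>2 - q\<^sup>2 + r\<^sup>2" "\<tau>\<^sup>2 - q\<^sup>2 + r\<^sup>2 \<le> 2 * \<tau>\<^sup>2" using r2 by (smt (verit) zero_le_power2)+
  have "\<bar>4 * q * (\<tau>\<^sup>2 - q\<^sup>2 + r\<^sup>2) / ?S\<^sup>2 * hypF1 g ?z\<bar> = (\<tau>\<^sup>2 - q\<^sup>2 + r\<^sup>2) * (4 * q / ?S\<^sup>2 * hypF1 g ?z)"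
    using F S assms B by (simp add: abs_mult)
  also have "\<dots> \<le> (2 * \<tau>\<^sup>2) * (4 * q / ?S\<^sup>2 * hypF1 g ?z)"
    using F S assms B by (intro mult_right_mono) auto
  also have "\<dots> = 2 * \<tau> / ?S * (4 * \<tau> * q / ?S * hypF1 g ?z)"
    using S by (simp add: power2_eq_square)
  also have "\<dots> \<le> 2 * \<tau> / ?S * hypF g 1"
    using F1 S t by (intro mult_left_mono) auto
  finally have b: "\<bar>4 * q * (\<tau>\<^sup>2 - q\<^sup>2 + r\<^sup>2) / ?S\<^sup>2 * hypF1 g ?z\<bar> \<le> 2 * \<tau> / ?S * hypF g 1" .
  have "\<bar>riem_t g \<tau> q r\<bar> \<le> ?S powr (- g) * (4 * \<bar>g\<bar> * hypF g 1 * \<tau> / ?S + 2 * \<tau> / ?S * hypF g 1)"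
    unfolding riem_t_def abs_mult[of "?S powr (- g)"]
  proof (intro mult_mono)
    show "\<bar>- (2 * g * (\<tau> + q) / ?S) * hypF g ?z + 4 * q * (\<tau>\<^sup>2 - q\<^sup>2 + r\<^sup>2) / ?S\<^sup>2 * hypF1 g ?z\<bar>
        \<le> 4 * \<bar>g\<bar> * hypF g 1 * \<tau> / ?S + 2 * \<tau> / ?S * hypF g 1"
      using a b by (rule order_trans[OF abs_triangle_ineq add_mono])
  qed auto
  also have "\<dots> = (4 * \<bar>g\<bar> + 2) * hypF g 1 * \<tau> * ?S powr (- g - 1)"
    using S by (simp add: powr_diff field_simps)
  finally show ?thesis .
qed

end

lemma kernel_eq: "kernel l t b r = riem (gam l) (phi l t) (phi l b) r"
  by (simp add: kernel_def riem_def riem_S_def riem_z_def hypergeo_F_eq)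

section \<open>Duhamel's formula for fixed b\<close>

text \<open>
  The derivative under a fixed interval of integration comes from the Leibniz rule; the change of the
  endpoint contributes the boundary value by continuity. The functions are only required on
  \<open>r \<le> \<tau>\<close>, because the kernel is singular for larger \<open>r\<close>, and the derivative is one-sided at \<open>q\<close>.
\<close>

lemma leibniz_moving_endpoint:
  fixes h h' :: "real \<Rightarrow> real \<Rightarrow> 'b::banach"
  defines "D \<equiv> \<lambda>q T. {(\<tau>, r). q \<le> \<tau> \<and> \<tau> \<le> T \<and> 0 \<le> r \<and> r \<le> (\<tau>::real)}"
  assumes q: "0 < q" "q \<le> \<tau>0" "\<tau>0 \<le> T"
    and h: "continuous_on (D q T) (\<lambda>(\<tau>, r). h \<tau> r)"
    and h': "continuous_on (D q T) (\<lambda>(\<tau>, r). h' \<tau> r)"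
    and deriv: "\<And>\<tau> r. (\<tau>, r) \<in> D q T \<Longrightarrow> ((\<lambda>\<tau>. h \<tau> r) has_vector_derivative h' \<tau> r) (at \<tau> within {q..T})"
  shows "((\<lambda>\<tau>. integral {0..\<tau> - q} (h \<tau>)) has_vector_derivative
            h \<tau>0 (\<tau>0 - q) + integral {0..\<tau>0 - q} (h' \<tau>0)) (at \<tau>0 within {q..T})"
proof -
  define y where "y = \<tau>0 - q"
  have y: "0 \<le> y" "y < \<tau>0" using q by (auto simp: y_def)
  \<comment> \<open>Near \<open>\<tau>0\<close> the interval \<open>[0, y]\<close> stays in the region \<open>r \<le> \<tau>\<close>.\<close>
  define U where "U = {q..T} \<inter> {y<..}"
  have \<tau>0U: "\<tau>0 \<in> U" using q y by (auto simp: U_def)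
  have at: "at \<tau>0 within U = at \<tau>0 within {q..T}"
    by (rule at_within_nhd[of _ "{y<..}"]) (use y in \<open>auto simp: U_def\<close>)
  have UD: "U \<times> cbox 0 y \<subseteq> D q T" by (auto simp: U_def D_def)
  have hint: "(h \<tau>) integrable_on {a..b}" if "q \<le> \<tau>" "\<tau> \<le> T" "0 \<le> a" "b \<le> \<tau>" for \<tau> a b
    by (intro integrable_continuous_real continuous_on_compose2[OF h, of _ "\<lambda>r. (\<tau>, r)", simplified])
       (use that in \<open>auto simp: D_def intro!: continuous_intros\<close>)
  have p1: "((\<lambda>\<tau>. integral {0..y} (h \<tau>)) has_vector_derivative integral {0..y} (h' \<tau>0)) (at \<tau>0 within {q..T})"
  proof -
    have "((\<lambda>\<tau>. integral (cbox 0 y) (h \<tau>)) has_vector_derivative integral (cbox 0 y) (h' \<tau>0)) (at \<tau>0 within U)"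
    proof (rule leibniz_rule_vector_derivative)
      show "((\<lambda>\<tau>. h \<tau> t) has_vector_derivative h' x t) (at x within U)" if "x \<in> U" "t \<in> cbox 0 y" for x t
        by (rule has_vector_derivative_within_subset[OF deriv]) (use that in \<open>auto simp: U_def D_def\<close>)
      show "h x integrable_on cbox 0 y" if "x \<in> U" for x
        using hint[of x 0 y] that by (auto simp: U_def)
      show "continuous_on (U \<times> cbox 0 y) (\<lambda>(x, t). h' x t)"
        by (rule continuous_on_subset[OF h' UD])
      show "convex U" unfolding U_def by (intro convex_Int) auto
    qed (rule \<tau>0U)
    then show ?thesis unfolding at by simp
  qed
  define \<Delta> where "\<Delta> \<tau> = integral {0..\<tau> - q} (h \<tau>) - integral {0..y} (h \<tau>)" for \<tau>
  have p2: "(\<Delta> has_vector_derivative h \<tau>0 y) (at \<tau>0 within {q..T})"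
    unfolding has_vector_derivative_def has_derivative_within_alt
  proof (intro conjI allI impI bounded_linear_scaleR_left)
    fix e :: real assume e: "0 < e"
    have "(\<tau>0, y) \<in> D q T" using q y by (auto simp: D_def)
    then obtain d where d: "d > 0" "\<And>p. p \<in> D q T \<Longrightarrow> dist p (\<tau>0, y) < d \<Longrightarrow> dist ((\<lambda>(\<tau>, r). h \<tau> r) p) (h \<tau>0 y) < e"
      using h e unfolding continuous_on_iff by fastforce
    have close: "norm (h \<tau> r - h \<tau>0 y) \<le> e" if "(\<tau>, r) \<in> D q T" "\<bar>\<tau> - \<tau>0\<bar> < d / 2" "\<bar>r - y\<bar> < d / 2" for \<tau> r
    proof -
      have "dist (\<tau>, r) (\<tau>0, y) \<le> \<bar>\<tau> - \<tau>0\<bar> + \<bar>r - y\<bar>"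
        unfolding dist_prod_def dist_real_def by (rule order_trans[OF sqrt_sum_squares_le_sum_abs]) simp
      also have "\<dots> < d" using that by simp
      finally show ?thesis using d(2)[OF that(1)] by (simp add: dist_norm less_imp_le)
    qed
    show "\<exists>d>0. \<forall>\<tau>\<in>{q..T}. norm (\<tau> - \<tau>0) < d \<longrightarrow>
         norm (\<Delta> \<tau> - \<Delta> \<tau>0 - (\<tau> - \<tau>0) *\<^sub>R h \<tau>0 y) \<le> e * norm (\<tau> - \<tau>0)"
    proof (intro exI conjI ballI impI)
      show "min (d / 2) q > 0" using d q by simp
      fix \<tau> assume \<tau>: "\<tau> \<in> {q..T}" and n: "norm (\<tau> - \<tau>0) < min (d / 2) q"
      have \<Delta>0: "\<Delta> \<tau>0 = 0" by (simp add: \<Delta>_def y_def)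
      have yt: "y \<le> \<tau>" using n by (auto simp: y_def abs_real_def split: if_splits)
      have bnd: "norm (integral {a..b} (h \<tau>) - (b - a) *\<^sub>R h \<tau>0 y) \<le> e * (b - a)"
        if ab: "0 \<le> a" "a \<le> b" "b \<le> \<tau>" "\<bar>a - y\<bar> < d / 2" "\<bar>b - y\<bar> < d / 2" for a b
      proof -
        have i: "h \<tau> integrable_on {a..b}" using hint[of \<tau> a b] \<tau> ab by auto
        have "integral {a..b} (h \<tau>) - (b - a) *\<^sub>R h \<tau>0 y = integral {a..b} (\<lambda>r. h \<tau> r - h \<tau>0 y)"
          using i ab by (subst integral_diff) auto
        also have "norm \<dots> \<le> e * (b - a)"
        proof (rule integral_bound)
          show "a \<le> b" by fact
          show "continuous_on {a..b} (\<lambda>r. h \<tau> r - h \<tau>0 y)"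
            by (intro continuous_intros continuous_on_compose2[OF h, of _ "\<lambda>r. (\<tau>, r)", simplified])
               (use ab \<tau> in \<open>auto simp: D_def\<close>)
          show "norm (h \<tau> r - h \<tau>0 y) \<le> e" if "r \<in> {a..b}" for r
            by (rule close) (use that ab \<tau> n in \<open>auto simp: D_def abs_real_def split: if_splits\<close>)
        qed
        finally show ?thesis .
      qed
      show "norm (\<Delta> \<tau> - \<Delta> \<tau>0 - (\<tau> - \<tau>0) *\<^sub>R h \<tau>0 y) \<le> e * norm (\<tau> - \<tau>0)"
      proof (cases "\<tau> \<ge> \<tau>0")
        case True
        have "\<Delta> \<tau> = integral {y..\<tau> - q} (h \<tau>)"
          unfolding \<Delta>_def using True y q \<tau> hint[of \<tau> 0 "\<tau> - q"]
          by (subst Henstock_Kurzweil_Integration.integral_combine[of 0 y "\<tau> - q", symmetric]) (auto simp: y_def)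
        then show ?thesis using bnd[of y "\<tau> - q"] True y n q \<Delta>0 by (auto simp: y_def)
      next
        case False
        have "\<Delta> \<tau> = - integral {\<tau> - q..y} (h \<tau>)"
          unfolding \<Delta>_def using False y q \<tau> hint[of \<tau> 0 y] yt
          by (subst Henstock_Kurzweil_Integration.integral_combine[of 0 "\<tau> - q" y, symmetric]) (auto simp: y_def)
        moreover have "norm (integral {\<tau> - q..y} (h \<tau>) - (\<tau>0 - \<tau>) *\<^sub>R h \<tau>0 y) \<le> e * (\<tau>0 - \<tau>)"
          using bnd[of "\<tau> - q" y] False y n q \<tau> yt by (auto simp: y_def)
        moreover have "norm (- integral {\<tau> - q..y} (h \<tau>) - (\<tau> - \<tau>0) *\<^sub>R h \<tau>0 y)
            = norm (integral {\<tau> - q..y} (h \<tau>) - (\<tau>0 - \<tau>) *\<^sub>R h \<tau>0 y)"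
          by (subst norm_minus_cancel[symmetric]) (simp add: algebra_simps)
        ultimately show ?thesis using \<Delta>0 False by (simp only:) simp
      qed
    qed
  qed
  have "((\<lambda>\<tau>. \<Delta> \<tau> + integral {0..y} (h \<tau>)) has_vector_derivative h \<tau>0 y + integral {0..y} (h' \<tau>0)) (at \<tau>0 within {q..T})"
    by (rule has_vector_derivative_add[OF p2 p1])
  then show ?thesis by (simp add: \<Delta>_def y_def)
qed

text \<open>
  The Duhamel integral of \<open>G\<close>, and its derivative in \<open>\<tau>\<close>.
\<close>

definition epd :: "real \<Rightarrow> real \<Rightarrow> (real \<Rightarrow> complex) \<Rightarrow> real \<Rightarrow> complex" where
  "epd g q G \<tau> = integral {0..\<tau> - q} (\<lambda>r. riem g \<tau> q r *\<^sub>R G r)"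
definition epd_t :: "real \<Rightarrow> real \<Rightarrow> (real \<Rightarrow> complex) \<Rightarrow> real \<Rightarrow> complex" where
  "epd_t g q G \<tau> = (4 * \<tau> * q) powr (- g) *\<^sub>R G (\<tau> - q) + integral {0..\<tau> - q} (\<lambda>r. riem_t g \<tau> q r *\<^sub>R G r)"

lemma riem_dom_compose:
  assumes "continuous_on riem_dom (\<lambda>(\<tau>, q, r). k \<tau> q r)" 
    and "continuous_on S t" "continuous_on S q" "continuous_on S r"
    and "\<And>x. x \<in> S \<Longrightarrow> 0 < t x \<and> 0 < q x \<and> 0 \<le> r x \<and> r x \<le> t x"
  shows "continuous_on S (\<lambda>x. k (t x) (q x) (r x))"
proof -
  have "continuous_on S (\<lambda>x. (\<lambda>(\<tau>, q, r). k \<tau> q r) (t x, q x, r x))"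
    by (rule continuous_on_compose2[OF assms(1)])
       (use assms(2-) in \<open>auto intro!: continuous_intros riem_dom_I\<close>)
  then show ?thesis by simp
qed

text \<open>
  Differentiating twice under the integral and integrating \<open>k G''\<close> twice by parts in \<open>r\<close> produces
  boundary terms at \<open>r = \<tau> - q\<close>, which cancel by the transport equation, and at \<open>r = 0\<close>, where
  \<open>k\<^sub>r = 0\<close> leaves only \<open>k G'\<close>. The remaining integrals cancel by the equation for \<open>k\<close>.
\<close>

lemma
  fixes G G1 G2 :: "real \<Rightarrow> complex"
  assumes g: "g < 1/2" and q: "0 < q" and \<tau>: "q \<le> \<tau>" "\<tau> \<le> T"
    and G: "\<And>r. r \<in> {0..T} \<Longrightarrow> (G has_vector_derivative G1 r) (at r within {0..T})"
  shows epd_deriv: "(epd g q G has_vector_derivative epd_t g q G \<tau>) (at \<tau> within {q..T})"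
  and epd_t_deriv: "(\<And>r. r \<in> {0..T} \<Longrightarrow> (G1 has_vector_derivative G2 r) (at r within {0..T})) \<Longrightarrow>
     continuous_on {0..T} G2 \<Longrightarrow>
     (epd_t g q G has_vector_derivative
        epd g q G2 \<tau> + riem g \<tau> q 0 *\<^sub>R G1 0 - (2 * g / \<tau>) *\<^sub>R epd_t g q G \<tau>) (at \<tau> within {q..T})"
proof -
  let ?D = "{(\<tau>, r). q \<le> \<tau> \<and> \<tau> \<le> T \<and> 0 \<le> r \<and> r \<le> (\<tau>::real)}"
  have cG: "continuous_on {0..T} G"
    by (rule continuous_on_vector_derivative) (rule G)
  have cG': "continuous_on ?D (\<lambda>p. G (snd p))"
    by (rule continuous_on_compose2[OF cG]) (auto intro!: continuous_intros)
  have cont: "continuous_on ?D (\<lambda>(\<tau>, r). k \<tau> q r *\<^sub>R G r)"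
    if "continuous_on riem_dom (\<lambda>(\<tau>, q, r). k \<tau> q r)" for k :: "real \<Rightarrow> real \<Rightarrow> real \<Rightarrow> real"
    unfolding case_prod_unfold
    by (intro continuous_on_scaleR cG'[unfolded case_prod_unfold] riem_dom_compose[OF that] continuous_intros) (use q in auto)
  have ineq: "(\<tau>, q, r) \<in> riem_dom" if "(\<tau>, r) \<in> ?D" for \<tau> r
    using that q by (auto intro!: riem_dom_I)
  have der: "((\<lambda>\<tau>. k \<tau> q r *\<^sub>R G r) has_vector_derivative k' \<tau> q r *\<^sub>R G r) (at \<tau> within {q..T})"
    if "((\<lambda>\<tau>. k \<tau> q r) has_real_derivative k' \<tau> q r) (at \<tau> within {q..T})" for k k' :: "real \<Rightarrow> real \<Rightarrow> real \<Rightarrow> real" and \<tau> r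
    using has_vector_derivative_scaleR[OF that has_vector_derivative_const, of "G r"] by simp
  have dV: "((\<lambda>\<tau>. integral {0..\<tau> - q} (\<lambda>r. riem g \<tau> q r *\<^sub>R G r)) has_vector_derivative
      riem g \<tau> q (\<tau> - q) *\<^sub>R G (\<tau> - q) + integral {0..\<tau> - q} (\<lambda>r. riem_t g \<tau> q r *\<^sub>R G r)) (at \<tau> within {q..T})"
    by (rule leibniz_moving_endpoint[OF q \<tau> cont[OF riem_continuous(1)[OF g]] cont[OF riem_continuous(2)[OF g]]])
       (intro der riem_deriv_t[OF g] ineq)
  show "(epd g q G has_vector_derivative epd_t g q G \<tau>) (at \<tau> within {q..T})"
    using dV unfolding riem_characteristic(1)[OF g q \<tau>(1)] epd_def[symmetric] epd_t_def[symmetric] .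
  assume G1: "\<And>r. r \<in> {0..T} \<Longrightarrow> (G1 has_vector_derivative G2 r) (at r within {0..T})"
    and G2: "continuous_on {0..T} G2"
  let ?y = "\<tau> - q" and ?P = "(4 * \<tau> * q) powr (- g)"
  have \<tau>pos: "\<tau> > 0" using q \<tau> by simp
  have y: "?y \<in> {0..T}" using q \<tau> by auto
  have dI: "((\<lambda>\<tau>. integral {0..\<tau> - q} (\<lambda>r. riem_t g \<tau> q r *\<^sub>R G r)) has_vector_derivative
      riem_t g \<tau> q ?y *\<^sub>R G ?y + integral {0..?y} (\<lambda>r. riem_tt g \<tau> q r *\<^sub>R G r)) (at \<tau> within {q..T})"
    by (rule leibniz_moving_endpoint[OF q \<tau> cont[OF riem_continuous(2)[OF g]] cont[OF riem_continuous(3)[OF g]]])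
       (intro der riem_t_deriv_t[OF g] ineq)
  have dG: "((\<lambda>\<tau>. G (\<tau> - q)) has_vector_derivative G1 ?y) (at \<tau> within {q..T})"
  proof -
    have "((\<lambda>\<tau>. \<tau> - q) has_vector_derivative 1) (at \<tau> within {q..T})"
      by (auto intro!: derivative_eq_intros)
    moreover have "(G has_vector_derivative G1 ?y) (at ?y within (\<lambda>\<tau>. \<tau> - q) ` {q..T})"
      by (rule has_vector_derivative_within_subset[OF G[OF y]]) (use q in auto)
    ultimately show ?thesis using vector_diff_chain_within[of "\<lambda>\<tau>. \<tau> - q" 1 \<tau> "{q..T}" G "G1 ?y"]
      by (simp add: o_def)
  qed
  have dP: "((\<lambda>\<tau>. (4 * \<tau> * q) powr (- g)) has_real_derivative - (g / \<tau>) * ?P) (at \<tau> within {q..T})"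
  proof -
    have pos: "4 * \<tau> * q > 0" using \<tau>pos q by simp
    have "((\<lambda>\<tau>. (4 * \<tau> * q) powr (- g)) has_real_derivative (- g * (4 * \<tau> * q) powr (- g - 1)) * (4 * q)) (at \<tau> within {q..T})"
      by (rule DERIV_chain2[where f = "\<lambda>z. z powr (- g)" and g = "\<lambda>\<tau>. 4 * \<tau> * q", OF has_real_derivative_powr[OF pos]])
         (auto intro!: derivative_eq_intros)
    then show ?thesis using \<tau>pos q by (simp add: powr_diff)
  qed
  have dV1: "(epd_t g q G has_vector_derivative
      (?P *\<^sub>R G1 ?y + (- (g / \<tau>) * ?P) *\<^sub>R G ?y)
      + (riem_t g \<tau> q ?y *\<^sub>R G ?y + integral {0..?y} (\<lambda>r. riem_tt g \<tau> q r *\<^sub>R G r))) (at \<tau> within {q..T})"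
    unfolding epd_t_def
    by (rule has_vector_derivative_add[OF has_vector_derivative_scaleR[OF dP dG] dI])
  have int: "(\<lambda>r. k \<tau> q r *\<^sub>R H r) integrable_on {0..?y}"
    if "continuous_on riem_dom (\<lambda>(\<tau>, q, r). k \<tau> q r)" "continuous_on {0..T} H"
      for k :: "real \<Rightarrow> real \<Rightarrow> real \<Rightarrow> real" and H :: "real \<Rightarrow> complex"
    by (intro integrable_continuous_real continuous_on_scaleR riem_dom_compose[OF that(1)]
          continuous_on_subset[OF that(2)] continuous_intros) (use q \<tau> in auto)
  have parts: "((\<lambda>r. riem g \<tau> q r *\<^sub>R G2 r - riem_rr g \<tau> q r *\<^sub>R G r) has_integral
     (riem g \<tau> q ?y *\<^sub>R G1 ?y - riem_r g \<tau> q ?y *\<^sub>R G ?y) - (riem g \<tau> q 0 *\<^sub>R G1 0 - riem_r g \<tau> q 0 *\<^sub>R G 0)) {0..?y}"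
  proof (rule fundamental_theorem_of_calculus)
    show "0 \<le> ?y" using y by simp
    fix r assume r: "r \<in> {0..?y}"
    have D: "(\<tau>, q, r) \<in> riem_dom" using r q \<tau> by (intro riem_dom_I) auto
    have sub: "{0..?y} \<subseteq> {0..T}" using q \<tau> by auto
    have rT: "r \<in> {0..T}" using r sub by blast
    have "((\<lambda>r. riem g \<tau> q r *\<^sub>R G1 r - riem_r g \<tau> q r *\<^sub>R G r) has_vector_derivative
       (riem g \<tau> q r *\<^sub>R G2 r + riem_r g \<tau> q r *\<^sub>R G1 r) - (riem_r g \<tau> q r *\<^sub>R G1 r + riem_rr g \<tau> q r *\<^sub>R G r)) (at r within {0..?y})"
      by (intro has_vector_derivative_diff has_vector_derivative_scaleR riem_deriv_r[OF g D] riem_r_deriv_r[OF g D]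
            has_vector_derivative_within_subset[OF G[OF rT] sub] has_vector_derivative_within_subset[OF G1[OF rT] sub])
    then show "((\<lambda>r. riem g \<tau> q r *\<^sub>R G1 r - riem_r g \<tau> q r *\<^sub>R G r) has_vector_derivative
       riem g \<tau> q r *\<^sub>R G2 r - riem_rr g \<tau> q r *\<^sub>R G r) (at r within {0..?y})" by simp
  qed
  have parts': "epd g q G2 \<tau> - integral {0..?y} (\<lambda>r. riem_rr g \<tau> q r *\<^sub>R G r)
     = ?P *\<^sub>R G1 ?y - riem_r g \<tau> q ?y *\<^sub>R G ?y - riem g \<tau> q 0 *\<^sub>R G1 0"
    using integral_unique[OF parts] int[OF riem_continuous(1)[OF g] G2] int[OF riem_continuous(4)[OF g] cG]
    by (simp add: integral_diff epd_def riem_characteristic(1)[OF g q \<tau>(1)] riem_r_0[OF g])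
  have pde: "integral {0..?y} (\<lambda>r. riem_tt g \<tau> q r *\<^sub>R G r) + (2 * g / \<tau>) *\<^sub>R integral {0..?y} (\<lambda>r. riem_t g \<tau> q r *\<^sub>R G r)
      = integral {0..?y} (\<lambda>r. riem_rr g \<tau> q r *\<^sub>R G r)"
  proof -
    have "integral {0..?y} (\<lambda>r. riem_tt g \<tau> q r *\<^sub>R G r) + (2 * g / \<tau>) *\<^sub>R integral {0..?y} (\<lambda>r. riem_t g \<tau> q r *\<^sub>R G r)
      = integral {0..?y} (\<lambda>r. riem_tt g \<tau> q r *\<^sub>R G r + (2 * g / \<tau>) *\<^sub>R (riem_t g \<tau> q r *\<^sub>R G r))"
      unfolding integral_cmul[symmetric]
      by (rule integral_add[symmetric]) (intro integrable_cmul int riem_continuous[OF g] cG)+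
    also have "\<dots> = integral {0..?y} (\<lambda>r. riem_rr g \<tau> q r *\<^sub>R G r)"
    proof (rule integral_cong)
      fix r assume r: "r \<in> {0..?y}"
      have D: "(\<tau>, q, r) \<in> riem_dom" using r q \<tau> by (intro riem_dom_I) auto
      show "riem_tt g \<tau> q r *\<^sub>R G r + (2 * g / \<tau>) *\<^sub>R (riem_t g \<tau> q r *\<^sub>R G r) = riem_rr g \<tau> q r *\<^sub>R G r"
        unfolding riem_pde[OF g D, symmetric] by (simp add: scaleR_add_left)
    qed
    finally show ?thesis .
  qed
  have ch: "riem_t g \<tau> q ?y *\<^sub>R G ?y = - (g / \<tau> * ?P) *\<^sub>R G ?y - riem_r g \<tau> q ?y *\<^sub>R G ?y"
  proof -
    have "riem_t g \<tau> q ?y = - (g / \<tau> * ?P) - riem_r g \<tau> q ?y"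
      using riem_characteristic(2)[OF g q \<tau>(1)] unfolding riem_characteristic(1)[OF g q \<tau>(1)] by simp
    then show ?thesis by (simp only: scaleR_diff_left)
  qed
  have "(?P *\<^sub>R G1 ?y + (- (g / \<tau>) * ?P) *\<^sub>R G ?y)
      + (riem_t g \<tau> q ?y *\<^sub>R G ?y + integral {0..?y} (\<lambda>r. riem_tt g \<tau> q r *\<^sub>R G r))
    = epd g q G2 \<tau> + riem g \<tau> q 0 *\<^sub>R G1 0 - (2 * g / \<tau>) *\<^sub>R epd_t g q G \<tau>"
  proof -
    have e1: "epd g q G2 \<tau> + riem g \<tau> q 0 *\<^sub>R G1 0 = ?P *\<^sub>R G1 ?y - riem_r g \<tau> q ?y *\<^sub>R G ?y + integral {0..?y} (\<lambda>r. riem_rr g \<tau> q r *\<^sub>R G r)"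
      using parts' by (simp add: algebra_simps)
    show ?thesis unfolding e1 pde[symmetric] epd_t_def ch
      by (simp add: scaleR_conv_of_real algebra_simps)
  qed
  then show "(epd_t g q G has_vector_derivative
        epd g q G2 \<tau> + riem g \<tau> q 0 *\<^sub>R G1 0 - (2 * g / \<tau>) *\<^sub>R epd_t g q G \<tau>) (at \<tau> within {q..T})"
    using dV1 by simp
qed

lemma epd_initial [simp]: "epd g q G q = 0"
  by (simp add: epd_def)

lemma epd_t_initial: "epd_t g q G q = (4 * q\<^sup>2) powr (- g) *\<^sub>R G 0"
  by (simp add: epd_t_def power2_eq_square mult.assoc)

section \<open>Differentiability along directions and integration by parts\<close>

text \<open>
  The sets \<open>U \<times> [0, R] \<times> [0, T]\<close> with \<open>U\<close> open are not open, but open in the \<open>x\<close>-directions.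
  On such sets the derivatives within the set are ordinary derivatives.
\<close>

definition dir_open :: "'a::real_normed_vector set \<Rightarrow> 'a set \<Rightarrow> bool" where
  "dir_open D S \<longleftrightarrow> (\<forall>p\<in>S. \<forall>e\<in>D. \<exists>\<delta>>0. \<forall>s. \<bar>s\<bar> < \<delta> \<longrightarrow> p + s *\<^sub>R e \<in> S)"

lemma dir_open_open: "open S \<Longrightarrow> dir_open D S"
  unfolding dir_open_def
proof (intro ballI)
  fix p e assume S: "open S" and p: "p \<in> S"
  have "((\<lambda>s. p + s *\<^sub>R e) \<longlongrightarrow> p + 0 *\<^sub>R e) (at 0)" by (intro tendsto_intros)
  then have "eventually (\<lambda>s. p + s *\<^sub>R e \<in> S) (at 0)"
    using S p by (intro topological_tendstoD) auto
  then obtain d where d: "d > 0" "\<And>s. s \<noteq> 0 \<Longrightarrow> \<bar>s\<bar> < d \<Longrightarrow> p + s *\<^sub>R e \<in> S"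
    by (auto simp: eventually_at dist_real_def)
  then have "\<forall>s. \<bar>s\<bar> < d \<longrightarrow> p + s *\<^sub>R e \<in> S" using p by (metis add.right_neutral scaleR_zero_left)
  then show "\<exists>\<delta>>0. \<forall>s. \<bar>s\<bar> < \<delta> \<longrightarrow> p + s *\<^sub>R e \<in> S" using d by blast
qed

lemma dir_open_Int: "dir_open D S \<Longrightarrow> dir_open D T \<Longrightarrow> dir_open D (S \<inter> T)"
  unfolding dir_open_def
proof (intro ballI)
  fix p e assume a: "\<forall>p\<in>S. \<forall>e\<in>D. \<exists>\<delta>>0. \<forall>s. \<bar>s\<bar> < \<delta> \<longrightarrow> p + s *\<^sub>R e \<in> S"
    "\<forall>p\<in>T. \<forall>e\<in>D. \<exists>\<delta>>0. \<forall>s. \<bar>s\<bar> < \<delta> \<longrightarrow> p + s *\<^sub>R e \<in> T" "p \<in> S \<inter> T" "e \<in> D"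
  then obtain d1 d2 where "d1 > 0" "\<forall>s. \<bar>s\<bar> < d1 \<longrightarrow> p + s *\<^sub>R e \<in> S" "d2 > 0" "\<forall>s. \<bar>s\<bar> < d2 \<longrightarrow> p + s *\<^sub>R e \<in> T"
    by blast
  then show "\<exists>\<delta>>0. \<forall>s. \<bar>s\<bar> < \<delta> \<longrightarrow> p + s *\<^sub>R e \<in> S \<inter> T"
    by (intro exI[of _ "min d1 d2"]) auto
qed

lemma dir_open_at:
  assumes "dir_open D S" "p \<in> S" "e \<in> D"
  shows "at 0 within {s. p + s *\<^sub>R e \<in> S} = at 0"
proof -
  obtain d where d: "d > 0" "\<forall>s. \<bar>s\<bar> < d \<longrightarrow> p + s *\<^sub>R e \<in> S"
    using assms unfolding dir_open_def by blast
  show ?thesis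
    by (rule at_within_nhd[of _ "{-d<..<d}"]) (use d in \<open>auto simp: abs_less_iff\<close>)
qed

lemma partial_within_eq:
  assumes "dir_open D S" "p \<in> S" "e \<in> D"
  shows "partial_within S e f p = partial e f p"
  unfolding partial_within_def dir_open_at[OF assms] by simp

lemma differentiable_transform_at:
  assumes "f differentiable (at x)" "0 < d" "\<And>y. dist y x < d \<Longrightarrow> f y = g y"
  shows "g differentiable (at x)"
  using assms unfolding differentiable_def
  by (metis UNIV_I has_derivative_transform_within)

lemma partial_cong_on:
  assumes S: "dir_open D S" "p \<in> S" "e \<in> D" and fg: "\<And>p. p \<in> S \<Longrightarrow> f p = g p"
  shows "partial e f p = partial e g p"
    and "(\<lambda>s. f (p + s *\<^sub>R e)) differentiable (at 0) \<longleftrightarrow> (\<lambda>s. g (p + s *\<^sub>R e)) differentiable (at 0)"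
proof -
  obtain d where d: "d > 0" "\<forall>s. \<bar>s\<bar> < d \<longrightarrow> p + s *\<^sub>R e \<in> S"
    using S unfolding dir_open_def by blast
  have eq: "dist s 0 < d \<Longrightarrow> f (p + s *\<^sub>R e) = g (p + s *\<^sub>R e)" for s using d fg by auto
  show "(\<lambda>s. f (p + s *\<^sub>R e)) differentiable (at 0) \<longleftrightarrow> (\<lambda>s. g (p + s *\<^sub>R e)) differentiable (at 0)"
    by (rule iffI; erule differentiable_transform_at[OF _ d(1)]) (simp_all only: eq)
  have "((\<lambda>s. f (p + s *\<^sub>R e)) has_vector_derivative y) (at 0) \<longleftrightarrow> ((\<lambda>s. g (p + s *\<^sub>R e)) has_vector_derivative y) (at 0)" for y
    by (rule iffI; erule has_vector_derivative_transform_within[OF _ d(1)]) (simp_all only: eq UNIV_I)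
  then show "partial e f p = partial e g p"
    unfolding partial_within_def vector_derivative_def by simp
qed

lemma Ck_along_cong:
  assumes "dir_open D S" "\<And>p. p \<in> S \<Longrightarrow> f p = g p" "Ck_along D k S f"
  shows "Ck_along D k S g"
  using assms(2,3)
proof (induction k arbitrary: f g)
  case 0
  then show ?case by (auto cong: continuous_on_cong)
next
  case (Suc k)
  have "(\<lambda>s. g (p + s *\<^sub>R e)) differentiable (at 0 within {s. p + s *\<^sub>R e \<in> S})" if "e \<in> D" "p \<in> S" for e p
  proof -
    have "(\<lambda>s. f (p + s *\<^sub>R e)) differentiable (at 0)"
      using Suc.prems(2) that by (auto simp: dir_open_at[OF assms(1) that(2,1)] dest!: bspec)
    then show ?thesis
      using partial_cong_on(2)[where f = f and g = g, OF assms(1) that(2,1) Suc.prems(1)]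
      by (simp only: dir_open_at[OF assms(1) that(2,1)] simp_thms)
  qed
  moreover have "Ck_along D k S (partial_within S e g)" if "e \<in> D" for e
  proof (rule Suc.IH[of "partial_within S e f"])
    show "Ck_along D k S (partial_within S e f)" using Suc.prems(2) that by simp
    show "partial_within S e f p = partial_within S e g p" if p: "p \<in> S" for p
      unfolding partial_within_eq[OF assms(1) p \<open>e \<in> D\<close>]
      by (rule partial_cong_on(1)[where f = f and g = g, OF assms(1) p \<open>e \<in> D\<close> Suc.prems(1)])
  qed
  ultimately show ?case using Suc.prems continuous_on_cong[of S S f g] by auto
qed

text \<open>
  On sets that are open in the directions of \<open>D\<close>, derivatives within the set can be traded for two-sided
  ones, which do not mention the set.
\<close>

lemma Ck_along_Suc_iff:
  assumes S: "dir_open D S"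
  shows "Ck_along D (Suc k) S f \<longleftrightarrow> continuous_on S f \<and>
     (\<forall>e\<in>D. (\<forall>p\<in>S. (\<lambda>s. f (p + s *\<^sub>R e)) differentiable (at 0)) \<and> Ck_along D k S (partial e f))"
proof -
  have "Ck_along D k S (partial_within S e f) \<longleftrightarrow> Ck_along D k S (partial e f)" if "e \<in> D" for e
    using Ck_along_cong[OF S, of "partial_within S e f" "partial e f" k]
      Ck_along_cong[OF S, of "partial e f" "partial_within S e f" k] partial_within_eq[OF S _ that]
    by auto
  then show ?thesis by (auto simp: dir_open_at[OF S])
qed

declare Ck_along.simps(2) [simp del]

lemma Ck_along_continuous: "Ck_along D k S f \<Longrightarrow> continuous_on S f"
  by (cases k) (auto simp: Ck_along.simps(2))

lemma Ck_along_SucD: "dir_open D S \<Longrightarrow> Ck_along D (Suc k) S f \<Longrightarrow> Ck_along D k S f"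
proof (induction k arbitrary: f)
  case (Suc k)
  then show ?case
    by (auto simp: Ck_along_Suc_iff[OF Suc.prems(1)])
qed (auto simp: Ck_along_Suc_iff)

lemma Ck_along_le: "dir_open D S \<Longrightarrow> j \<le> k \<Longrightarrow> Ck_along D k S f \<Longrightarrow> Ck_along D j S f"
  by (induction k) (auto simp: le_Suc_eq dest: Ck_along_SucD)

lemma Ck_along_subset:
  assumes "dir_open D S" "dir_open E T" "T \<subseteq> S" "E \<subseteq> D"
  shows "Ck_along D k S f \<Longrightarrow> Ck_along E k T f"
proof (induction k arbitrary: f)
  case 0
  then show ?case using assms by (auto intro: continuous_on_subset)
next
  case (Suc k)
  then show ?case using assms(3,4) continuous_on_subset[of S f T]
    by (auto simp: Ck_along_Suc_iff[OF assms(1)] Ck_along_Suc_iff[OF assms(2)] subset_iff)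
qed

lemma continuous_on_local:
  fixes f :: "'a::t2_space \<Rightarrow> 'b::topological_space"
  assumes "\<And>p. p \<in> S \<Longrightarrow> \<exists>W. open W \<and> p \<in> W \<and> continuous_on (S \<inter> W) f"
  shows "continuous_on S f"
  unfolding continuous_on_eq_continuous_within
proof (intro ballI)
  fix p assume p: "p \<in> S"
  then obtain W where W: "open W" "p \<in> W" "continuous_on (S \<inter> W) f" using assms by blast
  then have "continuous (at p within S \<inter> W) f" using p by (simp add: continuous_on_eq_continuous_within)
  moreover have "at p within S \<inter> W = at p within S"
    by (rule at_within_nhd[of _ W]) (use W in auto)
  ultimately show "continuous (at p within S) f" by simp
qed

text \<open>
  Differentiability is only known near each point, with a neighbourhood depending on the point.
\<close>

lemma Ck_along_local:
  assumes S: "dir_open D S"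
    and "\<And>p. p \<in> S \<Longrightarrow> \<exists>W. open W \<and> p \<in> W \<and> Ck_along D k (S \<inter> W) f"
  shows "Ck_along D k S f"
  using assms(2)
proof (induction k arbitrary: f)
  case 0
  show ?case unfolding Ck_along.simps(1)
    by (rule continuous_on_local) (use 0 in simp)
next
  case (Suc k)
  have SW: "dir_open D (S \<inter> W)" if "open W" for W
    by (rule dir_open_Int[OF S dir_open_open[OF that]])
  have "continuous_on S f"
  proof (rule continuous_on_local)
    fix p assume "p \<in> S"
    then obtain W where "open W" "p \<in> W" "Ck_along D (Suc k) (S \<inter> W) f" using Suc.prems by blast
    then show "\<exists>W. open W \<and> p \<in> W \<and> continuous_on (S \<inter> W) f"
      by (intro exI[of _ W] conjI Ck_along_continuous)
  qed
  moreover have "(\<lambda>s. f (p + s *\<^sub>R e)) differentiable (at 0)" if "e \<in> D" "p \<in> S" for e p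
    using Suc.prems[OF that(2)] that SW by (auto simp: Ck_along_Suc_iff)
  moreover have "Ck_along D k S (partial e f)" if e: "e \<in> D" for e
  proof (rule Suc.IH)
    fix p assume "p \<in> S"
    then obtain W where W: "open W" "p \<in> W" "Ck_along D (Suc k) (S \<inter> W) f" using Suc.prems by blast
    then show "\<exists>W. open W \<and> p \<in> W \<and> Ck_along D k (S \<inter> W) (partial e f)"
      using e SW by (auto simp: Ck_along_Suc_iff)
  qed
  ultimately show ?case by (simp add: Ck_along_Suc_iff[OF S])
qed

lemma has_partial:
  "(\<lambda>s. f (p + s *\<^sub>R e)) differentiable (at 0) \<Longrightarrow>
   ((\<lambda>s. f (p + s *\<^sub>R e)) has_vector_derivative partial e f p) (at 0)"
  using vector_derivative_works[of "\<lambda>s. f (p + s *\<^sub>R e)" "at 0"] unfolding partial_within_def by simp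

lemma partial_eqI:
  "((\<lambda>s. f (p + s *\<^sub>R e)) has_vector_derivative y) (at 0) \<Longrightarrow> partial e f p = y"
  unfolding partial_within_def by (simp add: vector_derivative_at)

lemma has_vector_derivative_line_shift:
  fixes g :: "'a::real_vector \<Rightarrow> 'b::real_normed_vector"
  assumes "((\<lambda>u. g ((p + s *\<^sub>R e) + u *\<^sub>R e)) has_vector_derivative y) (at 0)"
  shows "((\<lambda>s. g (p + s *\<^sub>R e)) has_vector_derivative y) (at s within T)"
proof -
  have "((\<lambda>u. g ((p + s *\<^sub>R e) + u *\<^sub>R e)) has_vector_derivative y) (at (s + - s))"
    using assms by simp
  then have "(((\<lambda>u. g ((p + s *\<^sub>R e) + u *\<^sub>R e)) \<circ> (\<lambda>u. u + - s)) has_vector_derivative 1 *\<^sub>R y) (at s)"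
    by (intro vector_diff_chain_at) (auto intro!: derivative_eq_intros)
  then have "((\<lambda>s. g (p + s *\<^sub>R e)) has_vector_derivative y) (at s)"
    by (simp add: o_def algebra_simps)
  then show ?thesis by (rule has_vector_derivative_at_within)
qed

lemma Ck_along_add:
  assumes S: "dir_open D S"
  shows "Ck_along D k S f \<Longrightarrow> Ck_along D k S g \<Longrightarrow> Ck_along D k S (\<lambda>p. f p + g p)"
proof (induction k arbitrary: f g)
  case 0
  then show ?case by (auto intro!: continuous_intros)
next
  case (Suc k)
  note f = Suc.prems[unfolded Ck_along_Suc_iff[OF S]]
  show ?case unfolding Ck_along_Suc_iff[OF S]
  proof (intro conjI ballI)
    show "continuous_on S (\<lambda>p. f p + g p)" using f by (auto intro!: continuous_intros)
    fix e assume e: "e \<in> D"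
    show "(\<lambda>s. f (p + s *\<^sub>R e) + g (p + s *\<^sub>R e)) differentiable (at 0)" if "p \<in> S" for p
      using f e that by auto
    show "Ck_along D k S (partial e (\<lambda>p. f p + g p))"
      by (rule Ck_along_cong[OF S _ Suc.IH[of "partial e f" "partial e g"]])
         (use f e in \<open>auto intro!: partial_eqI[symmetric] has_vector_derivative_add has_partial\<close>)
  qed
qed

lemma Ck_along_mult:
  fixes f g :: "'a::real_normed_vector \<Rightarrow> 'b::real_normed_algebra"
  assumes S: "dir_open D S"
  shows "Ck_along D k S f \<Longrightarrow> Ck_along D k S g \<Longrightarrow> Ck_along D k S (\<lambda>p. f p * g p)"
proof (induction k arbitrary: f g)
  case 0
  then show ?case by (auto intro!: continuous_intros)
next
  case (Suc k)
  note f = Suc.prems[unfolded Ck_along_Suc_iff[OF S]]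
  have der: "((\<lambda>s. f (p + s *\<^sub>R e) * g (p + s *\<^sub>R e)) has_vector_derivative
      (f p * partial e g p + partial e f p * g p)) (at 0)" if "e \<in> D" "p \<in> S" for e p
  proof -
    have "((\<lambda>s. f (p + s *\<^sub>R e) * g (p + s *\<^sub>R e)) has_vector_derivative
      (f (p + 0 *\<^sub>R e) * partial e g p + partial e f p * g (p + 0 *\<^sub>R e))) (at 0)"
      by (rule has_vector_derivative_mult; rule has_partial) (use f that in auto)
    then show ?thesis by simp
  qed
  show ?case unfolding Ck_along_Suc_iff[OF S]
  proof (intro conjI ballI)
    show "continuous_on S (\<lambda>p. f p * g p)" using f by (auto intro!: continuous_intros)
    fix e assume e: "e \<in> D"
    show "(\<lambda>s. f (p + s *\<^sub>R e) * g (p + s *\<^sub>R e)) differentiable (at 0)" if "p \<in> S" for p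
      using der[OF e that] by (auto simp: has_vector_derivative_def differentiable_def)
    have "Ck_along D k S f" "Ck_along D k S g" using Suc.prems Ck_along_SucD[OF S] by blast+
    then have "Ck_along D k S (\<lambda>p. f p * partial e g p + partial e f p * g p)"
      using f e by (intro Ck_along_add[OF S] Suc.IH) auto
    then show "Ck_along D k S (partial e (\<lambda>p. f p * g p))"
      by (rule Ck_along_cong[OF S, rotated]) (use der e in \<open>auto intro!: partial_eqI[symmetric]\<close>)
  qed
qed

lemma Ck_along_const_dir:
  assumes S: "dir_open D S"
  shows "continuous_on S f \<Longrightarrow> (\<And>p s e. e \<in> D \<Longrightarrow> f (p + s *\<^sub>R e) = f p) \<Longrightarrow> Ck_along D k S f"
proof (induction k arbitrary: f)
  case (Suc k)
  have p0: "partial e f p = 0" if "e \<in> D" for p e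
    by (rule partial_eqI) (simp add: Suc.prems(2)[OF that])
  have "Ck_along D k S (partial e f)" if "e \<in> D" for e
  proof (rule Suc.IH)
    show "continuous_on S (partial e f)" by (subst continuous_on_cong[OF refl p0[OF that]]) auto
    show "partial e f (p + s *\<^sub>R e') = partial e f p" for p s e' by (simp add: p0[OF that])
  qed
  then show ?case using Suc.prems by (simp add: Ck_along_Suc_iff[OF S])
qed simp

lemma Ck_along_fold:
  assumes S: "dir_open D S"
  shows "Ck_along D k S f \<Longrightarrow> set es \<subseteq> D \<Longrightarrow> length es \<le> k \<Longrightarrow> Ck_along D (k - length es) S (foldr partial es f)"
proof (induction es arbitrary: k)
  case (Cons e es)
  have "Ck_along D (k - length es) S (foldr partial es f)" using Cons by auto
  moreover have "k - length es = Suc (k - length (e # es))" using Cons by simp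
  ultimately have "Ck_along D (k - length (e # es)) S (partial e (foldr partial es f))"
    using Cons.prems by (simp add: Ck_along_Suc_iff[OF S])
  then show ?case by simp
qed simp

lemma partial_vanish:
  assumes "open O'" "\<And>p. p \<in> O' \<Longrightarrow> f p = 0" "p \<in> O'"
  shows "partial e f p = 0"
proof -
  have "partial e f p = partial e (\<lambda>_. 0) p"
    by (rule partial_cong_on(1)[of UNIV O']) (use assms dir_open_open in auto)
  then show ?thesis by (simp add: partial_eqI)
qed

lemma fold_partial_vanish:
  assumes "closed K" "\<And>p. p \<notin> K \<Longrightarrow> f p = 0" "p \<notin> K"
  shows "foldr partial es f p = 0"
  using assms(3)
  by (induction es arbitrary: p) (use assms in \<open>auto intro!: partial_vanish[of "- K"]\<close>)

lemma continuous_on_zero_extend: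
  fixes f :: "'a::topological_space \<Rightarrow> 'b::{topological_space,zero}"
  assumes "open O'" "closed K" "K \<subseteq> O'" "continuous_on O' f" "\<And>p. p \<notin> K \<Longrightarrow> f p = 0"
  shows "continuous_on UNIV f"
proof -
  have "continuous_on (- K) f" using assms(5) by (subst continuous_on_cong[OF refl, of _ _ "\<lambda>_. 0"]) auto
  then have "continuous_on (O' \<union> - K) f" using assms by (intro continuous_on_open_Un) auto
  moreover have "O' \<union> - K = UNIV" using assms by auto
  ultimately show ?thesis by simp
qed

lemma integrable_compact_support:
  fixes f :: "'a::euclidean_space \<Rightarrow> 'b::{banach, second_countable_topology}"
  assumes "compact K" "continuous_on UNIV f" "\<And>p. p \<notin> K \<Longrightarrow> f p = 0"
  shows "integrable lborel f"
proof -
  have "integrable lborel (\<lambda>x. indicator K x *\<^sub>R f x)"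
    using borel_integrable_compact[OF assms(1) continuous_on_subset[OF assms(2)]] by simp
  moreover have "(\<lambda>x. indicator K x *\<^sub>R f x) = f" using assms(3) by (auto simp: indicator_def)
  ultimately show ?thesis by simp
qed

lemma integral_lborel_translate:
  fixes f :: "'a::euclidean_space \<Rightarrow> 'b::{banach, second_countable_topology}"
  assumes "f \<in> borel_measurable borel"
  shows "(LINT x|lborel. f (x + c)) = (LINT x|lborel. f x)"
proof -
  have "(LINT x|lborel. f x) = (LINT x|distr lborel borel ((+) c). f x)" by (simp add: lborel_distr_plus)
  also have "\<dots> = (LINT x|lborel. f (c + x))" using assms by (subst integral_distr) auto
  finally show ?thesis by (simp add: add.commute)
qed

text \<open>
  The difference quotients have integral \<open>0\<close> by translation invariance, and they converge
  dominatedly to the derivative.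
\<close>

lemma integral_partial_zero:
  fixes g :: "'a::euclidean_space \<Rightarrow> complex"
  assumes K: "compact K" "\<And>p. p \<notin> K \<Longrightarrow> g p = 0"
    and d: "\<And>p. (\<lambda>s. g (p + s *\<^sub>R e)) differentiable (at 0)"
    and c: "continuous_on UNIV g" "continuous_on UNIV (partial e g)"
  shows "(LINT x|lborel. partial e g x) = 0"
proof -
  have D0: "partial e g p = 0" if "p \<notin> K" for p
    by (rule partial_vanish[of "- K"]) (use K that compact_imp_closed in auto)
  obtain B where B: "\<And>p. norm (partial e g p) \<le> B" "B \<ge> 0"
  proof -
    have "bounded (partial e g ` K)"
      using compact_imp_bounded[OF compact_continuous_image[OF continuous_on_subset[OF c(2)] K(1)]] by simp
    then obtain B where "B > 0" "\<And>p. p \<in> K \<Longrightarrow> norm (partial e g p) \<le> B"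
      by (auto simp: bounded_pos)
    then show thesis using D0 that[of B] by (metis less_imp_le norm_zero)
  qed
  have der: "((\<lambda>s. g (p + s *\<^sub>R e)) has_vector_derivative partial e g (p + s *\<^sub>R e)) (at s within T)" for p s T
    by (rule has_vector_derivative_line_shift[OF has_partial[OF d]])
  have lip: "norm (g (p + h *\<^sub>R e) - g p) \<le> B * h" if "h \<ge> 0" for p h
  proof -
    have "((\<lambda>s. partial e g (p + s *\<^sub>R e)) has_integral g (p + h *\<^sub>R e) - g (p + 0 *\<^sub>R e)) {0..h}"
      by (rule fundamental_theorem_of_calculus[OF that]) (rule der)
    moreover have "continuous_on {0..h} (\<lambda>s. partial e g (p + s *\<^sub>R e))"
      by (rule continuous_on_compose2[OF c(2)]) (auto intro!: continuous_intros)
    ultimately show ?thesis using integral_bound[OF that, of "\<lambda>s. partial e g (p + s *\<^sub>R e)" B] B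
      by (auto simp: integral_unique)
  qed
  define h where "h n = inverse (real (Suc n))" for n
  have h: "0 < h n" "h n \<le> 1" for n by (auto simp: h_def inverse_le_1_iff)
  define gn where "gn n p = (g (p + h n *\<^sub>R e) - g p) /\<^sub>R h n" for n p
  define K' where "K' = (\<lambda>(p, s). p - s *\<^sub>R e) ` (K \<times> {0..1})"
  have K'c: "compact K'" unfolding K'_def case_prod_unfold
    by (intro compact_continuous_image compact_Times K continuous_intros) auto
  have gi: "integrable lborel g" by (rule integrable_compact_support[OF K(1) c(1) K(2)])
  have gm: "g \<in> borel_measurable borel" using c(1) by (rule borel_measurable_continuous_onI)
  have gpi: "integrable lborel (\<lambda>p. g (p + h n *\<^sub>R e))" for n
  proof (rule integrable_compact_support[of K'])
    show "continuous_on UNIV (\<lambda>p. g (p + h n *\<^sub>R e))"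
      by (rule continuous_on_compose2[OF c(1)]) (auto intro!: continuous_intros)
    show "g (p + h n *\<^sub>R e) = 0" if "p \<notin> K'" for p
    proof (rule K(2), rule notI)
      assume "p + h n *\<^sub>R e \<in> K"
      then have "(\<lambda>(p, s). p - s *\<^sub>R e) (p + h n *\<^sub>R e, h n) \<in> K'" unfolding K'_def
        using h[of n] by (intro imageI) auto
      then show False using that by simp
    qed
  qed (rule K'c)
  have I0: "(LINT p|lborel. gn n p) = 0" for n
  proof -
    have "(LINT p|lborel. gn n p) = ((LINT p|lborel. g (p + h n *\<^sub>R e)) - (LINT p|lborel. g p)) /\<^sub>R h n"
      unfolding gn_def using gi gpi by (subst integral_scaleR_right, subst Bochner_Integration.integral_diff) auto
    then show ?thesis using integral_lborel_translate[OF gm] by simp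
  qed
  have "(\<lambda>n. LINT p|lborel. gn n p) \<longlonglongrightarrow> (LINT p|lborel. partial e g p)"
  proof (rule integral_dominated_convergence[where w = "\<lambda>p. B * indicator (K \<union> K') p"])
    show "partial e g \<in> borel_measurable lborel" using borel_measurable_continuous_onI[OF c(2)] by simp
    show "gn n \<in> borel_measurable lborel" for n
      unfolding gn_def using gi gpi[of n] by (auto intro!: borel_measurable_integrable)
    have "emeasure lborel (K \<union> K') < \<infinity>"
      using K(1) K'c by (intro emeasure_bounded_finite compact_imp_bounded) auto
    moreover have "K \<union> K' \<in> sets lborel" using K(1) K'c by (auto intro!: borel_compact)
    ultimately show "integrable lborel (\<lambda>p. B * indicator (K \<union> K') p)"
      by (intro integrable_mult_right integrable_real_indicator) auto
    show "AE p in lborel. (\<lambda>n. gn n p) \<longlonglongrightarrow> partial e g p"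
    proof (rule AE_I2)
      fix p
      have "((\<lambda>s. (g (p + s *\<^sub>R e) - g p) /\<^sub>R s) \<longlongrightarrow> partial e g p) (at 0)"
      proof -
        have "((\<lambda>s. g (p + s *\<^sub>R e)) has_vector_derivative partial e g p) (at 0)" by (rule has_partial[OF d])
        then have "((\<lambda>s. norm (g (p + s *\<^sub>R e) - g p - s *\<^sub>R partial e g p) / norm s) \<longlongrightarrow> 0) (at 0)"
          by (simp add: has_vector_derivative_def has_derivative_at)
        then have "((\<lambda>s. norm ((g (p + s *\<^sub>R e) - g p) /\<^sub>R s - partial e g p)) \<longlongrightarrow> 0) (at 0)"
        proof (rule Lim_transform_eventually)
          have "norm (g (p + s *\<^sub>R e) - g p - s *\<^sub>R partial e g p) / norm s
              = norm ((g (p + s *\<^sub>R e) - g p) /\<^sub>R s - partial e g p)" if "s \<noteq> 0" for s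
          proof -
            have "(g (p + s *\<^sub>R e) - g p) /\<^sub>R s - partial e g p = (g (p + s *\<^sub>R e) - g p - s *\<^sub>R partial e g p) /\<^sub>R s"
              using that by (simp add: scaleR_diff_right)
            then show ?thesis by (simp add: divide_inverse_commute)
          qed
          then show "eventually (\<lambda>s. norm (g (p + s *\<^sub>R e) - g p - s *\<^sub>R partial e g p) / norm s
              = norm ((g (p + s *\<^sub>R e) - g p) /\<^sub>R s - partial e g p)) (at 0)"
            by (simp add: eventually_at_filter)
        qed
        then show ?thesis by (simp only: tendsto_norm_zero_iff Lim_null[symmetric])
      qed
      moreover have "filterlim h (at 0) sequentially"
        unfolding filterlim_at h_def using LIMSEQ_inverse_real_of_nat by auto
      ultimately show "(\<lambda>n. gn n p) \<longlonglongrightarrow> partial e g p"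
        unfolding gn_def by (rule filterlim_compose)
    qed
    show "AE p in lborel. norm (gn n p) \<le> B * indicator (K \<union> K') p" for n
    proof (rule AE_I2)
      fix p
      show "norm (gn n p) \<le> B * indicator (K \<union> K') p"
      proof (cases "p \<in> K \<union> K'")
        case True
        have "norm (gn n p) \<le> inverse (h n) * (B * h n)"
          unfolding gn_def using lip[of "h n" p] h[of n] by (auto intro!: mult_left_mono)
        also have "inverse (h n) * (B * h n) = B" using h[of n] by (simp add: field_simps)
        finally show ?thesis using True by simp
      next
        case False
        have "p + h n *\<^sub>R e \<notin> K"
        proof
          assume "p + h n *\<^sub>R e \<in> K"
          then have "(\<lambda>(p, s). p - s *\<^sub>R e) (p + h n *\<^sub>R e, h n) \<in> K'" unfolding K'_def
            using h[of n] by (intro imageI) auto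
          then show False using False by simp
        qed
        then show ?thesis using False K(2) by (simp add: gn_def)
      qed
    qed
  qed
  then show ?thesis using I0 by (simp add: LIMSEQ_const_iff)
qed

text \<open>
  The product \<open>f \<eta>\<close> is differentiable along \<open>e\<close> everywhere, whatever \<open>f\<close> is off \<open>O'\<close>, since it
  vanishes there together with its neighbours. So its derivative has integral \<open>0\<close>.
\<close>

lemma integral_by_parts_along:
  fixes f \<eta> :: "'a::euclidean_space \<Rightarrow> complex"
  assumes O: "open O'" "compact K" "K \<subseteq> O'" and e: "e \<in> D"
    and f: "Ck_along D 1 O' f" and \<eta>: "Ck_along D 1 UNIV \<eta>" "\<And>p. p \<notin> K \<Longrightarrow> \<eta> p = 0"
  shows "(LINT x|lborel. partial e f x * \<eta> x) = - (LINT x|lborel. f x * partial e \<eta> x)"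
proof -
  have dO: "dir_open D O'" "dir_open D (UNIV::'a set)" by (auto intro: dir_open_open O)
  have cK: "closed K" using O compact_imp_closed by blast
  note f' = f[unfolded One_nat_def Ck_along_Suc_iff[OF dO(1)]]
  note \<eta>' = \<eta>(1)[unfolded One_nat_def Ck_along_Suc_iff[OF dO(2)]]
  have \<eta>0: "partial e \<eta> p = 0" if "p \<notin> K" for p
    by (rule partial_vanish[of "- K"]) (use \<eta>(2) cK that in auto)
  have der: "((\<lambda>s. f (p + s *\<^sub>R e) * \<eta> (p + s *\<^sub>R e)) has_vector_derivative
      f p * partial e \<eta> p + partial e f p * \<eta> p) (at 0)" for p
  proof (cases "p \<in> O'")
    case True
    have "((\<lambda>s. f (p + s *\<^sub>R e) * \<eta> (p + s *\<^sub>R e)) has_vector_derivative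
      (f (p + 0 *\<^sub>R e) * partial e \<eta> p + partial e f p * \<eta> (p + 0 *\<^sub>R e))) (at 0)"
      by (rule has_vector_derivative_mult; rule has_partial) (use f' \<eta>' e True in auto)
    then show ?thesis by simp
  next
    case False
    then have p: "p \<in> - K" using O by auto
    have "(\<lambda>s. f (p + s *\<^sub>R e) * \<eta> (p + s *\<^sub>R e)) differentiable (at 0) \<longleftrightarrow> (\<lambda>s. (\<lambda>_. 0::complex) (p + s *\<^sub>R e)) differentiable (at 0)"
      by (rule partial_cong_on(2)[of "{e}" "- K", OF dir_open_open]) (use cK p \<eta>(2) in auto)
    then have "((\<lambda>s. f (p + s *\<^sub>R e) * \<eta> (p + s *\<^sub>R e)) has_vector_derivative partial e (\<lambda>p. f p * \<eta> p) p) (at 0)"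
      by (intro has_partial) auto
    moreover have "partial e (\<lambda>p. f p * \<eta> p) p = 0"
      by (rule partial_vanish[of "- K"]) (use \<eta>(2) cK p in auto)
    ultimately show ?thesis using p \<eta>(2)[of p] \<eta>0[of p] by simp
  qed
  have pe: "partial e (\<lambda>p. f p * \<eta> p) = (\<lambda>p. f p * partial e \<eta> p + partial e f p * \<eta> p)"
    using der by (intro ext partial_eqI)
  have c1: "continuous_on UNIV (\<lambda>p. f p * partial e \<eta> p)"
    by (rule continuous_on_zero_extend[OF O(1) cK O(3)])
       (use f' \<eta>' e \<eta>0 in \<open>auto intro!: continuous_intros intro: continuous_on_subset\<close>)
  have c2: "continuous_on UNIV (\<lambda>p. partial e f p * \<eta> p)"
    by (rule continuous_on_zero_extend[OF O(1) cK O(3)])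
       (use f' \<eta>' e \<eta>(2) in \<open>auto intro!: continuous_intros intro: continuous_on_subset\<close>)
  have c0: "continuous_on UNIV (\<lambda>p. f p * \<eta> p)"
    by (rule continuous_on_zero_extend[OF O(1) cK O(3)])
       (use f' \<eta>' e \<eta>(2) in \<open>auto intro!: continuous_intros intro: continuous_on_subset\<close>)
  have "(LINT x|lborel. partial e (\<lambda>p. f p * \<eta> p) x) = 0"
    by (rule integral_partial_zero[OF O(2) _ _ c0])
       (use der \<eta>(2) c1 c2 in \<open>auto simp: pe has_vector_derivative_def differentiable_def intro!: continuous_intros\<close>)
  then have "(LINT x|lborel. f x * partial e \<eta> x) + (LINT x|lborel. partial e f x * \<eta> x) = 0"
    unfolding pe
    by (subst (asm) Bochner_Integration.integral_add)
       (auto intro!: integrable_compact_support[OF O(2)] c1 c2 simp: \<eta>0 \<eta>(2))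
  then show ?thesis by (simp add: eq_neg_iff_add_eq_0 add.commute)
qed

text \<open>
  Moving the derivatives over one by one reverses their order; this is the order in which
  \<^term>\<open>dist_diff_op\<close> applies them to the test function.
\<close>

lemma integral_by_parts_fold:
  fixes f \<eta> :: "'a::euclidean_space \<Rightarrow> complex"
  assumes O: "open O'" "compact K" "K \<subseteq> O'"
  shows "Ck_along D k O' f \<Longrightarrow> set es \<subseteq> D \<Longrightarrow> length es \<le> k \<Longrightarrow> Ck_along D k UNIV \<eta> \<Longrightarrow> (\<And>p. p \<notin> K \<Longrightarrow> \<eta> p = 0) \<Longrightarrow>
    (LINT x|lborel. foldr partial es f x * \<eta> x) = (-1) ^ length es * (LINT x|lborel. f x * foldr partial (rev es) \<eta> x)"
proof (induction es arbitrary: k \<eta>)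
  case (Cons e es)
  have dO: "dir_open D O'" "dir_open D (UNIV::'a set)" by (auto intro: dir_open_open O)
  have cK: "closed K" using O compact_imp_closed by blast
  from Cons.prems obtain j where j: "k = Suc j" "length es \<le> j" by (cases k) auto
  have e: "e \<in> D" using Cons.prems by simp
  have \<eta>': "Ck_along D j UNIV (partial e \<eta>)" using Cons.prems e j by (simp add: Ck_along_Suc_iff[OF dO(2)])
  have v: "partial e \<eta> p = 0" if "p \<notin> K" for p
    by (rule partial_vanish[of "- K"]) (use Cons.prems cK that in auto)
  have fold: "Ck_along D 1 O' (foldr partial es f)"
    using Ck_along_fold[OF dO(1) Cons.prems(1), of es] Cons.prems j
    by (auto intro: Ck_along_le[OF dO(1), rotated])
  have \<eta>1: "Ck_along D 1 UNIV \<eta>"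
    using Cons.prems j by (auto intro: Ck_along_le[OF dO(2), rotated])
  have "(LINT x|lborel. foldr partial (e # es) f x * \<eta> x) = - (LINT x|lborel. foldr partial es f x * partial e \<eta> x)"
    using integral_by_parts_along[OF O e fold \<eta>1 Cons.prems(5)] by simp
  also have "(LINT x|lborel. foldr partial es f x * partial e \<eta> x)
      = (-1) ^ length es * (LINT x|lborel. f x * foldr partial (rev es) (partial e \<eta>) x)"
    by (rule Cons.IH[OF _ _ _ \<eta>']) (use Cons.prems j v Ck_along_SucD[OF dO(1)] in auto)
  finally show ?case by simp
qed simp

section \<open>The function phi and the family w\<close>

lemma foldr_replicate_concat:
  "foldr (\<lambda>i. D i ^^ \<alpha> i) is g = foldr D (concat (map (\<lambda>i. replicate (\<alpha> i) i) is)) g"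
proof (induction "is")
  case (Cons i "is")
  have "foldr D (replicate n i) h = (D i ^^ n) h" for n h by (induction n) auto
  then show ?case using Cons by simp
qed simp

definition multi_list :: "('n::finite \<Rightarrow> nat) \<Rightarrow> 'n list" where
  "multi_list \<alpha> = concat (map (\<lambda>i. replicate (\<alpha> i) i) coords)"

lemma coords: "distinct (coords :: 'n::finite list)" "set (coords :: 'n list) = UNIV"
proof -
  have "\<exists>is::'n list. distinct is \<and> set is = UNIV"
    using finite_distinct_list[of "UNIV :: 'n set"] by auto
  then have "distinct (coords :: 'n list) \<and> set (coords :: 'n list) = UNIV"
    unfolding coords_def by (rule someI_ex)
  then show "distinct (coords :: 'n::finite list)" "set (coords :: 'n list) = UNIV" by auto
qed

lemma multi_pow_eq: "multi_pow D \<alpha> g = foldr D (multi_list \<alpha>) g"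
  unfolding multi_pow_def multi_list_def by (rule foldr_replicate_concat)

lemma length_multi_list: "length (multi_list \<alpha>) = (\<Sum>i\<in>UNIV. \<alpha> i)"
proof -
  have "length (multi_list \<alpha>) = sum_list (map \<alpha> coords)"
    by (simp add: multi_list_def length_concat o_def)
  also have "\<dots> = (\<Sum>i\<in>UNIV. \<alpha> i)"
    using sum_list_distinct_conv_sum_set[OF coords(1), of \<alpha>] by (simp add: coords(2))
  finally show ?thesis .
qed

lemma multi_list_le: "\<alpha> \<in> multi_indices m \<Longrightarrow> length (multi_list \<alpha>) \<le> m"
  by (simp add: multi_indices_def length_multi_list)

lemma finite_multi_indices: "finite (multi_indices m :: ('n::finite \<Rightarrow> nat) set)"
proof (rule finite_subset)
  show "multi_indices m \<subseteq> (UNIV :: 'n set) \<rightarrow>\<^sub>E {..m}"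
  proof
    fix \<alpha> :: "'n \<Rightarrow> nat" assume "\<alpha> \<in> multi_indices m"
    then have "(\<Sum>i\<in>UNIV. \<alpha> i) \<le> m" by (simp add: multi_indices_def)
    then have "\<alpha> i \<le> m" for i using member_le_sum[of i UNIV \<alpha>] by simp
    then show "\<alpha> \<in> UNIV \<rightarrow>\<^sub>E {..m}" by auto
  qed
  show "finite ((UNIV :: 'n set) \<rightarrow>\<^sub>E {..m})" by (intro finite_PiE) auto
qed

context
  fixes l :: real assumes l: "l > -2"
begin

lemma gam_less: "gam l < 1/2"
  using l by (simp add: gam_def field_simps)

lemma gam_twice: "- 2 * gam l = - l / (l + 2)" "1 - 2 * gam l = 2 / (l + 2)"
  using l by (simp_all add: gam_def field_simps)

lemma phi_pos: "t > 0 \<Longrightarrow> phi l t > 0"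
  using l by (simp add: phi_def)

lemma phi_nonneg: "phi l t \<ge> 0"
  using l by (simp add: phi_def)

lemma phi_mono: "0 \<le> s \<Longrightarrow> s \<le> t \<Longrightarrow> phi l s \<le> phi l t"
  using l unfolding phi_def by (intro mult_left_mono powr_mono2) auto

lemma phi_less: "0 \<le> s \<Longrightarrow> s < t \<Longrightarrow> phi l s < phi l t"
  using l unfolding phi_def by (intro mult_strict_left_mono powr_less_mono2) auto

lemma phi_continuous: "continuous_on {0..} (phi l)"
  using l unfolding phi_def by (intro continuous_intros continuous_on_powr') auto

lemma phi_deriv: "t > 0 \<Longrightarrow> (phi l has_real_derivative t powr (l / 2)) (at t within S)"
proof -
  assume t: "t > 0"
  have "((\<lambda>t. 2 / (l + 2) * t powr ((l + 2) / 2)) has_real_derivative 2 / (l + 2) * ((l + 2) / 2 * t powr ((l + 2) / 2 - 1))) (at t)"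
    by (intro DERIV_cmult has_real_derivative_powr t)
  moreover have "2 / (l + 2) * ((l + 2) / 2 * t powr ((l + 2) / 2 - 1)) = t powr (l / 2)"
    using l by (simp add: field_simps)
  ultimately show ?thesis unfolding phi_def[abs_def]
    by (auto intro: has_field_derivative_at_within)
qed

lemma deriv_phi: "t > 0 \<Longrightarrow> deriv (phi l) t = t powr (l / 2)"
  by (rule DERIV_imp_deriv[OF phi_deriv])

lemma powr_half_sq: "(t powr (l / 2))\<^sup>2 = t powr l"
  by (simp add: power2_eq_square powr_add[symmetric])

text \<open>
  In this form the second derivative of \<open>\<phi>\<close> absorbs the first-order term of the
  Euler-Poisson-Darboux equation: \<open>\<phi>'' = (2\<gamma>/\<phi>) \<phi>'\<^sup>2\<close>.
\<close>

lemma phi_deriv2: "t > 0 \<Longrightarrow>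
   ((\<lambda>t. t powr (l / 2)) has_real_derivative 2 * gam l / phi l t * t powr l) (at t within S)"
proof -
  assume t: "t > 0"
  have "((\<lambda>t. t powr (l / 2)) has_real_derivative l / 2 * t powr (l / 2 - 1)) (at t)"
    by (rule has_real_derivative_powr[OF t])
  moreover have "2 * gam l / phi l t * t powr l = l / 2 * t powr (l / 2 - 1)"
  proof -
    have "2 * gam l / phi l t * t powr l = l / 2 * (t powr l / t powr ((l + 2) / 2))"
    proof -
      define L where "L = l + 2"
      have "L > 0" "t powr (L / 2) > 0" using l t by (auto simp: L_def)
      then show ?thesis unfolding gam_def phi_def L_def[symmetric] by (simp add: field_simps)
    qed
    also have "t powr l / t powr ((l + 2) / 2) = t powr (l / 2 - 1)"
      using l by (simp add: powr_diff[symmetric] field_simps)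
    finally show ?thesis .
  qed
  ultimately have "((\<lambda>t. t powr (l / 2)) has_real_derivative 2 * gam l / phi l t * t powr l) (at t)"
    by (simp only:)
  then show ?thesis by (rule has_field_derivative_at_within)
qed

lemma phi_powr: "t > 0 \<Longrightarrow> phi l t powr (- 2 * gam l) = (2 / (l + 2)) powr (- l / (l + 2)) * t powr (- l / 2)"
proof -
  assume t: "t > 0"
  have "phi l t powr (- 2 * gam l) = (2 / (l + 2)) powr (- 2 * gam l) * (t powr ((l + 2) / 2)) powr (- 2 * gam l)"
    unfolding phi_def using l t by (intro powr_mult)
  also note gam_twice(1)
  also have "(t powr ((l + 2) / 2)) powr (- l / (l + 2)) = t powr (- l / 2)"
  proof -
    have "l + 2 \<noteq> 0" using l by simp
    then have "(l + 2) / 2 * (- l / (l + 2)) = - l / 2"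
      unfolding times_divide_times_eq by (simp add: nonzero_divide_eq_eq field_simps)
    then show ?thesis unfolding powr_powr by (simp only:)
  qed
  finally show ?thesis unfolding gam_twice(1) .
qed

text \<open>
  The constant \<open>c\<^sub>l\<close> is chosen such that \<open>c\<^sub>l \<phi>'(t)\<close> times the kernel at \<open>\<tau> = q = \<phi>(t)\<close>, \<open>r = 0\<close> is \<open>1\<close>.
\<close>

lemma c_const_normalization: "t > 0 \<Longrightarrow> c_const l * (t powr (l / 2) * (4 * (phi l t)\<^sup>2) powr (- gam l)) = 1"
proof -
  assume t: "t > 0"
  have "(4 * (phi l t)\<^sup>2) powr (- gam l) = ((2 * phi l t) powr 2) powr (- gam l)"
    using phi_pos[OF t] by (simp add: power_mult_distrib)
  also have "\<dots> = 2 powr (- 2 * gam l) * phi l t powr (- 2 * gam l)"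
  proof -
    have "((2 * phi l t) powr 2) powr (- gam l) = (2 * phi l t) powr (- 2 * gam l)"
      unfolding powr_powr by simp
    then show ?thesis using phi_pos[OF t] by (simp add: powr_mult)
  qed
  also have "\<dots> = 2 powr (- l / (l + 2)) * ((2 / (l + 2)) powr (- l / (l + 2)) * t powr (- l / 2))"
    unfolding phi_powr[OF t] unfolding gam_twice(1) ..
  finally have "c_const l * (t powr (l / 2) * (4 * (phi l t)\<^sup>2) powr (- gam l))
    = (((l + 2) / 4) powr (- l / (l + 2)) * 2 powr (- l / (l + 2)) * (2 / (l + 2)) powr (- l / (l + 2)))
      * (t powr (l / 2) * t powr (- l / 2))"
    by (simp add: c_const_def)
  also have "t powr (l / 2) * t powr (- l / 2) = 1" using t by (simp add: powr_add[symmetric])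
  also have "((l + 2) / 4) powr (- l / (l + 2)) * 2 powr (- l / (l + 2)) * (2 / (l + 2)) powr (- l / (l + 2)) = 1"
    using l by (simp add: powr_mult[symmetric])
  finally show ?thesis by simp
qed

lemma phi_powr_one: "t > 0 \<Longrightarrow> phi l t powr (1 - 2 * gam l) = (2 / (l + 2)) powr (2 / (l + 2)) * t"
proof -
  assume t: "t > 0"
  note e = gam_twice(2)
  have "phi l t powr (1 - 2 * gam l) = (2 / (l + 2)) powr (2 / (l + 2)) * (t powr ((l + 2) / 2)) powr (2 / (l + 2))"
    unfolding phi_def e using l t by (intro powr_mult)
  also have "(t powr ((l + 2) / 2)) powr (2 / (l + 2)) = t"
  proof -
    have "(l + 2) / 2 * (2 / (l + 2)) = 1" using l by simp
    then show ?thesis unfolding powr_powr using t by (simp del: times_divide_eq_right)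
  qed
  finally show ?thesis .
qed

lemma phi_ratio: "t > 0 \<Longrightarrow> b > 0 \<Longrightarrow> (phi l t / phi l b) powr \<kappa> = (t / b) powr ((l + 2) / 2 * \<kappa>)"
proof -
  assume t: "t > 0" "b > 0"
  have "phi l t / phi l b = t powr ((l + 2) / 2) / b powr ((l + 2) / 2)"
    using l t by (simp add: phi_def)
  also have "\<dots> = (t / b) powr ((l + 2) / 2)" using t by (simp add: powr_divide)
  finally show ?thesis by (simp only: powr_powr)
qed

end

text \<open>
  Away from its right end, derivatives within \<open>[0, T]\<close> are derivatives within \<open>[0, \<infinity>)\<close>. This gives
  derivatives of \<open>w\<close> in \<open>r\<close> that depend on no choice of neighbourhood.
\<close>

lemma half_line_derivative:
  fixes h :: "real \<Rightarrow> complex"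
  assumes r: "0 \<le> r" "r < T"
    and d: "(\<lambda>s. h (r + s *\<^sub>R 1)) differentiable (at 0 within {s. r + s *\<^sub>R 1 \<in> {0..T}})"
  shows "(h has_vector_derivative partial_within {0..} 1 h r) (at r within {0..})"
    and "partial_within {0..T} 1 h r = partial_within {0..} 1 h r"
proof -
  have at: "at 0 within {s. r + s *\<^sub>R 1 \<in> {0..T}} = at 0 within {s. r + s *\<^sub>R 1 \<in> {0..}}"
    by (rule at_within_nhd[of _ "{..<T - r}"]) (use r in auto)
  show eq: "partial_within {0..T} 1 h r = partial_within {0..} 1 h r"
    unfolding partial_within_def at ..
  have "((\<lambda>s. h (r + s *\<^sub>R 1)) has_vector_derivative partial_within {0..} 1 h r) (at 0 within {s. r + s *\<^sub>R 1 \<in> {0..}})"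
    using d vector_derivative_works unfolding partial_within_def at by blast
  moreover have "(\<lambda>s. s - r) ` {0..} = {s. r + s *\<^sub>R 1 \<in> {0..}}"
    by (auto simp: image_iff intro!: bexI[of _ "_ + r"])
  moreover have "((\<lambda>s. s - r) has_vector_derivative 1) (at r within {0..})"
    by (auto intro!: derivative_eq_intros)
  ultimately have "(((\<lambda>s. h (r + s *\<^sub>R 1)) \<circ> (\<lambda>s. s - r)) has_vector_derivative 1 *\<^sub>R partial_within {0..} 1 h r) (at r within {0..})"
    by (intro vector_diff_chain_within) auto
  then show "(h has_vector_derivative partial_within {0..} 1 h r) (at r within {0..})"
    by (simp add: o_def)
qed

text \<open>
  The hypotheses of the theorem.
\<close>

locale wave_setting =
  fixes l :: real and m :: nat
    and \<Omega> :: "((real^'n) \<times> real) set"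
    and a :: "('n \<Rightarrow> nat) \<Rightarrow> real^'n \<Rightarrow> complex"
    and f :: "real^'n \<Rightarrow> real \<Rightarrow> complex"
    and w :: "real^'n \<Rightarrow> real \<Rightarrow> real \<Rightarrow> complex"
  assumes l: "l > -2"
    and dom: "halfspace_domain \<Omega>"
    and backward: "backward_time_connected \<Omega>"
    and coeff: "\<And>\<alpha>. \<alpha> \<in> multi_indices m \<Longrightarrow> smooth_on (fst ` \<Omega>) (a \<alpha>)"
    and reg: "\<And>x0 t0. (x0, t0) \<in> \<Omega> \<Longrightarrow> t0 > 0 \<Longrightarrow>
               \<exists>U. open U \<and> x0 \<in> U \<and> Cm20_on m (U \<times> {0..phi l t0} \<times> {0..t0}) w"
    and pde: "\<And>x r b. (x, r) \<in> phi_image l \<Omega> \<Longrightarrow> (x, b) \<in> \<Omega> \<Longrightarrow>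
               partial 1 (partial 1 (\<lambda>r. w x r b)) r - diff_op m a (\<lambda>y. w y r b) x = 0"
    and init: "\<And>x b. (x, b) \<in> \<Omega> \<Longrightarrow> w x 0 b = f x b"
begin

abbreviation "g \<equiv> gam l"

lemma g: "g < 1/2" by (rule gam_less[OF l])

lemma \<Omega>_nonneg: "(x, t) \<in> \<Omega> \<Longrightarrow> 0 \<le> t"
  using dom openin_subset[of "top_of_set closed_upper_halfspace" \<Omega>]
  unfolding halfspace_domain_def closed_upper_halfspace_def by auto

lemma \<Omega>_back: "(x, t) \<in> \<Omega> \<Longrightarrow> 0 < s \<Longrightarrow> s \<le> t \<Longrightarrow> (x, s) \<in> \<Omega>"
  using backward unfolding backward_time_connected_def by fastforce

lemma \<Omega>_nhd:
  assumes "(x, t) \<in> \<Omega>"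
  obtains d where "d > 0" "\<And>y s. dist y x < d \<Longrightarrow> \<bar>s - t\<bar> < d \<Longrightarrow> 0 \<le> s \<Longrightarrow> (y, s) \<in> \<Omega>"
proof -
  obtain S where S: "open S" "\<Omega> = closed_upper_halfspace \<inter> S"
    using dom unfolding halfspace_domain_def openin_open by blast
  then obtain e where e: "e > 0" "ball (x, t) e \<subseteq> S" using assms open_contains_ball by blast
  show thesis
  proof
    show "e / 2 > 0" using e by simp
    fix y s assume a: "dist y x < e / 2" "\<bar>s - t\<bar> < e / 2" "0 \<le> s"
    have "dist (x, t) (y, s) \<le> dist y x + \<bar>s - t\<bar>"
      unfolding dist_prod_def
      using sqrt_sum_squares_le_sum_abs[of "dist x y" "dist t s"] by (simp add: dist_commute dist_real_def abs_minus_commute)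
    also have "\<dots> < e" using a by simp
    finally have "(y, s) \<in> S" using e by auto
    then show "(y, s) \<in> \<Omega>" using S a by (auto simp: closed_upper_halfspace_def)
  qed
qed

lemma \<Omega>_later:
  assumes "(x, t) \<in> \<Omega>"
  obtains t1 where "t < t1" "(x, t1) \<in> \<Omega>"
proof -
  obtain d where d: "d > 0" "\<And>y s. dist y x < d \<Longrightarrow> \<bar>s - t\<bar> < d \<Longrightarrow> 0 \<le> s \<Longrightarrow> (y, s) \<in> \<Omega>"
    using \<Omega>_nhd[OF assms] by blast
  show thesis by (rule that[of "t + d/2"]) (use d \<Omega>_nonneg[OF assms] in auto)
qed

abbreviation "V \<equiv> \<Omega> \<inter> upper_halfspace"

lemma open_V: "open V"
proof -
  have V: "V = {p \<in> \<Omega>. 0 < snd p}" by (auto simp: upper_halfspace_def)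
  show ?thesis
  proof (subst open_subopen, intro ballI)
    fix p assume "p \<in> V"
    then obtain x t where p: "p = (x, t)" "(x, t) \<in> \<Omega>" "0 < t" by (cases p) (auto simp: V)
    obtain d where d: "d > 0" "\<And>y s. dist y x < d \<Longrightarrow> \<bar>s - t\<bar> < d \<Longrightarrow> 0 \<le> s \<Longrightarrow> (y, s) \<in> \<Omega>"
      using \<Omega>_nhd[OF p(2)] by blast
    have "ball p (min d t) \<subseteq> V"
    proof
      fix q assume q: "q \<in> ball p (min d t)"
      obtain y s where ys: "q = (y, s)" by (cases q)
      have "dist y x < min d t" "dist s t < min d t"
        using q dist_fst_le[of p q] dist_snd_le[of p q] by (auto simp: ys p dist_commute)
      then show "q \<in> V" using d p by (auto simp: ys V dist_real_def)
    qed
    then show "\<exists>T. open T \<and> p \<in> T \<and> T \<subseteq> V" using d p by (intro exI[of _ "ball p (min d t)"]) auto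
  qed
qed

text \<open>
  The points at which \<open>w(x, r; b)\<close> is controlled: one time \<open>t\<close> with \<open>(x, t)\<close> in the domain bounds both
  \<open>r\<close> and \<open>b\<close>.
\<close>

definition Q :: "((real^'n) \<times> real \<times> real) set" where
  "Q = {(x, r, b). \<exists>t. (x, t) \<in> \<Omega> \<and> 0 < t \<and> 0 \<le> r \<and> r \<le> phi l t \<and> 0 \<le> b \<and> b \<le> t}"

definition DX :: "((real^'n) \<times> real \<times> real) set" where
  "DX = {(axis i 1, 0, 0) | i. True}"

lemma Q_I: "(x, t) \<in> \<Omega> \<Longrightarrow> 0 < t \<Longrightarrow> 0 \<le> r \<Longrightarrow> r \<le> phi l t \<Longrightarrow> 0 \<le> b \<Longrightarrow> b \<le> t \<Longrightarrow> (x, r, b) \<in> Q"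
  by (auto simp: Q_def)

lemma dir_open_Q: "dir_open DX Q"
  unfolding dir_open_def
proof (intro ballI)
  fix p e assume "p \<in> Q" "e \<in> DX"
  then obtain x r b t i where p: "p = (x, r, b)" "(x, t) \<in> \<Omega>" "0 < t" "0 \<le> r" "r \<le> phi l t" "0 \<le> b" "b \<le> t"
    and e: "e = (axis i 1, 0, 0)" by (auto simp: Q_def DX_def)
  obtain d where d: "d > 0" "\<And>y s. dist y x < d \<Longrightarrow> \<bar>s - t\<bar> < d \<Longrightarrow> 0 \<le> s \<Longrightarrow> (y, s) \<in> \<Omega>"
    using \<Omega>_nhd[OF p(2)] by blast
  have "p + s *\<^sub>R e \<in> Q" if "\<bar>s\<bar> < d" for s
  proof -
    have "(x + s *\<^sub>R axis i 1, t) \<in> \<Omega>" by (rule d(2)) (use that d p in \<open>auto simp: dist_norm\<close>)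
    then show ?thesis using p by (auto simp: e p(1) intro: Q_I)
  qed
  then show "\<exists>\<delta>>0. \<forall>s. \<bar>s\<bar> < \<delta> \<longrightarrow> p + s *\<^sub>R e \<in> Q" using d(1) by blast
qed

lemma reg_near:
  assumes "(x, r, b) \<in> Q"
  obtains U t1 where "open U" "x \<in> U" "0 < t1" "r < phi l t1" "b < t1" "Cm20_on m (U \<times> {0..phi l t1} \<times> {0..t1}) w"
proof -
  obtain t where t: "(x, t) \<in> \<Omega>" "0 < t" "0 \<le> r" "r \<le> phi l t" "0 \<le> b" "b \<le> t"
    using assms by (auto simp: Q_def)
  obtain t1 where t1: "t < t1" "(x, t1) \<in> \<Omega>" using \<Omega>_later[OF t(1)] by blast
  obtain U where "open U" "x \<in> U" "Cm20_on m (U \<times> {0..phi l t1} \<times> {0..t1}) w"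
    using reg[OF t1(2)] t t1 by auto
  then show thesis using that[of U t1] t t1 phi_less[OF l, of t t1] by auto
qed

lemma w_Ck: "Ck_along DX m Q (\<lambda>(x, r, b). w x r b)"
proof (rule Ck_along_local[OF dir_open_Q])
  fix p assume p: "p \<in> Q"
  obtain x r b where pe: "p = (x, r, b)" by (cases p)
  obtain U t1 where U: "open U" "x \<in> U" "0 < t1" "r < phi l t1" "b < t1" "Cm20_on m (U \<times> {0..phi l t1} \<times> {0..t1}) w"
    using reg_near p pe by blast
  let ?S = "U \<times> {0..phi l t1} \<times> {0..t1}"
  let ?W = "U \<times> {..<phi l t1} \<times> {..<t1}"
  have oW: "open ?W" using U by (intro open_Times) auto
  have sub: "Q \<inter> ?W \<subseteq> ?S" by (auto simp: Q_def)
  have dS: "dir_open DX ?S" unfolding dir_open_def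
  proof (intro ballI)
    fix p e assume pe: "p \<in> ?S" "e \<in> DX"
    then have "dir_open {fst e} U" using U by (intro dir_open_open) auto
    then obtain d where d: "d > 0" "\<forall>s. \<bar>s\<bar> < d \<longrightarrow> fst p + s *\<^sub>R fst e \<in> U"
      unfolding dir_open_def using pe by (auto simp: mem_Times_iff)
    then show "\<exists>\<delta>>0. \<forall>s. \<bar>s\<bar> < \<delta> \<longrightarrow> p + s *\<^sub>R e \<in> ?S"
      using pe by (intro exI[of _ d]) (auto simp: mem_Times_iff DX_def)
  qed
  have "Ck_along DX m ?S (\<lambda>(x, r, b). w x r b)" using U(6) by (simp add: Cm20_on_def DX_def)
  then have "Ck_along DX m (Q \<inter> ?W) (\<lambda>(x, r, b). w x r b)"
    by (rule Ck_along_subset[OF dS dir_open_Int[OF dir_open_Q dir_open_open[OF oW]] sub subset_refl])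
  then show "\<exists>W. open W \<and> p \<in> W \<and> Ck_along DX m (Q \<inter> W) (\<lambda>(x, r, b). w x r b)"
    using oW U pe by (intro exI[of _ ?W]) auto
qed

definition w1 where "w1 x r b = partial_within {0..} 1 (\<lambda>r. w x r b) r"
definition w2 where "w2 x r b = partial_within {0..} 1 (\<lambda>r. w1 x r b) r"

lemma w_r_near:
  assumes U: "open U" "0 < t1" "Cm20_on m (U \<times> {0..phi l t1} \<times> {0..t1}) w"
    and p: "x \<in> U" "0 \<le> r" "r < phi l t1" "0 \<le> b" "b \<le> t1"
  defines "S \<equiv> U \<times> {0..phi l t1} \<times> {0..t1}"
    and "F \<equiv> (\<lambda>(x, r, b). w x r b)"
  shows "((\<lambda>r. w x r b) has_vector_derivative w1 x r b) (at r within {0..})"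
    and "((\<lambda>r. w1 x r b) has_vector_derivative w2 x r b) (at r within {0..})"
    and "partial_within S (0, 1, 0) F (x, r, b) = w1 x r b"
    and "partial_within S (0, 1, 0) (partial_within S (0, 1, 0) F) (x, r, b) = w2 x r b"
proof -
  let ?e = "(0, 1, 0) :: (real^'n) \<times> real \<times> real"
  let ?T = "phi l t1"
  have C: "Ck_along {?e} 2 S F" using U(3) by (simp add: Cm20_on_def S_def F_def)
  have set_eq: "{s. (x, r', b) + s *\<^sub>R ?e \<in> S} = {s. r' + s *\<^sub>R 1 \<in> {0..?T}}" for r'
    using p by (auto simp: S_def)
  have pw: "partial_within S ?e H (x, r', b) = partial_within {0..?T} 1 (\<lambda>r. H (x, r, b)) r'" for r' and H :: "(real^'n) \<times> real \<times> real \<Rightarrow> complex"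
    unfolding partial_within_def set_eq by simp
  have d1: "(\<lambda>s. w x (r' + s *\<^sub>R 1) b) differentiable (at 0 within {s. r' + s *\<^sub>R 1 \<in> {0..?T}})" if "r' \<in> {0..?T}" for r'
  proof -
    have "(x, r', b) \<in> S" using p that by (auto simp: S_def)
    then have "(\<lambda>s. F ((x, r', b) + s *\<^sub>R ?e)) differentiable (at 0 within {s. (x, r', b) + s *\<^sub>R ?e \<in> S})"
      using C by (auto simp: numeral_2_eq_2 Ck_along.simps(2))
    then show ?thesis unfolding set_eq by (simp add: F_def)
  qed
  have P1: "partial_within S ?e F (x, r', b) = w1 x r' b" if "0 \<le> r'" "r' < ?T" for r'
    unfolding pw using half_line_derivative(2)[OF that d1] that by (simp add: w1_def F_def)
  show "((\<lambda>r. w x r b) has_vector_derivative w1 x r b) (at r within {0..})"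
    unfolding w1_def by (rule half_line_derivative(1)[OF p(2,3) d1]) (use p in auto)
  show "partial_within S (0, 1, 0) F (x, r, b) = w1 x r b" using P1 p by simp
  have S: "(x, r, b) \<in> S" using p by (auto simp: S_def)
  have d2: "(\<lambda>s. partial_within S ?e F ((x, r, b) + s *\<^sub>R ?e)) differentiable (at 0 within {s. (x, r, b) + s *\<^sub>R ?e \<in> S})"
    using C S by (auto simp: numeral_2_eq_2 Ck_along.simps(2))
  let ?h = "\<lambda>r. partial_within S ?e F (x, r, b)"
  have d2': "(\<lambda>s. ?h (r + s *\<^sub>R 1)) differentiable (at 0 within {s. r + s *\<^sub>R 1 \<in> {0..?T}})"
    using d2 unfolding set_eq by simp
  have hd: "(?h has_vector_derivative partial_within {0..} 1 ?h r) (at r within {0..})"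
    by (rule half_line_derivative(1)[OF p(2,3) d2'])
  have w1d: "((\<lambda>r. w1 x r b) has_vector_derivative partial_within {0..} 1 ?h r) (at r within {0..})"
    by (rule has_vector_derivative_transform_within[OF hd, of "?T - r"])
       (use p P1 in \<open>auto simp: dist_real_def\<close>)
  have sh: "((\<lambda>s. w1 x (r + s *\<^sub>R 1) b) has_vector_derivative partial_within {0..} 1 ?h r) (at 0 within {s. r + s *\<^sub>R 1 \<in> {0..}})"
  proof -
    have "((\<lambda>s. r + s *\<^sub>R 1) has_vector_derivative 1) (at 0 within {s. r + s *\<^sub>R 1 \<in> {0..}})"
      by (auto intro!: derivative_eq_intros)
    moreover have "((\<lambda>r. w1 x r b) has_vector_derivative partial_within {0..} 1 ?h r) (at (r + 0 *\<^sub>R 1) within ((\<lambda>s. r + s *\<^sub>R 1) ` {s. r + s *\<^sub>R 1 \<in> {0..}}))"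
      using w1d by (auto intro: has_vector_derivative_within_subset)
    ultimately show ?thesis using vector_diff_chain_within by (fastforce simp: o_def)
  qed
  have nt: "at 0 within {s. r + s *\<^sub>R 1 \<in> {0..}} \<noteq> bot"
  proof -
    have "at 0 within {s. r + s *\<^sub>R 1 \<in> {0..}} \<ge> at_right (0::real)"
      using p by (intro at_le) auto
    then show ?thesis using trivial_limit_at_right_real[of 0] by (metis bot.extremum_uniqueI)
  qed
  have w2: "w2 x r b = partial_within {0..} 1 ?h r"
    unfolding w2_def partial_within_def[of _ _ "\<lambda>r. w1 x r b"]
    by (rule vector_derivative_within[OF nt sh])
  show "((\<lambda>r. w1 x r b) has_vector_derivative w2 x r b) (at r within {0..})"
    unfolding w2 by (rule w1d)
  show "partial_within S (0, 1, 0) (partial_within S (0, 1, 0) F) (x, r, b) = w2 x r b"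
    unfolding w2 pw[of "partial_within S ?e F"] by (rule half_line_derivative(2)[OF p(2,3) d2'])
qed

lemma
  assumes p: "(x, r, b) \<in> Q"
  shows w_deriv: "((\<lambda>r. w x r b) has_vector_derivative w1 x r b) (at r within {0..})"
    and w1_deriv: "((\<lambda>r. w1 x r b) has_vector_derivative w2 x r b) (at r within {0..})"
proof -
  obtain U t1 where U: "open U" "x \<in> U" "0 < t1" "r < phi l t1" "b < t1" "Cm20_on m (U \<times> {0..phi l t1} \<times> {0..t1}) w"
    using reg_near p by blast
  have "0 \<le> r" "0 \<le> b" "b \<le> t1" using p U by (auto simp: Q_def)
  then show "((\<lambda>r. w x r b) has_vector_derivative w1 x r b) (at r within {0..})"
    "((\<lambda>r. w1 x r b) has_vector_derivative w2 x r b) (at r within {0..})"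
    using w_r_near(1,2)[OF U(1,3,6,2) _ U(4)] by auto
qed

lemma w12_continuous:
  "continuous_on Q (\<lambda>(x, r, b). w1 x r b)" "continuous_on Q (\<lambda>(x, r, b). w2 x r b)"
proof -
  have near: "continuous_on (Q \<inter> W) (\<lambda>(x, r, b). w1 x r b) \<and> continuous_on (Q \<inter> W) (\<lambda>(x, r, b). w2 x r b)"
    if "open U" "x \<in> U" "0 < t1" "r < phi l t1" "b < t1" and C: "Cm20_on m (U \<times> {0..phi l t1} \<times> {0..t1}) w"
     and W: "W = U \<times> {..<phi l t1} \<times> {..<t1}" for U t1 x r b W
  proof -
    let ?S = "U \<times> {0..phi l t1} \<times> {0..t1}" and ?F = "(\<lambda>(x, r, b). w x r b)"
    let ?e = "(0, 1, 0) :: (real^'n) \<times> real \<times> real"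
    have sub: "Q \<inter> W \<subseteq> ?S" by (auto simp: Q_def W)
    have "continuous_on ?S (partial_within ?S ?e ?F)" "continuous_on ?S (partial_within ?S ?e (partial_within ?S ?e ?F))"
      using C by (auto simp: Cm20_on_def numeral_2_eq_2 Ck_along.simps(2))
    note c = this[THEN continuous_on_subset, OF sub]
    have "partial_within ?S ?e ?F p = (\<lambda>(x, r, b). w1 x r b) p
       \<and> partial_within ?S ?e (partial_within ?S ?e ?F) p = (\<lambda>(x, r, b). w2 x r b) p" if p: "p \<in> Q \<inter> W" for p
    proof -
      obtain y r' b' where pe: "p = (y, r', b')" by (cases p)
      have "y \<in> U" "0 \<le> r'" "r' < phi l t1" "0 \<le> b'" "b' \<le> t1" using p by (auto simp: pe Q_def W)
      then show ?thesis using w_r_near(3,4)[OF \<open>open U\<close> \<open>0 < t1\<close> C] by (simp add: pe)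
    qed
    then have "continuous_on (Q \<inter> W) (partial_within ?S ?e ?F) = continuous_on (Q \<inter> W) (\<lambda>(x, r, b). w1 x r b)"
      "continuous_on (Q \<inter> W) (partial_within ?S ?e (partial_within ?S ?e ?F)) = continuous_on (Q \<inter> W) (\<lambda>(x, r, b). w2 x r b)"
      by (intro continuous_on_cong refl; blast)+
    then show ?thesis using c by blast
  qed
  have "\<exists>W. open W \<and> p \<in> W \<and> continuous_on (Q \<inter> W) (\<lambda>(x, r, b). w1 x r b) \<and> continuous_on (Q \<inter> W) (\<lambda>(x, r, b). w2 x r b)" if p: "p \<in> Q" for p
  proof -
    obtain x r b where pe: "p = (x, r, b)" by (cases p)
    obtain U t1 where U: "open U" "x \<in> U" "0 < t1" "r < phi l t1" "b < t1" "Cm20_on m (U \<times> {0..phi l t1} \<times> {0..t1}) w"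
      using reg_near p pe by blast
    then have "open (U \<times> {..<phi l t1} \<times> {..<t1})" by (intro open_Times) auto
    then show ?thesis
      using near[OF U refl] U pe
      by (intro exI[of _ "U \<times> {..<phi l t1} \<times> {..<t1}"]) auto
  qed
  then have *: "\<exists>W. open W \<and> p \<in> W \<and> Ck_along {} 0 (Q \<inter> W) (\<lambda>(x, r, b). w1 x r b)"
    "\<exists>W. open W \<and> p \<in> W \<and> Ck_along {} 0 (Q \<inter> W) (\<lambda>(x, r, b). w2 x r b)" if "p \<in> Q" for p
    using that by (simp; blast)+
  have "Ck_along {} 0 Q (\<lambda>(x, r, b). w1 x r b)" "Ck_along {} 0 Q (\<lambda>(x, r, b). w2 x r b)"
    by (rule Ck_along_local; use * in \<open>auto simp: dir_open_def\<close>)+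
  then show "continuous_on Q (\<lambda>(x, r, b). w1 x r b)" "continuous_on Q (\<lambda>(x, r, b). w2 x r b)" by auto
qed

definition wd :: "'n list \<Rightarrow> real^'n \<Rightarrow> real \<Rightarrow> real \<Rightarrow> complex" where
  "wd is x r b = foldr (\<lambda>i. partial (axis i 1)) is (\<lambda>y. w y r b) x"

lemma wd_fold: "foldr partial (map (\<lambda>i. (axis i 1, 0, 0)) is) (\<lambda>(x, r, b). w x r b) = (\<lambda>(x, r, b). wd is x r b)"
proof (induction "is")
  case (Cons i "is")
  show ?case
    unfolding list.map foldr.simps o_def Cons
    by (auto simp: fun_eq_iff wd_def partial_within_def)
qed (simp add: wd_def)

lemma wd_Ck: "length is \<le> m \<Longrightarrow> Ck_along DX (m - length is) Q (\<lambda>(x, r, b). wd is x r b)"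
  using Ck_along_fold[OF dir_open_Q w_Ck, of "map (\<lambda>i. (axis i 1, 0, 0)) is"]
  by (auto simp: wd_fold DX_def)

lemma wd_continuous: "length is \<le> m \<Longrightarrow> continuous_on Q (\<lambda>(x, r, b). wd is x r b)"
  by (rule Ck_along_continuous[OF wd_Ck])

lemma wd_Nil: "wd [] = w"
  by (intro ext) (simp add: wd_def)

lemma w_continuous: "continuous_on Q (\<lambda>(x, r, b). w x r b)"
  by (rule wd_continuous[of "[]", unfolded wd_Nil]) simp

lemma wd_deriv:
  assumes "length is < m" "(x, r, b) \<in> Q"
  shows "((\<lambda>s. wd is (x + s *\<^sub>R axis i 1) r b) has_vector_derivative wd (i # is) x r b) (at 0)"
proof -
  define j where "j = m - length is - 1"
  have j: "m - length is = Suc j" using assms(1) unfolding j_def by linarith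
  have e: "(axis i 1, 0, 0) \<in> DX" by (auto simp: DX_def)
  have "Ck_along DX (Suc j) Q (\<lambda>(x, r, b). wd is x r b)"
    using wd_Ck[of "is"] assms(1) unfolding j by simp
  then have "(\<lambda>s. (\<lambda>(x, r, b). wd is x r b) ((x, r, b) + s *\<^sub>R (axis i 1, 0, 0))) differentiable (at 0)"
    unfolding Ck_along_Suc_iff[OF dir_open_Q] using e assms(2) by blast
  then have "(\<lambda>s. wd is (x + s *\<^sub>R axis i 1) r b) differentiable (at 0)" by simp
  from has_partial[OF this] show ?thesis by (simp add: wd_def)
qed

text \<open>
  The point \<open>r = 0\<close> is excluded, where only one-sided derivatives exist.
\<close>

lemma w2_eq:
  assumes "(x, t) \<in> \<Omega>" "0 < r" "r \<le> phi l t" "(x, b) \<in> \<Omega>"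
  shows "w2 x r b = (\<Sum>\<alpha>\<in>multi_indices m. a \<alpha> x * wd (multi_list \<alpha>) x r b)"
proof -
  have im: "(x, r) \<in> phi_image l \<Omega>" using assms by (auto simp: phi_image_def)
  have pd: "partial 1 (partial 1 (\<lambda>r. w x r b)) r = diff_op m a (\<lambda>y. w y r b) x"
    by (rule eq_iff_diff_eq_0[THEN iffD2, OF pde[OF im assms(4)]])
  have half: "partial 1 h r' = partial_within {0..} 1 h r'" if "0 < r'" for r' and h :: "real \<Rightarrow> complex"
  proof -
    have "at 0 within {s. r' + s *\<^sub>R 1 \<in> {0..}} = at 0"
      by (rule at_within_nhd[of _ "{-r'<..}"]) (use that in auto)
    then show ?thesis by (simp add: partial_within_def)
  qed
  have "w2 x r b = partial 1 (\<lambda>r. w1 x r b) r" unfolding w2_def half[OF assms(2)] ..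
  also have "\<dots> = partial 1 (partial 1 (\<lambda>r. w x r b)) r"
  proof (rule partial_cong_on(1)[of "{1}" "{0<..}"])
    show "dir_open {1::real} {0<..}" by (rule dir_open_open) simp
    show "w1 x p b = partial 1 (\<lambda>r. w x r b) p" if "p \<in> {0<..}" for p
      using half[of p] that unfolding w1_def by simp
  qed (use assms in auto)
  also note pd
  finally show ?thesis unfolding diff_op_def multi_pow_eq wd_def .
qed

end

section \<open>Bounds for the Riemann function and integrals with parameters\<close>

text \<open>
  With \<open>\<kappa> = max g 0\<close> one has \<open>S\<^sup>-\<^sup>g \<le> (4\<tau>\<^sup>2)\<^sup>\<kappa>\<^sup>-\<^sup>g (\<tau>(\<tau> - r))\<^sup>-\<^sup>\<kappa>\<close>, and \<open>\<kappa> < 1\<close> makes this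
  integrable. The exponent of \<open>\<tau>\<close> is dictated by homogeneity.
\<close>

lemma riem_integral_bound:
  assumes g: "g < 1/2"
  obtains C where "C \<ge> 0" "\<And>q \<tau> M G. 0 < q \<Longrightarrow> q \<le> \<tau> \<Longrightarrow> continuous_on {0..\<tau> - q} G \<Longrightarrow>
     (\<And>r. r \<in> {0..\<tau> - q} \<Longrightarrow> norm (G r) \<le> M) \<Longrightarrow> norm (epd g q G \<tau>) \<le> C * M * \<tau> powr (1 - 2 * g)"
proof -
  define \<kappa> where "\<kappa> = max g 0"
  have \<kappa>: "0 \<le> \<kappa>" "\<kappa> < 1" "g \<le> \<kappa>" using g by (auto simp: \<kappa>_def)
  define C where "C = hypF g 1 * 4 powr (\<kappa> - g) / (1 - \<kappa>)"
  have F1: "0 \<le> hypF g 1" by (rule hypF_nonneg[OF g]) auto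
  show thesis
  proof (rule that)
    show "C \<ge> 0" using F1 \<kappa> by (simp add: C_def)
    fix q \<tau> M and G :: "real \<Rightarrow> complex"
    assume q: "0 < q" "q \<le> \<tau>" and G: "continuous_on {0..\<tau> - q} G" "\<And>r. r \<in> {0..\<tau> - q} \<Longrightarrow> norm (G r) \<le> M"
    have \<tau>: "\<tau> > 0" using q by simp
    have M: "0 \<le> M" by (rule order_trans[OF norm_ge_zero G(2)[of 0]]) (use q in auto)
    define A where "A = hypF g 1 * ((4 * \<tau>\<^sup>2) powr (\<kappa> - g) * \<tau> powr (- \<kappa>)) * M"
    have A: "A \<ge> 0" using F1 M by (simp add: A_def)
    have pt: "norm (riem g \<tau> q r *\<^sub>R G r) \<le> A * (\<tau> - r) powr (- \<kappa>)" if r: "r \<in> {0..\<tau> - q}" for r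
    proof -
      have D: "(\<tau>, q, r) \<in> riem_dom" using r q by (intro riem_dom_I) auto
      have S0: "riem_S \<tau> q r > 0" by (rule riem_S_pos[OF D])
      have S1: "riem_S \<tau> q r \<le> 4 * \<tau>\<^sup>2"
      proof -
        have "(\<tau> + q)\<^sup>2 \<le> (2 * \<tau>)\<^sup>2" using q by (intro power_mono) auto
        then show ?thesis by (simp add: riem_S_def power_mult_distrib) (smt (verit) zero_le_power2)
      qed
      have S2: "\<tau> * (\<tau> - r) \<le> riem_S \<tau> q r"
      proof -
        have "\<tau> * (\<tau> - r) \<le> (\<tau> + q + r) * (\<tau> + q - r)" using q r by (intro mult_mono) auto
        then show ?thesis by (simp add: riem_S_def power2_eq_square algebra_simps)
      qed
      have "riem_S \<tau> q r powr (- g) = riem_S \<tau> q r powr (\<kappa> - g) * riem_S \<tau> q r powr (- \<kappa>)"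
        by (simp add: powr_add[symmetric])
      also have "\<dots> \<le> (4 * \<tau>\<^sup>2) powr (\<kappa> - g) * (\<tau> * (\<tau> - r)) powr (- \<kappa>)"
        using S0 S1 S2 \<kappa> q r \<tau> by (intro mult_mono powr_mono2 powr_mono2') auto
      also have "(\<tau> * (\<tau> - r)) powr (- \<kappa>) = \<tau> powr (- \<kappa>) * (\<tau> - r) powr (- \<kappa>)"
        using q r \<tau> by (intro powr_mult)
      finally have S3: "riem_S \<tau> q r powr (- g) \<le> (4 * \<tau>\<^sup>2) powr (\<kappa> - g) * (\<tau> powr (- \<kappa>) * (\<tau> - r) powr (- \<kappa>))" .
      have "norm (riem g \<tau> q r *\<^sub>R G r) \<le> (hypF g 1 * riem_S \<tau> q r powr (- g)) * M"
        unfolding norm_scaleR using riem_bound[OF g q] r G(2)[OF r] F1 by (intro mult_mono) auto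
      also have "\<dots> \<le> (hypF g 1 * ((4 * \<tau>\<^sup>2) powr (\<kappa> - g) * (\<tau> powr (- \<kappa>) * (\<tau> - r) powr (- \<kappa>)))) * M"
        using S3 F1 M by (intro mult_right_mono mult_left_mono)
      also have "\<dots> = A * (\<tau> - r) powr (- \<kappa>)" by (simp add: A_def)
      finally show ?thesis .
    qed
    have I: "((\<lambda>r. A * (\<tau> - r) powr (- \<kappa>)) has_integral
        A * (- ((\<tau> - (\<tau> - q)) powr (1 - \<kappa>)) / (1 - \<kappa>)) - A * (- ((\<tau> - 0) powr (1 - \<kappa>)) / (1 - \<kappa>))) {0..\<tau> - q}"
    proof (rule fundamental_theorem_of_calculus)
      show "0 \<le> \<tau> - q" using q by simp
      fix r assume r: "r \<in> {0..\<tau> - q}"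
      have p: "\<tau> - r > 0" using r q by auto
      have "((\<lambda>r. (\<tau> - r) powr (1 - \<kappa>)) has_real_derivative ((1 - \<kappa>) * (\<tau> - r) powr (1 - \<kappa> - 1)) * (- 1)) (at r)"
        by (rule DERIV_chain2[where f = "\<lambda>z. z powr (1 - \<kappa>)" and g = "\<lambda>r. \<tau> - r", OF has_real_derivative_powr[OF p]])
           (auto intro!: derivative_eq_intros)
      then have "((\<lambda>r. (\<tau> - r) powr (1 - \<kappa>)) has_real_derivative - ((1 - \<kappa>) * (\<tau> - r) powr (- \<kappa>))) (at r)" by simp
      then have "((\<lambda>r. A * (- ((\<tau> - r) powr (1 - \<kappa>)) / (1 - \<kappa>))) has_real_derivative
          A * (- (- ((1 - \<kappa>) * (\<tau> - r) powr (- \<kappa>))) / (1 - \<kappa>))) (at r)"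
        by (intro DERIV_cmult DERIV_cdivide DERIV_minus)
      then have "((\<lambda>r. A * (- ((\<tau> - r) powr (1 - \<kappa>)) / (1 - \<kappa>))) has_real_derivative A * (\<tau> - r) powr (- \<kappa>)) (at r)"
        using \<kappa> by simp
      then show "((\<lambda>r. A * (- ((\<tau> - r) powr (1 - \<kappa>)) / (1 - \<kappa>))) has_vector_derivative A * (\<tau> - r) powr (- \<kappa>)) (at r within {0..\<tau> - q})"
        by (auto simp: has_real_derivative_iff_has_vector_derivative intro: has_vector_derivative_at_within)
    qed
    have "norm (epd g q G \<tau>) \<le> integral {0..\<tau> - q} (\<lambda>r. A * (\<tau> - r) powr (- \<kappa>))"
      unfolding epd_def
    proof (rule integral_norm_bound_integral)
      show "(\<lambda>r. riem g \<tau> q r *\<^sub>R G r) integrable_on {0..\<tau> - q}"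
        by (intro integrable_continuous_real continuous_on_scaleR G riem_dom_compose[OF riem_continuous(1)[OF g]] continuous_intros)
           (use q in auto)
      show "(\<lambda>r. A * (\<tau> - r) powr (- \<kappa>)) integrable_on {0..\<tau> - q}" using I by blast
    qed (rule pt)
    also have "\<dots> = A * (- (q powr (1 - \<kappa>)) / (1 - \<kappa>)) - A * (- (\<tau> powr (1 - \<kappa>)) / (1 - \<kappa>))"
      using integral_unique[OF I] by simp
    also have "\<dots> \<le> A * (\<tau> powr (1 - \<kappa>) / (1 - \<kappa>))" using A \<kappa> by simp
    also have "\<dots> = C * M * \<tau> powr (1 - 2 * g)"
    proof -
      have "(4 * \<tau>\<^sup>2) powr (\<kappa> - g) = 4 powr (\<kappa> - g) * \<tau> powr (2 * (\<kappa> - g))"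
      proof -
        have "\<tau>\<^sup>2 = \<tau> powr 2" using \<tau> by simp
        then have "(\<tau>\<^sup>2) powr (\<kappa> - g) = \<tau> powr (2 * (\<kappa> - g))" by (simp only: powr_powr)
        then show ?thesis using \<tau> by (simp add: powr_mult)
      qed
      moreover have "\<tau> powr (2 * (\<kappa> - g)) * \<tau> powr (- \<kappa>) * \<tau> powr (1 - \<kappa>) = \<tau> powr (1 - 2 * g)"
        using \<tau> by (simp add: powr_add[symmetric])
      ultimately show ?thesis by (simp add: A_def C_def mult.assoc[symmetric])
    qed
    finally show "norm (epd g q G \<tau>) \<le> C * M * \<tau> powr (1 - 2 * g)" .
  qed
qed

text \<open>
  Here \<open>S\<^sup>-\<^sup>g\<^sup>-\<^sup>1 \<le> (4\<tau>\<^sup>2)\<^sup>\<kappa>\<^sup>-\<^sup>g (\<tau>(\<tau> + q - r))\<^sup>-\<^sup>\<kappa>\<^sup>-\<^sup>1\<close> is integrated explicitly. The singularity at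
  \<open>q = 0\<close> is of order \<open>\<kappa>\<close>, which may be any positive number not below \<open>g\<close>.
\<close>

lemma riem_t_integral_bound:
  assumes g: "g < 1/2" and \<kappa>: "0 < \<kappa>" "g \<le> \<kappa>"
  obtains C where "C \<ge> 0" "\<And>q \<tau> M G. 0 < q \<Longrightarrow> q \<le> \<tau> \<Longrightarrow> continuous_on {0..\<tau> - q} G \<Longrightarrow>
     (\<And>r. r \<in> {0..\<tau> - q} \<Longrightarrow> norm (G r) \<le> M) \<Longrightarrow>
     norm (epd_t g q G \<tau>) \<le> C * M * \<tau> powr (- 2 * g) * (\<tau> / q) powr \<kappa>"
proof -
  define E where "E = (4 * \<bar>g\<bar> + 2) * hypF g 1"
  define C where "C = 4 powr (- g) + E * 4 powr (\<kappa> - g) * 2 powr (- \<kappa>) / \<kappa>"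
  have F1: "0 \<le> hypF g 1" by (rule hypF_nonneg[OF g]) auto
  have E: "E \<ge> 0" using F1 by (simp add: E_def)
  show thesis
  proof (rule that)
    show "C \<ge> 0" using E \<kappa> by (simp add: C_def)
    fix q \<tau> M and G :: "real \<Rightarrow> complex"
    assume q: "0 < q" "q \<le> \<tau>" and G: "continuous_on {0..\<tau> - q} G" "\<And>r. r \<in> {0..\<tau> - q} \<Longrightarrow> norm (G r) \<le> M"
    have \<tau>: "\<tau> > 0" using q by simp
    have M: "0 \<le> M" by (rule order_trans[OF norm_ge_zero G(2)[of 0]]) (use q in auto)
    define A where "A = E * \<tau> * ((4 * \<tau>\<^sup>2) powr (\<kappa> - g) * \<tau> powr (- \<kappa> - 1)) * M"
    have A: "A \<ge> 0" using E \<tau> M by (simp add: A_def)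
    have pt: "norm (riem_t g \<tau> q r *\<^sub>R G r) \<le> A * (\<tau> + q - r) powr (- \<kappa> - 1)" if r: "r \<in> {0..\<tau> - q}" for r
    proof -
      have D: "(\<tau>, q, r) \<in> riem_dom" using r q by (intro riem_dom_I) auto
      have S0: "riem_S \<tau> q r > 0" by (rule riem_S_pos[OF D])
      have S1: "riem_S \<tau> q r \<le> 4 * \<tau>\<^sup>2"
      proof -
        have "(\<tau> + q)\<^sup>2 \<le> (2 * \<tau>)\<^sup>2" using q by (intro power_mono) auto
        then show ?thesis by (simp add: riem_S_def power_mult_distrib) (smt (verit) zero_le_power2)
      qed
      have S2: "\<tau> * (\<tau> + q - r) \<le> riem_S \<tau> q r"
      proof -
        have "\<tau> * (\<tau> + q - r) \<le> (\<tau> + q + r) * (\<tau> + q - r)" using q r by (intro mult_mono) auto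
        then show ?thesis by (simp add: riem_S_def power2_eq_square algebra_simps)
      qed
      have "riem_S \<tau> q r powr (- g - 1) = riem_S \<tau> q r powr (\<kappa> - g) * riem_S \<tau> q r powr (- \<kappa> - 1)"
        by (simp add: powr_add[symmetric])
      also have "\<dots> \<le> (4 * \<tau>\<^sup>2) powr (\<kappa> - g) * (\<tau> * (\<tau> + q - r)) powr (- \<kappa> - 1)"
        using S0 S1 S2 \<kappa> q r \<tau> by (intro mult_mono powr_mono2 powr_mono2') auto
      also have "(\<tau> * (\<tau> + q - r)) powr (- \<kappa> - 1) = \<tau> powr (- \<kappa> - 1) * (\<tau> + q - r) powr (- \<kappa> - 1)"
        using q r \<tau> by (intro powr_mult)
      finally have S3: "riem_S \<tau> q r powr (- g - 1) \<le> (4 * \<tau>\<^sup>2) powr (\<kappa> - g) * (\<tau> powr (- \<kappa> - 1) * (\<tau> + q - r) powr (- \<kappa> - 1))" .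
      have "norm (riem_t g \<tau> q r *\<^sub>R G r) \<le> (E * \<tau> * riem_S \<tau> q r powr (- g - 1)) * M"
        unfolding norm_scaleR E_def using riem_t_bound[OF g q] r G(2)[OF r] F1 \<tau> by (intro mult_mono) auto
      also have "\<dots> \<le> (E * \<tau> * ((4 * \<tau>\<^sup>2) powr (\<kappa> - g) * (\<tau> powr (- \<kappa> - 1) * (\<tau> + q - r) powr (- \<kappa> - 1)))) * M"
        using S3 E M \<tau> by (intro mult_right_mono mult_left_mono) auto
      also have "\<dots> = A * (\<tau> + q - r) powr (- \<kappa> - 1)" by (simp add: A_def)
      finally show ?thesis .
    qed
    have I: "((\<lambda>r. A * (\<tau> + q - r) powr (- \<kappa> - 1)) has_integral
        A * ((\<tau> + q - (\<tau> - q)) powr (- \<kappa>) / \<kappa>) - A * ((\<tau> + q - 0) powr (- \<kappa>) / \<kappa>)) {0..\<tau> - q}"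
    proof (rule fundamental_theorem_of_calculus)
      show "0 \<le> \<tau> - q" using q by simp
      fix r assume r: "r \<in> {0..\<tau> - q}"
      have p: "\<tau> + q - r > 0" using r q by auto
      have "((\<lambda>r. (\<tau> + q - r) powr (- \<kappa>)) has_real_derivative ((- \<kappa>) * (\<tau> + q - r) powr (- \<kappa> - 1)) * (- 1)) (at r)"
        by (rule DERIV_chain2[where f = "\<lambda>z. z powr (- \<kappa>)" and g = "\<lambda>r. \<tau> + q - r", OF has_real_derivative_powr[OF p]])
           (auto intro!: derivative_eq_intros)
      then have "((\<lambda>r. A * ((\<tau> + q - r) powr (- \<kappa>) / \<kappa>)) has_real_derivative
          A * (((- \<kappa>) * (\<tau> + q - r) powr (- \<kappa> - 1)) * (- 1) / \<kappa>)) (at r)"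
        by (intro DERIV_cmult DERIV_cdivide)
      then have "((\<lambda>r. A * ((\<tau> + q - r) powr (- \<kappa>) / \<kappa>)) has_real_derivative A * (\<tau> + q - r) powr (- \<kappa> - 1)) (at r)"
        using \<kappa> by simp
      then show "((\<lambda>r. A * ((\<tau> + q - r) powr (- \<kappa>) / \<kappa>)) has_vector_derivative A * (\<tau> + q - r) powr (- \<kappa> - 1)) (at r within {0..\<tau> - q})"
        by (auto simp: has_real_derivative_iff_has_vector_derivative intro: has_vector_derivative_at_within)
    qed
    have "norm (integral {0..\<tau> - q} (\<lambda>r. riem_t g \<tau> q r *\<^sub>R G r)) \<le> integral {0..\<tau> - q} (\<lambda>r. A * (\<tau> + q - r) powr (- \<kappa> - 1))"
    proof (rule integral_norm_bound_integral)
      show "(\<lambda>r. riem_t g \<tau> q r *\<^sub>R G r) integrable_on {0..\<tau> - q}"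
        by (intro integrable_continuous_real continuous_on_scaleR G riem_dom_compose[OF riem_continuous(2)[OF g]] continuous_intros)
           (use q in auto)
      show "(\<lambda>r. A * (\<tau> + q - r) powr (- \<kappa> - 1)) integrable_on {0..\<tau> - q}" using I by blast
    qed (rule pt)
    also have "\<dots> = A * ((2 * q) powr (- \<kappa>) / \<kappa>) - A * ((\<tau> + q) powr (- \<kappa>) / \<kappa>)"
      using integral_unique[OF I] by simp
    also have "\<dots> \<le> A * ((2 * q) powr (- \<kappa>) / \<kappa>)" using A \<kappa> by simp
    also have "\<dots> = E * 4 powr (\<kappa> - g) * 2 powr (- \<kappa>) / \<kappa> * M * (\<tau> powr (- 2 * g) * (\<tau> / q) powr \<kappa>)"
    proof -
      have "(4 * \<tau>\<^sup>2) powr (\<kappa> - g) = 4 powr (\<kappa> - g) * \<tau> powr (2 * (\<kappa> - g))"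
      proof -
        have "\<tau>\<^sup>2 = \<tau> powr 2" using \<tau> by simp
        then have "(\<tau>\<^sup>2) powr (\<kappa> - g) = \<tau> powr (2 * (\<kappa> - g))" by (simp only: powr_powr)
        then show ?thesis using \<tau> by (simp add: powr_mult)
      qed
      then have 1: "\<tau> * ((4 * \<tau>\<^sup>2) powr (\<kappa> - g) * \<tau> powr (- \<kappa> - 1)) = 4 powr (\<kappa> - g) * (\<tau> powr 1 * \<tau> powr (2 * (\<kappa> - g)) * \<tau> powr (- \<kappa> - 1))"
        using \<tau> by simp
      have 2: "\<tau> powr 1 * \<tau> powr (2 * (\<kappa> - g)) * \<tau> powr (- \<kappa> - 1) = \<tau> powr (- 2 * g) * \<tau> powr \<kappa>"
        unfolding powr_add[symmetric] by simp
      have 3: "(2 * q) powr (- \<kappa>) = 2 powr (- \<kappa>) * q powr (- \<kappa>)" using q by (simp add: powr_mult)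
      have 4: "(\<tau> / q) powr \<kappa> = \<tau> powr \<kappa> * q powr (- \<kappa>)" using q \<tau> by (simp add: powr_divide powr_minus_divide)
      have "A * ((2 * q) powr (- \<kappa>) / \<kappa>) = E * (\<tau> * ((4 * \<tau>\<^sup>2) powr (\<kappa> - g) * \<tau> powr (- \<kappa> - 1))) * M * ((2 * q) powr (- \<kappa>) / \<kappa>)"
        by (simp add: A_def)
      then show ?thesis unfolding 1 2 3 4 by (simp add: mult_ac)
    qed
    finally have b1: "norm (integral {0..\<tau> - q} (\<lambda>r. riem_t g \<tau> q r *\<^sub>R G r))
      \<le> E * 4 powr (\<kappa> - g) * 2 powr (- \<kappa>) / \<kappa> * M * (\<tau> powr (- 2 * g) * (\<tau> / q) powr \<kappa>)" .
    have b2: "norm ((4 * \<tau> * q) powr (- g) *\<^sub>R G (\<tau> - q)) \<le> 4 powr (- g) * M * (\<tau> powr (- 2 * g) * (\<tau> / q) powr \<kappa>)"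
    proof -
      have "(4 * \<tau> * q) powr (- g) = 4 powr (- g) * (\<tau> powr (- g) * q powr (- g))" using \<tau> q by (simp add: powr_mult)
      also have "\<tau> powr (- g) * q powr (- g) = \<tau> powr (- 2 * g) * (\<tau> / q) powr g"
      proof -
        have "\<tau> powr (- 2 * g) * (\<tau> / q) powr g = (\<tau> powr (- 2 * g) * \<tau> powr g) * q powr (- g)"
          using \<tau> q by (simp add: powr_divide powr_minus_divide)
        also have "\<tau> powr (- 2 * g) * \<tau> powr g = \<tau> powr (- g)" unfolding powr_add[symmetric] by simp
        finally show ?thesis by simp
      qed
      also have "\<dots> \<le> \<tau> powr (- 2 * g) * (\<tau> / q) powr \<kappa>"
        using \<tau> q \<kappa> by (intro mult_left_mono powr_mono) auto
      finally have "(4 * \<tau> * q) powr (- g) \<le> 4 powr (- g) * (\<tau> powr (- 2 * g) * (\<tau> / q) powr \<kappa>)" by simp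
      then have "(4 * \<tau> * q) powr (- g) * norm (G (\<tau> - q)) \<le> 4 powr (- g) * (\<tau> powr (- 2 * g) * (\<tau> / q) powr \<kappa>) * M"
        using G(2)[of "\<tau> - q"] q by (intro mult_mono) auto
      then show ?thesis by (simp add: mult.commute mult.left_commute)
    qed
    have "norm (epd_t g q G \<tau>) \<le> 4 powr (- g) * M * (\<tau> powr (- 2 * g) * (\<tau> / q) powr \<kappa>)
        + E * 4 powr (\<kappa> - g) * 2 powr (- \<kappa>) / \<kappa> * M * (\<tau> powr (- 2 * g) * (\<tau> / q) powr \<kappa>)"
      unfolding epd_t_def by (rule norm_triangle_mono[OF b2 b1])
    also have "\<dots> = C * M * \<tau> powr (- 2 * g) * (\<tau> / q) powr \<kappa>"
      by (simp add: C_def algebra_simps)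
    finally show "norm (epd_t g q G \<tau>) \<le> C * M * \<tau> powr (- 2 * g) * (\<tau> / q) powr \<kappa>" .
  qed
qed

lemma has_bochner_integral_powr_ratio:
  fixes a t :: real
  assumes a: "a < 1" and t: "t \<ge> 0"
  shows "has_bochner_integral lborel (\<lambda>b. indicator {0<..t} b * (t / b) powr a) (t / (1 - a))"
proof -
  have pos: "0 \<le> t / (1 - a)" using a t by (intro divide_nonneg_pos) auto
  have hi: "((\<lambda>b. (t / b) powr a) has_integral t / (1 - a)) {0..t}"
  proof (cases "t = 0")
    case False
    then have t: "t > 0" using t by simp
    have 1: "((\<lambda>b. t powr a * b powr (- a)) has_integral t powr a * (t powr (- a + 1) / (- a + 1))) {0..t}"
      using has_integral_powr_from_0[of "- a" t] a t by (intro has_integral_mult_right) auto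
    have 2: "t powr a * (t powr (- a + 1) / (- a + 1)) = t / (1 - a)"
    proof -
      have "t powr a * t powr (- a + 1) = t" unfolding powr_add[symmetric] using t by simp
      then show ?thesis by (simp add: mult.commute[of _ "t powr (- a + 1)"])
    qed
    have 3: "t powr a * b powr (- a) = (t / b) powr a" if "b \<in> {0..t}" for b
      using that t by (cases "b = 0") (auto simp: powr_divide powr_minus_divide)
    show ?thesis by (rule has_integral_eq[OF 3 1[unfolded 2]])
  qed simp
  have nn: "integral\<^sup>N lborel (\<lambda>b. indicator {0..t} b * (t / b) powr a) = ennreal (t / (1 - a))"
    by (rule nn_integral_has_integral_lebesgue[OF _ hi]) simp
  have "has_bochner_integral lborel (\<lambda>b. indicator {0..t} b * (t / b) powr a) (t / (1 - a))"
    by (rule has_bochner_integral_nn_integral) (use pos nn in auto)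
  moreover have "indicator {0..t} b * (t / b) powr a = indicator {0<..t} b * (t / b) powr a" for b
    by (cases "b = 0") (auto simp: indicator_def)
  ultimately show ?thesis by simp
qed

lemma set_integral_scale_unit:
  fixes h :: "real \<Rightarrow> complex"
  assumes t: "t > 0"
  shows "(LINT b:{0<..t}|lborel. h b) = (LINT \<beta>:{0<..1}|lborel. t *\<^sub>R h (t * \<beta>))"
proof -
  have "(LINT b:{0<..t}|lborel. h b) = \<bar>t\<bar> *\<^sub>R (LINT \<beta>|lborel. indicator {0<..t} (0 + t * \<beta>) *\<^sub>R h (0 + t * \<beta>))"
    unfolding set_lebesgue_integral_def using t by (intro lborel_integral_real_affine) auto
  also have "(\<lambda>\<beta>. indicator {0<..t} (0 + t * \<beta>) *\<^sub>R h (0 + t * \<beta>)) = (\<lambda>\<beta>. indicator {0<..1} \<beta> *\<^sub>R h (t * \<beta>))"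
    using t by (auto simp: fun_eq_iff indicator_def zero_less_mult_iff)
  finally show ?thesis using t by (simp add: set_lebesgue_integral_def[symmetric])
qed

context
  fixes h :: "'a::metric_space \<Rightarrow> real \<Rightarrow> real \<Rightarrow> complex" and S :: "('a \<times> real) set" and a B :: real
  assumes h: "continuous_on {(x, t, b). (x, t) \<in> S \<and> 0 < b \<and> b \<le> t} (\<lambda>(x, t, b). h x t b)"
    and bnd: "\<And>x t b. (x, t) \<in> S \<Longrightarrow> 0 < b \<Longrightarrow> b \<le> t \<Longrightarrow> norm (h x t b) \<le> B * (t / b) powr a"
    and a: "a < 1" and S: "\<And>x t. (x, t) \<in> S \<Longrightarrow> 0 \<le> t"
begin

lemma param_measurable:
  assumes "(x, t) \<in> S"
  shows "(\<lambda>b. indicator {0<..t} b *\<^sub>R h x t b) \<in> borel_measurable borel"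
proof (rule borel_measurable_continuous_on_indicator)
  have "continuous_on {0<..t} (\<lambda>b. (\<lambda>(x, t, b). h x t b) (x, t, b))"
    by (rule continuous_on_compose2[OF h]) (use assms in \<open>auto intro!: continuous_intros\<close>)
  then show "continuous_on {0<..t} (h x t)" by simp
qed auto

lemma param_integrable:
  assumes "(x, t) \<in> S"
  shows "set_integrable lborel {0<..t} (h x t)"
    and "norm (LINT b:{0<..t}|lborel. h x t b) \<le> B * t / (1 - a)"
proof -
  let ?w = "\<lambda>b. B * (indicator {0<..t} b * (t / b) powr a)"
  have w: "has_bochner_integral lborel ?w (B * (t / (1 - a)))"
    by (intro has_bochner_integral_mult_right has_bochner_integral_powr_ratio a S[OF assms])
  have le: "norm (indicator {0<..t} b *\<^sub>R h x t b) \<le> ?w b" for b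
    using bnd[OF assms, of b] by (auto simp: indicator_def)
  show i: "set_integrable lborel {0<..t} (h x t)" unfolding set_integrable_def
  proof (rule Bochner_Integration.integrable_bound[OF integrable.intros[OF w]])
    show "AE b in lborel. norm (indicator {0<..t} b *\<^sub>R h x t b) \<le> norm (?w b)"
      unfolding real_norm_def by (intro AE_I2 order_trans[OF le abs_ge_self])
  qed (use param_measurable[OF assms] in simp)
  have "norm (LINT b:{0<..t}|lborel. h x t b) \<le> (LINT b|lborel. ?w b)"
    unfolding set_lebesgue_integral_def
    by (rule Bochner_Integration.integral_norm_bound_integral[OF i[unfolded set_integrable_def] integrable.intros[OF w] le])
  then show "norm (LINT b:{0<..t}|lborel. h x t b) \<le> B * t / (1 - a)"
    using has_bochner_integral_integral_eq[OF w] by simp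
qed

text \<open>
  The substitution \<open>b = t \<beta>\<close> fixes the domain of integration and turns the bound into
  \<open>t B (1/\<beta>)\<^sup>a\<close>, integrable in \<open>\<beta>\<close>; it also handles \<open>t = 0\<close>.
\<close>

lemma param_continuous: "continuous_on S (\<lambda>(x, t). LINT b:{0<..t}|lborel. h x t b)"
  unfolding continuous_on_sequentially
proof (intro allI ballI impI)
  fix z :: "nat \<Rightarrow> 'a \<times> real" and z0
  assume z0: "z0 \<in> S" and z: "(\<forall>n. z n \<in> S) \<and> z \<longlonglongrightarrow> z0"
  obtain x0 t0 where z0e: "z0 = (x0, t0)" by (cases z0)
  define X where "X n = fst (z n)" for n
  define T where "T n = snd (z n)" for n
  have ze: "z n = (X n, T n)" for n by (simp add: X_def T_def)
  have XT: "(X n, T n) \<in> S" for n using z by (simp add: ze[symmetric])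
  have Xl: "X \<longlonglongrightarrow> x0" and Tl: "T \<longlonglongrightarrow> t0"
    using tendsto_fst[of z z0] tendsto_snd[of z z0] z by (auto simp: X_def[abs_def] T_def[abs_def] z0e)
  have T0: "0 \<le> T n" for n by (rule S[OF XT])
  have t0: "0 \<le> t0" using S z0 z0e by blast
  obtain K where K: "\<And>n. T n \<le> K" "K \<ge> 0"
  proof -
    have "Bseq T" using Tl by (intro convergent_imp_Bseq convergentI)
    then obtain K where "K > 0" "\<And>n. norm (T n) \<le> K" by (auto simp: Bseq_def)
    then show thesis by (intro that[of K]) (auto simp: abs_le_iff less_imp_le)
  qed
  have sc: "(LINT b:{0<..t}|lborel. h x t b) = (LINT \<beta>|lborel. indicator {0<..1} \<beta> *\<^sub>R (t *\<^sub>R h x t (t * \<beta>)))"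
    if "0 \<le> t" for x t
  proof (cases "t = 0")
    case False
    then show ?thesis using set_integral_scale_unit[of t "h x t", unfolded set_lebesgue_integral_def] that
      unfolding set_lebesgue_integral_def by simp
  qed (simp add: set_lebesgue_integral_def)
  have dom: "norm (t *\<^sub>R h x t (t * \<beta>)) \<le> t * (B * (1 / \<beta>) powr a)" if "(x, t) \<in> S" "\<beta> \<in> {0<..1}" for x t \<beta>
  proof (cases "t = 0")
    case False
    then have t: "t > 0" using S[OF that(1)] by simp
    have "norm (h x t (t * \<beta>)) \<le> B * (t / (t * \<beta>)) powr a"
      by (rule bnd[OF that(1)]) (use t that in \<open>auto simp: mult_le_cancel_left1\<close>)
    then show ?thesis using t by (simp add: mult_left_mono)
  qed simp
  let ?J = "\<lambda>n \<beta>. indicator {0<..1} \<beta> *\<^sub>R (T n *\<^sub>R h (X n) (T n) (T n * \<beta>))"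
  let ?w = "\<lambda>\<beta>. \<bar>K * B\<bar> * (indicator {0<..1} \<beta> * (1 / \<beta>) powr a)"
  have meas: "(\<lambda>\<beta>. indicator {0<..1} \<beta> *\<^sub>R (t *\<^sub>R h x t (t * \<beta>))) \<in> borel_measurable borel" if "(x, t) \<in> S" for x t
  proof (rule borel_measurable_continuous_on_indicator)
    show "continuous_on {0<..1} (\<lambda>\<beta>. t *\<^sub>R h x t (t * \<beta>))"
    proof (cases "t = 0")
      case False
      then have t: "t > 0" using S[OF that] by simp
      have "continuous_on {0<..1} (\<lambda>\<beta>. (\<lambda>(x, t, b). h x t b) (x, t, t * \<beta>))"
        by (rule continuous_on_compose2[OF h]) (use that t in \<open>auto intro!: continuous_intros simp: mult_le_cancel_left1\<close>)
      then show ?thesis by (auto intro!: continuous_intros)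
    qed simp
  qed auto
  have "(\<lambda>n. LINT \<beta>|lborel. ?J n \<beta>) \<longlonglongrightarrow> (LINT \<beta>|lborel. indicator {0<..1} \<beta> *\<^sub>R (t0 *\<^sub>R h x0 t0 (t0 * \<beta>)))"
  proof (rule integral_dominated_convergence[where w = ?w])
    show "(\<lambda>\<beta>. indicator {0<..1} \<beta> *\<^sub>R (t0 *\<^sub>R h x0 t0 (t0 * \<beta>))) \<in> borel_measurable lborel"
      using meas z0 z0e by simp
    show "?J n \<in> borel_measurable lborel" for n using meas[OF XT] by simp
    show "integrable lborel ?w"
      using integrable.intros[OF has_bochner_integral_powr_ratio[OF a, of 1]] by (intro integrable_mult_right) auto
    show "AE \<beta> in lborel. norm (?J n \<beta>) \<le> ?w \<beta>" for n
    proof (rule AE_I2)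
      fix \<beta> :: real
      show "norm (?J n \<beta>) \<le> ?w \<beta>"
      proof (cases "\<beta> \<in> {0<..1}")
        case True
        have "norm (?J n \<beta>) \<le> T n * (B * (1 / \<beta>) powr a)" using dom[OF XT True] True by simp
        also have "\<dots> \<le> \<bar>T n * B\<bar> * (1 / \<beta>) powr a" by (simp add: mult.assoc[symmetric] mult_right_mono)
        also have "\<dots> \<le> \<bar>K * B\<bar> * (1 / \<beta>) powr a"
          unfolding abs_mult using K T0[of n] by (intro mult_right_mono) auto
        finally show ?thesis using True by simp
      qed simp
    qed
    show "AE \<beta> in lborel. (\<lambda>n. ?J n \<beta>) \<longlonglongrightarrow> indicator {0<..1} \<beta> *\<^sub>R (t0 *\<^sub>R h x0 t0 (t0 * \<beta>))"
    proof (rule AE_I2)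
      fix \<beta> :: real
      show "(\<lambda>n. ?J n \<beta>) \<longlonglongrightarrow> indicator {0<..1} \<beta> *\<^sub>R (t0 *\<^sub>R h x0 t0 (t0 * \<beta>))"
      proof (cases "\<beta> \<in> {0<..1}")
        case True
        have "(\<lambda>n. T n *\<^sub>R h (X n) (T n) (T n * \<beta>)) \<longlonglongrightarrow> t0 *\<^sub>R h x0 t0 (t0 * \<beta>)"
        proof (cases "t0 = 0")
          case True
          have "(\<lambda>n. T n * (B * (1 / \<beta>) powr a)) \<longlonglongrightarrow> t0 * (B * (1 / \<beta>) powr a)" by (intro tendsto_intros Tl)
          then have "(\<lambda>n. T n * (B * (1 / \<beta>) powr a)) \<longlonglongrightarrow> 0" using True by simp
          moreover have "eventually (\<lambda>n. norm (T n *\<^sub>R h (X n) (T n) (T n * \<beta>)) \<le> T n * (B * (1 / \<beta>) powr a)) sequentially"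
            by (intro always_eventually allI dom[OF XT \<open>\<beta> \<in> {0<..1}\<close>])
          ultimately have "(\<lambda>n. T n *\<^sub>R h (X n) (T n) (T n * \<beta>)) \<longlonglongrightarrow> 0"
            by (rule Lim_null_comparison[rotated])
          then show ?thesis using True by simp
        next
          case False
          then have t0p: "t0 > 0" using t0 by simp
          let ?D = "{(x, t, b). (x, t) \<in> S \<and> 0 < b \<and> b \<le> t}"
          have lim: "(\<lambda>n. (X n, T n, T n * \<beta>)) \<longlonglongrightarrow> (x0, t0, t0 * \<beta>)" by (intro tendsto_intros Xl Tl)
          have p0: "(x0, t0, t0 * \<beta>) \<in> ?D" using z0 z0e t0p True by (auto simp: mult_le_cancel_left1)
          have "eventually (\<lambda>n. 0 < T n) sequentially" using order_tendstoD(1)[OF Tl t0p] .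
          then have "eventually (\<lambda>n. (X n, T n, T n * \<beta>) \<in> ?D) sequentially"
            by eventually_elim (use XT True in \<open>auto simp: mult_le_cancel_left1\<close>)
          from continuous_on_tendsto_compose[OF h lim p0 this]
          have "(\<lambda>n. h (X n) (T n) (T n * \<beta>)) \<longlonglongrightarrow> h x0 t0 (t0 * \<beta>)" by simp
          then show ?thesis by (intro tendsto_intros Tl)
        qed
        then show ?thesis using True by simp
      qed simp
    qed
  qed
  then have "(\<lambda>n. LINT b:{0<..T n}|lborel. h (X n) (T n) b) \<longlonglongrightarrow> (LINT b:{0<..t0}|lborel. h x0 t0 b)"
    using sc T0 t0 by simp
  then show "((\<lambda>(x, t). LINT b:{0<..t}|lborel. h x t b) \<circ> z) \<longlonglongrightarrow> (case z0 of (x, t) \<Rightarrow> LINT b:{0<..t}|lborel. h x t b)"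
    by (simp add: o_def ze z0e)
qed

end

text \<open>
  At \<open>b = 0\<close> the kernel has an accidental value, which is removed from all integrals.
\<close>

lemma set_integral_add_point:
  fixes h :: "real \<Rightarrow> complex"
  assumes t: "0 \<le> t"
  shows "set_integrable lborel {0..t} h \<longleftrightarrow> set_integrable lborel {0<..t} h"
    and "(LINT b:{0..t}|lborel. h b) = (LINT b:{0<..t}|lborel. h b)"
proof -
  have e: "indicator {0..t} b *\<^sub>R h b = indicator {0<..t} b *\<^sub>R h b + indicator {0} b *\<^sub>R h 0" for b
    using t by (auto simp: indicator_def)
  have e': "indicator {0<..t} b *\<^sub>R h b = indicator {0..t} b *\<^sub>R h b - indicator {0} b *\<^sub>R h 0" for b
    using t by (auto simp: indicator_def)
  have p: "has_bochner_integral lborel (\<lambda>b::real. indicator {0} b *\<^sub>R h 0) 0"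
    using has_bochner_integral_indicator[of "{0::real}" lborel "h 0"] by simp
  note pi = integrable.intros[OF p]
  show i: "set_integrable lborel {0..t} h \<longleftrightarrow> set_integrable lborel {0<..t} h"
    unfolding set_integrable_def using pi
    by (metis (no_types, lifting) e e' Bochner_Integration.integrable_add Bochner_Integration.integrable_cong Bochner_Integration.integrable_diff)
  show "(LINT b:{0..t}|lborel. h b) = (LINT b:{0<..t}|lborel. h b)"
  proof (cases "set_integrable lborel {0<..t} h")
    case True
    then show ?thesis
      unfolding set_lebesgue_integral_def e
      using pi has_bochner_integral_integral_eq[OF p] by (subst Bochner_Integration.integral_add) (auto simp: set_integrable_def)
  next
    case False
    then show ?thesis using i
      by (simp add: set_lebesgue_integral_def set_integrable_def not_integrable_integral_eq)
  qed
qed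

section \<open>Continuity of the transform and of the right-hand side\<close>

lemma integral_scale_unit:
  fixes f :: "real \<Rightarrow> complex"
  assumes R: "0 \<le> R" and f: "continuous_on {0..R} f"
  shows "integral {0..R} f = integral {0..1} (\<lambda>s. R *\<^sub>R f (R * s))"
proof (cases "R = 0")
  case False
  then have R: "R > 0" using R by simp
  have "(f has_integral integral {0..R} f) (cbox 0 R)"
    using integrable_integral[OF integrable_continuous_real[OF f]] by simp
  from has_integral_affinity[OF this, of R 0]
  have "((\<lambda>x. f (R * x)) has_integral (1 / R) *\<^sub>R integral {0..R} f) ((\<lambda>x. (1 / R) *\<^sub>R x) ` {0..R})"
    using R by simp
  moreover have "(\<lambda>x. (1 / R) *\<^sub>R x) ` {0..R} = {0..1}"
  proof
    show "{0..1} \<subseteq> (\<lambda>x. (1 / R) *\<^sub>R x) ` {0..R}"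
    proof
      fix s :: real assume "s \<in> {0..1}"
      then show "s \<in> (\<lambda>x. (1 / R) *\<^sub>R x) ` {0..R}"
        using R by (intro image_eqI[of _ _ "R * s"]) (auto simp: mult_left_le)
    qed
  qed (use R in auto)
  ultimately have "((\<lambda>x. f (R * x)) has_integral (1 / R) *\<^sub>R integral {0..R} f) {0..1}" by simp
  then have "integral {0..1} (\<lambda>s. R *\<^sub>R f (R * s)) = R *\<^sub>R ((1 / R) *\<^sub>R integral {0..R} f)"
    by (intro integral_unique has_integral_cmul)
  also have "\<dots> = integral {0..R} f" using R by simp
  finally show ?thesis by (rule sym)
qed simp

context wave_setting begin

abbreviation "\<phi> \<equiv> phi l"

text \<open>
  The triples \<open>(x, t, b)\<close> at which the inner integral is evaluated; \<open>b = 0\<close> is left out because the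
  kernel is singular there.
\<close>

definition R3 :: "((real^'n) \<times> real \<times> real) set" where
  "R3 = {(x, t, b). (x, t) \<in> \<Omega> \<and> 0 < b \<and> b \<le> t}"

lemma phi_R3:
  assumes "0 < b" "b \<le> t"
  shows "0 < \<phi> b" "\<phi> b \<le> \<phi> t" "0 < \<phi> t"
  using assms phi_pos[OF l] phi_mono[OF l] by auto

lemma Q_R3: "(x, t) \<in> \<Omega> \<Longrightarrow> 0 < b \<Longrightarrow> b \<le> t \<Longrightarrow> 0 \<le> r \<Longrightarrow> r \<le> \<phi> t \<Longrightarrow> (x, r, b) \<in> Q"
  by (rule Q_I) auto

lemma slice_continuous:
  assumes H: "continuous_on Q (\<lambda>(x, r, b). H x r b)" and "(x, t) \<in> \<Omega>" "0 < b" "b \<le> t"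
  shows "continuous_on {0..\<phi> t} (\<lambda>r. H x r b)"
proof -
  have "continuous_on {0..\<phi> t} (\<lambda>r. (\<lambda>(x, r, b). H x r b) (x, r, b))"
    by (rule continuous_on_compose2[OF H]) (use assms in \<open>auto intro!: continuous_intros Q_R3\<close>)
  then show ?thesis by simp
qed

lemma slice_kernel_continuous:
  assumes k: "continuous_on riem_dom (\<lambda>(\<tau>, q, r). k \<tau> q r)"
    and H: "continuous_on Q (\<lambda>(x, r, b). H x r b)" and "(x, t) \<in> \<Omega>" "0 < b" "b \<le> t"
  shows "continuous_on {0..\<phi> t - \<phi> b} (\<lambda>r. k (\<phi> t) (\<phi> b) r *\<^sub>R (H x r b :: complex))"
  by (intro continuous_on_scaleR continuous_on_subset[OF slice_continuous[OF H assms(3-)]] riem_dom_compose[OF k] continuous_intros)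
     (use phi_R3[OF assms(4,5)] in auto)

text \<open>
  The substitution \<open>r = (\<phi>(t) - \<phi>(b)) s\<close> gives a fixed interval of integration with a continuous
  integrand.
\<close>

lemma kint_continuous:
  assumes k: "continuous_on riem_dom (\<lambda>(\<tau>, q, r). k \<tau> q r)"
    and H: "continuous_on Q (\<lambda>(x, r, b). H x r b)"
  shows "continuous_on R3 (\<lambda>(x, t, b). integral {0..\<phi> t - \<phi> b} (\<lambda>r. k (\<phi> t) (\<phi> b) r *\<^sub>R (H x r b :: complex)))"
proof -
  let ?I = "\<lambda>(x, t, b) s. (\<phi> t - \<phi> b) *\<^sub>R (k (\<phi> t) (\<phi> b) ((\<phi> t - \<phi> b) * s) *\<^sub>R H x ((\<phi> t - \<phi> b) * s) b)"
  let ?x = "\<lambda>z :: ((real^'n) \<times> real \<times> real) \<times> real. fst (fst z)"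
  let ?t = "\<lambda>z :: ((real^'n) \<times> real \<times> real) \<times> real. fst (snd (fst z))"
  let ?b = "\<lambda>z :: ((real^'n) \<times> real \<times> real) \<times> real. snd (snd (fst z))"
  let ?S = "R3 \<times> cbox 0 (1::real)"
  have m: "(?x z, ?t z) \<in> \<Omega> \<and> 0 < ?b z \<and> ?b z \<le> ?t z \<and> 0 \<le> snd z \<and> snd z \<le> 1" if "z \<in> ?S" for z
    using that by (auto simp: R3_def)
  have ct: "continuous_on ?S (\<lambda>z. \<phi> (?t z))" "continuous_on ?S (\<lambda>z. \<phi> (?b z))"
  proof -
    have m2: "?t z \<in> {0..}" "?b z \<in> {0..}" if "z \<in> ?S" for z
      using m[OF that] unfolding atLeast_iff by linarith+
    show "continuous_on ?S (\<lambda>z. \<phi> (?t z))"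
      by (rule continuous_on_compose2[OF phi_continuous[OF l] _ image_subsetI[OF m2(1)]]) (intro continuous_intros)
    show "continuous_on ?S (\<lambda>z. \<phi> (?b z))"
      by (rule continuous_on_compose2[OF phi_continuous[OF l] _ image_subsetI[OF m2(2)]]) (intro continuous_intros)
  qed
  let ?r = "\<lambda>z. (\<phi> (?t z) - \<phi> (?b z)) * snd z"
  have cr: "continuous_on ?S ?r" by (intro continuous_intros ct)
  have rr: "0 \<le> ?r z" "?r z \<le> \<phi> (?t z) - \<phi> (?b z)" "0 < \<phi> (?b z)" if "z \<in> ?S" for z
    using m[OF that] phi_R3[of "?b z" "?t z"] by (auto simp: mult_left_le)
  have "continuous_on ?S (\<lambda>z. (\<lambda>(x, r, b). H x r b) (?x z, ?r z, ?b z))"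
  proof (rule continuous_on_compose2[OF H])
    show "continuous_on ?S (\<lambda>z. (?x z, ?r z, ?b z))" by (intro continuous_intros cr)
    show "(\<lambda>z. (?x z, ?r z, ?b z)) ` ?S \<subseteq> Q"
    proof safe
      fix x t b s assume "(x, t, b) \<in> R3" "s \<in> cbox 0 (1::real)"
      then have z: "((x, t, b), s) \<in> ?S" by blast
      show "(?x ((x, t, b), s), ?r ((x, t, b), s), ?b ((x, t, b), s)) \<in> Q"
        by (rule Q_R3[of _ "?t ((x, t, b), s)"]) (use m[OF z] rr[OF z] in auto)
    qed
  qed
  then have cH: "continuous_on ?S (\<lambda>z. H (?x z) (?r z) (?b z))" by simp
  have ck: "continuous_on ?S (\<lambda>z. k (\<phi> (?t z)) (\<phi> (?b z)) (?r z))"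
  proof (rule riem_dom_compose[OF k ct cr])
    fix z assume z: "z \<in> ?S"
    show "0 < \<phi> (?t z) \<and> 0 < \<phi> (?b z) \<and> 0 \<le> ?r z \<and> ?r z \<le> \<phi> (?t z)"
      using m[OF z] rr[OF z] phi_R3(3)[of "?b z" "?t z"] by linarith
  qed
  have "continuous_on ?S (\<lambda>(p, s). ?I p s)"
    using continuous_on_scaleR[OF continuous_on_diff[OF ct] continuous_on_scaleR[OF ck cH]]
    by (simp add: case_prod_unfold)
  then have "continuous_on R3 (\<lambda>p. integral (cbox 0 1) (?I p))"
    by (rule integral_continuous_on_param)
  moreover have "(case p of (x, t, b) \<Rightarrow> integral {0..\<phi> t - \<phi> b} (\<lambda>r. k (\<phi> t) (\<phi> b) r *\<^sub>R H x r b)) = integral (cbox 0 1) (?I p)"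
    if "p \<in> R3" for p
  proof -
    obtain x t b where p: "p = (x, t, b)" by (cases p)
    have R: "(x, t) \<in> \<Omega>" "0 < b" "b \<le> t" using that by (auto simp: p R3_def)
    show ?thesis
      using integral_scale_unit[OF _ slice_kernel_continuous[OF k H R]] phi_R3[OF R(2,3)] by (simp add: p)
  qed
  ultimately show ?thesis by (simp cong: continuous_on_cong)
qed

text \<open>
  A time \<open>t1\<close> slightly later than \<open>t0\<close> still belongs to the domain, so compactness bounds \<open>H\<close> for all
  \<open>r \<le> \<phi>(t1)\<close> and \<open>b \<le> t1\<close>, uniformly down to \<open>t = 0\<close>.
\<close>

lemma local_bound:
  assumes H: "continuous_on Q (\<lambda>(x, r, b). H x r b :: complex)" and p: "(x0, t0) \<in> \<Omega>"
  obtains d t1 M where "0 < d" "t0 < t1" "0 \<le> M" "(x0, t1) \<in> \<Omega>"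
    "\<And>x r b. dist x x0 \<le> d \<Longrightarrow> 0 \<le> r \<Longrightarrow> r \<le> \<phi> t1 \<Longrightarrow> 0 \<le> b \<Longrightarrow> b \<le> t1 \<Longrightarrow> norm (H x r b) \<le> M"
proof -
  obtain t1 where t1: "t0 < t1" "(x0, t1) \<in> \<Omega>" using \<Omega>_later[OF p] by blast
  have t1p: "t1 > 0" using t1 \<Omega>_nonneg[OF p] by simp
  obtain d where d: "d > 0" "\<And>y s. dist y x0 < d \<Longrightarrow> \<bar>s - t1\<bar> < d \<Longrightarrow> 0 \<le> s \<Longrightarrow> (y, s) \<in> \<Omega>"
    using \<Omega>_nhd[OF t1(2)] by blast
  let ?K = "cball x0 (d / 2) \<times> {0..\<phi> t1} \<times> {0..t1}"
  have sub: "?K \<subseteq> Q"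
  proof clarify
    fix x r b assume x: "x \<in> cball x0 (d / 2)" and rb: "r \<in> {0..\<phi> t1}" "b \<in> {0..t1}"
    have "dist x x0 < d" using x d by (simp add: dist_commute)
    then have "(x, t1) \<in> \<Omega>" using d(2)[of x t1] d(1) t1p by simp
    then show "(x, r, b) \<in> Q" using rb t1p by (intro Q_I[of x t1]) auto
  qed
  have "compact ?K" by (intro compact_Times compact_cball compact_Icc)
  then have "bounded ((\<lambda>(x, r, b). H x r b) ` ?K)"
    by (rule compact_imp_bounded[OF compact_continuous_image[OF continuous_on_subset[OF H sub]]])
  then obtain M where M: "M > 0" "\<And>z. z \<in> (\<lambda>(x, r, b). H x r b) ` ?K \<Longrightarrow> norm z \<le> M"
    unfolding bounded_pos by blast
  show thesis
  proof (rule that[of "d / 2" t1 M])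
    show "norm (H x r b) \<le> M" if "dist x x0 \<le> d / 2" "0 \<le> r" "r \<le> \<phi> t1" "0 \<le> b" "b \<le> t1" for x r b
    proof (rule M(2))
      have "(x, r, b) \<in> ?K" using that by (auto simp: dist_commute)
      then show "H x r b \<in> (\<lambda>(x, r, b). H x r b) ` ?K" by (rule image_eqI[rotated]) simp
    qed
  qed (use d M t1 in auto)
qed

text \<open>
  The inner integral of the transform.
\<close>

definition v :: "real^'n \<Rightarrow> real \<Rightarrow> real \<Rightarrow> complex" where
  "v x t b = epd g (\<phi> b) (\<lambda>r. w x r b) (\<phi> t)"

lemma v_continuous: "continuous_on R3 (\<lambda>(x, t, b). v x t b)"
  unfolding v_def epd_def by (rule kint_continuous[OF riem_continuous(1)[OF g] w_continuous])

lemma inner_transform_eq: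
  assumes "(x, t) \<in> \<Omega>" "0 < b" "b \<le> t"
  shows "set_integrable lborel {0..\<bar>\<phi> t - \<phi> b\<bar>} (\<lambda>r. kernel l t b r *\<^sub>R w x r b)"
    and "inner_transform l w x t b = v x t b"
proof -
  have e: "\<bar>\<phi> t - \<phi> b\<bar> = \<phi> t - \<phi> b" using phi_R3[OF assms(2,3)] by simp
  show i: "set_integrable lborel {0..\<bar>\<phi> t - \<phi> b\<bar>} (\<lambda>r. kernel l t b r *\<^sub>R w x r b)"
    unfolding e kernel_eq
    by (intro borel_integrable_atLeastAtMost' slice_kernel_continuous[OF riem_continuous(1)[OF g] w_continuous assms])
  show "inner_transform l w x t b = v x t b"
    unfolding inner_transform_def v_def epd_def
    using set_borel_integral_eq_integral(2)[OF i] unfolding e kernel_eq .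
qed

lemma v_bound:
  obtains C where "C \<ge> 0" "\<And>x t b M. (x, t) \<in> \<Omega> \<Longrightarrow> 0 < b \<Longrightarrow> b \<le> t \<Longrightarrow>
    (\<And>r. r \<in> {0..\<phi> t} \<Longrightarrow> norm (w x r b) \<le> M) \<Longrightarrow> norm (v x t b) \<le> C * M * t"
proof -
  obtain C where C: "C \<ge> 0" "\<And>q \<tau> M G. 0 < q \<Longrightarrow> q \<le> \<tau> \<Longrightarrow> continuous_on {0..\<tau> - q} G \<Longrightarrow>
     (\<And>r. r \<in> {0..\<tau> - q} \<Longrightarrow> norm (G r) \<le> M) \<Longrightarrow> norm (epd g q G \<tau>) \<le> C * M * \<tau> powr (1 - 2 * g)"
    by (rule riem_integral_bound[OF g]) blast
  show thesis
  proof (rule that)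
    show "0 \<le> C * (2 / (l + 2)) powr (2 / (l + 2))" using C by simp
    fix x t b M assume a: "(x, t) \<in> \<Omega>" "0 < b" "b \<le> t" "\<And>r. r \<in> {0..\<phi> t} \<Longrightarrow> norm (w x r b) \<le> M"
    have t: "t > 0" using a by simp
    have "norm (v x t b) \<le> C * M * \<phi> t powr (1 - 2 * g)"
      unfolding v_def
    proof (rule C(2))
      show "continuous_on {0..\<phi> t - \<phi> b} (\<lambda>r. w x r b)"
        by (rule continuous_on_subset[OF slice_continuous[OF w_continuous a(1-3)]]) (use phi_R3[OF a(2,3)] in auto)
    qed (use phi_R3[OF a(2,3)] a(4) in auto)
    then show "norm (v x t b) \<le> C * (2 / (l + 2)) powr (2 / (l + 2)) * M * t"
      unfolding phi_powr_one[OF l t] by (simp add: mult_ac)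
  qed
qed

text \<open>
  Neighbourhoods of a point \<open>(x0, t0)\<close> that reach down to \<open>t = 0\<close>.
\<close>

definition near :: "real^'n \<Rightarrow> real \<Rightarrow> real \<Rightarrow> ((real^'n) \<times> real) set" where
  "near x0 d t1 = {(x, t). dist x x0 < d \<and> t < t1}"

lemma open_near: "open (near x0 d t1)"
proof -
  have "near x0 d t1 = ball x0 d \<times> {..<t1}" by (auto simp: near_def dist_commute)
  then show ?thesis by (simp add: open_Times)
qed

lemma R3_near: "{(x, t, b). (x, t) \<in> \<Omega> \<inter> N \<and> 0 < b \<and> b \<le> t} \<subseteq> R3"
  by (auto simp: R3_def)

lemma
  assumes "continuous_on R3 (\<lambda>(x, t, b). h x t b :: complex)" and a: "e < (1::real)"
    and "\<And>x t b. (x, t) \<in> \<Omega> \<inter> N \<Longrightarrow> 0 < b \<Longrightarrow> b \<le> t \<Longrightarrow> norm (h x t b) \<le> B * (t / b) powr e"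
  shows local_integrable: "(x, t) \<in> \<Omega> \<inter> N \<Longrightarrow> set_integrable lborel {0<..t} (h x t)"
    and local_integral_bound: "(x, t) \<in> \<Omega> \<inter> N \<Longrightarrow> norm (LINT b:{0<..t}|lborel. h x t b) \<le> B * t / (1 - e)"
    and local_integral_continuous: "continuous_on (\<Omega> \<inter> N) (\<lambda>(x, t). LINT b:{0<..t}|lborel. h x t b)"
proof -
  have c: "continuous_on {(x, t, b). (x, t) \<in> \<Omega> \<inter> N \<and> 0 < b \<and> b \<le> t} (\<lambda>(x, t, b). h x t b)"
    by (rule continuous_on_subset[OF assms(1) R3_near])
  have nn: "0 \<le> t" if "(x, t) \<in> \<Omega> \<inter> N" for x t using that \<Omega>_nonneg by blast
  note p = param_integrable[where S = "\<Omega> \<inter> N" and B = B and a = e and h = h, OF c assms(3) a nn]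
  show "(x, t) \<in> \<Omega> \<inter> N \<Longrightarrow> set_integrable lborel {0<..t} (h x t)" by (rule p(1))
  show "(x, t) \<in> \<Omega> \<inter> N \<Longrightarrow> norm (LINT b:{0<..t}|lborel. h x t b) \<le> B * t / (1 - e)" by (rule p(2))
  show "continuous_on (\<Omega> \<inter> N) (\<lambda>(x, t). LINT b:{0<..t}|lborel. h x t b)"
    by (rule param_continuous[where S = "\<Omega> \<inter> N" and B = B and a = e and h = h, OF c assms(3) a nn])
qed

text \<open>
  The exponent \<open>0\<close> is kept to match the form of the bound in \<open>local_integral_continuous\<close>.
\<close>

lemma v_local:
  assumes p: "(x0, t0) \<in> \<Omega>"
  obtains d t1 B where "0 < d" "t0 < t1" "0 \<le> B"
    "\<And>x t b. (x, t) \<in> \<Omega> \<inter> near x0 d t1 \<Longrightarrow> 0 < b \<Longrightarrow> b \<le> t \<Longrightarrow> norm (v x t b) \<le> B * (t / b) powr 0"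
proof -
  obtain C where C: "C \<ge> 0" "\<And>x t b M. (x, t) \<in> \<Omega> \<Longrightarrow> 0 < b \<Longrightarrow> b \<le> t \<Longrightarrow>
    (\<And>r. r \<in> {0..\<phi> t} \<Longrightarrow> norm (w x r b) \<le> M) \<Longrightarrow> norm (v x t b) \<le> C * M * t"
    by (rule v_bound) blast
  obtain d t1 M where dM: "0 < d" "t0 < t1" "0 \<le> M" "(x0, t1) \<in> \<Omega>"
    "\<And>x r b. dist x x0 \<le> d \<Longrightarrow> 0 \<le> r \<Longrightarrow> r \<le> \<phi> t1 \<Longrightarrow> 0 \<le> b \<Longrightarrow> b \<le> t1 \<Longrightarrow> norm (w x r b) \<le> M"
    by (rule local_bound[OF w_continuous p]) blast
  have t1: "0 \<le> t1" using \<Omega>_nonneg[OF p] dM by simp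
  show thesis
  proof (rule that[of d t1 "C * M * t1"])
    show "norm (v x t b) \<le> C * M * t1 * (t / b) powr 0"
      if a: "(x, t) \<in> \<Omega> \<inter> near x0 d t1" "0 < b" "b \<le> t" for x t b
    proof -
      have tt: "t < t1" "dist x x0 < d" using a by (auto simp: near_def)
      have "\<phi> t \<le> \<phi> t1" using tt a by (intro phi_mono[OF l]) auto
      then have "norm (v x t b) \<le> C * M * t"
        using a tt by (intro C(2) dM(5)) auto
      also have "\<dots> \<le> C * M * t1" using C dM tt by (intro mult_left_mono) auto
      finally show ?thesis using a by simp
    qed
  qed (use C dM t1 in auto)
qed

lemma u_eq:
  assumes "(x, t) \<in> \<Omega>"
  shows "transform l w (x, t) = c_const l *\<^sub>R (LINT b:{0<..t}|lborel. v x t b)"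
    and "set_integrable lborel {0<..t} (v x t) \<Longrightarrow> set_integrable lborel {0..t} (inner_transform l w x t)"
proof -
  have t: "0 \<le> t" using \<Omega>_nonneg[OF assms] .
  have e: "(LINT b:{0<..t}|lborel. inner_transform l w x t b) = (LINT b:{0<..t}|lborel. v x t b)"
    by (rule set_lebesgue_integral_cong) (use inner_transform_eq(2)[OF assms] in auto)
  show "transform l w (x, t) = c_const l *\<^sub>R (LINT b:{0<..t}|lborel. v x t b)"
    unfolding transform_def by (simp add: set_integral_add_point(2)[OF t] e)
  assume i: "set_integrable lborel {0<..t} (v x t)"
  have "set_integrable lborel {0<..t} (inner_transform l w x t)"
    using i by (subst set_integrable_cong[OF refl refl, of _ _ "v x t"]) (use inner_transform_eq(2)[OF assms] in auto)
  then show "set_integrable lborel {0..t} (inner_transform l w x t)"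
    unfolding set_integral_add_point(1)[OF t] .
qed

lemma v_integrable:
  assumes "(x, t) \<in> \<Omega>"
  shows "set_integrable lborel {0<..t} (v x t)"
proof -
  obtain d t1 B where B: "0 < d" "t < t1" "0 \<le> B"
    "\<And>x' t b. (x', t) \<in> \<Omega> \<inter> near x d t1 \<Longrightarrow> 0 < b \<Longrightarrow> b \<le> t \<Longrightarrow> norm (v x' t b) \<le> B * (t / b) powr 0"
    by (rule v_local[OF assms]) blast
  have mem: "(x, t) \<in> \<Omega> \<inter> near x d t1" using assms B by (simp add: near_def)
  show ?thesis
    by (rule local_integrable[where N = "near x d t1", OF v_continuous zero_less_one B(4) mem])
qed

lemma transform_exists: "p \<in> \<Omega> \<Longrightarrow> transform_exists l w p"
  using inner_transform_eq(1) u_eq(2) v_integrable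
  by (cases p) (simp add: transform_exists_def)

lemma u_continuous: "continuous_on \<Omega> (transform l w)"
proof (rule continuous_on_local)
  fix p assume p: "p \<in> \<Omega>"
  obtain x0 t0 where pe: "p = (x0, t0)" by (cases p)
  obtain d t1 B where B: "0 < d" "t0 < t1" "0 \<le> B"
    "\<And>x t b. (x, t) \<in> \<Omega> \<inter> near x0 d t1 \<Longrightarrow> 0 < b \<Longrightarrow> b \<le> t \<Longrightarrow> norm (v x t b) \<le> B * (t / b) powr 0"
    by (rule v_local[OF p[unfolded pe]]) blast
  have "continuous_on (\<Omega> \<inter> near x0 d t1) (\<lambda>(x, t). LINT b:{0<..t}|lborel. v x t b)"
    by (rule local_integral_continuous[OF v_continuous zero_less_one B(4)])
  then have "continuous_on (\<Omega> \<inter> near x0 d t1) (\<lambda>p. c_const l *\<^sub>R (case p of (x, t) \<Rightarrow> LINT b:{0<..t}|lborel. v x t b))"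
    by (intro continuous_intros)
  then have "continuous_on (\<Omega> \<inter> near x0 d t1) (transform l w)"
    by (rule continuous_on_eq) (use u_eq(1) in auto)
  then show "\<exists>W. open W \<and> p \<in> W \<and> continuous_on (\<Omega> \<inter> W) (transform l w)"
    using open_near B by (intro exI[of _ "near x0 d t1"]) (auto simp: pe near_def)
qed

text \<open>
  A bound by a multiple of \<open>t\<close> near every point of the projection forces both the limit and the value
  at \<open>t = 0\<close> to be \<open>0\<close>.
\<close>

lemma vanishes_initially_I:
  assumes "\<And>x0 t0. (x0, t0) \<in> \<Omega> \<Longrightarrow> \<exists>d t1 B. 0 < d \<and> t0 < t1 \<and>
     (\<forall>x t. (x, t) \<in> \<Omega> \<inter> near x0 d t1 \<longrightarrow> norm (h (x, t)) \<le> B * t)"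
  shows "vanishes_initially \<Omega> h"
  unfolding vanishes_initially_def
proof (intro ballI conjI impI)
  fix x0 assume "x0 \<in> fst ` \<Omega>"
  then obtain t0 where p: "(x0, t0) \<in> \<Omega>" by auto
  then have t0: "t0 \<ge> 0" by (rule \<Omega>_nonneg)
  obtain d t1 B where B: "0 < d" "t0 < t1" "\<And>x t. (x, t) \<in> \<Omega> \<inter> near x0 d t1 \<Longrightarrow> norm (h (x, t)) \<le> B * t"
    using assms[OF p] by blast
  have n: "(x0, 0) \<in> near x0 d t1" using B t0 by (auto simp: near_def)
  have "eventually (\<lambda>p. p \<in> \<Omega> \<inter> near x0 d t1) (at (x0, 0) within \<Omega>)"
    using open_near n by (auto simp: eventually_at_topological)
  then have "eventually (\<lambda>p. norm (h p) \<le> B * snd p) (at (x0, 0) within \<Omega>)"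
    by eventually_elim (use B(3) in auto)
  moreover have "((\<lambda>p. B * snd p) \<longlongrightarrow> 0) (at (x0, 0) within \<Omega>)"
    by (rule tendsto_eq_intros refl | simp)+
  ultimately show "(h \<longlongrightarrow> 0) (at (x0, 0) within \<Omega>)" by (rule Lim_null_comparison)
  assume "(x0, 0) \<in> \<Omega>"
  then show "h (x0, 0) = 0" using B(3)[of x0 0] n by auto
qed

lemma u_vanishes: "vanishes_initially \<Omega> (transform l w)"
proof (rule vanishes_initially_I)
  fix x0 t0 assume p: "(x0, t0) \<in> \<Omega>"
  obtain d t1 B where B: "0 < d" "t0 < t1" "0 \<le> B"
    "\<And>x t b. (x, t) \<in> \<Omega> \<inter> near x0 d t1 \<Longrightarrow> 0 < b \<Longrightarrow> b \<le> t \<Longrightarrow> norm (v x t b) \<le> B * (t / b) powr 0"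
    by (rule v_local[OF p]) blast
  have "norm (transform l w (x, t)) \<le> \<bar>c_const l\<bar> * B * t" if "(x, t) \<in> \<Omega> \<inter> near x0 d t1" for x t
  proof -
    have "norm (LINT b:{0<..t}|lborel. v x t b) \<le> B * t / (1 - 0)"
      by (rule local_integral_bound[OF v_continuous zero_less_one B(4) that])
    then show ?thesis using that u_eq(1)[of x t] by (simp add: mult_left_mono mult.assoc)
  qed
  then show "\<exists>d t1 B. 0 < d \<and> t0 < t1 \<and> (\<forall>x t. (x, t) \<in> \<Omega> \<inter> near x0 d t1 \<longrightarrow> norm (transform l w (x, t)) \<le> B * t)"
    using B by blast
qed

lemma rhs_integrand_eq:
  assumes "0 < b" "b \<le> t"
  shows "rhs_integrand l w x t b = riem g (\<phi> t) (\<phi> b) 0 *\<^sub>R w1 x 0 b"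
proof -
  have p: "\<phi> t + \<phi> b > 0" using phi_R3[OF assms] by simp
  have "((\<phi> t + \<phi> b)\<^sup>2) powr (- g) = (\<phi> t + \<phi> b) powr (- 2 * g)"
  proof -
    have "(\<phi> t + \<phi> b)\<^sup>2 = (\<phi> t + \<phi> b) powr 2" using p by simp
    then show ?thesis by (simp only: powr_powr) simp
  qed
  then show ?thesis
    by (simp add: rhs_integrand_def riem_def riem_S_def riem_z_def hypergeo_F_eq w1_def)
qed

text \<open>
  The contribution of one \<open>b\<close> to the right-hand side, up to \<open>c\<^sub>l t\<^sup>l\<close>; \<open>Z\<close> below is its integral over \<open>b\<close>.
\<close>

definition z :: "real^'n \<Rightarrow> real \<Rightarrow> real \<Rightarrow> complex" where
  "z x t b = riem g (\<phi> t) (\<phi> b) 0 *\<^sub>R w1 x 0 b"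

lemma H0_continuous:
  assumes H: "continuous_on Q (\<lambda>(x, r, b). H x r b :: complex)"
  shows "continuous_on R3 (\<lambda>(x, t, b). H x 0 b)"
proof -
  have "continuous_on R3 (\<lambda>p. (\<lambda>(x, r, b). H x r b) (fst p, 0, snd (snd p)))"
    by (rule continuous_on_compose2[OF H])
       (use phi_nonneg[OF l] in \<open>auto intro!: continuous_intros Q_R3 simp: R3_def\<close>)
  then show ?thesis by (simp add: case_prod_unfold)
qed

lemma z_continuous: "continuous_on R3 (\<lambda>(x, t, b). z x t b)"
proof -
  have ct: "continuous_on R3 (\<lambda>p. \<phi> (fst (snd p)))" "continuous_on R3 (\<lambda>p. \<phi> (snd (snd p)))"
    by (rule continuous_on_compose2[OF phi_continuous[OF l]]; force simp: R3_def intro!: continuous_intros)+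
  have "continuous_on R3 (\<lambda>p. riem g (\<phi> (fst (snd p))) (\<phi> (snd (snd p))) 0)"
    by (rule riem_dom_compose[OF riem_continuous(1)[OF g] ct]) (use phi_R3 in \<open>auto simp: R3_def less_imp_le\<close>)
  from continuous_on_scaleR[OF this H0_continuous[OF w12_continuous(1)]]
  show ?thesis by (simp add: z_def case_prod_unfold)
qed

lemma z_local:
  assumes p: "(x0, t0) \<in> \<Omega>" "0 < t0"
  obtains d t1 B where "0 < d" "t0 < t1" "0 \<le> B"
    "\<And>x t b. (x, t) \<in> \<Omega> \<inter> (near x0 d t1 \<inter> UNIV \<times> {t0/2<..}) \<Longrightarrow> 0 < b \<Longrightarrow> b \<le> t \<Longrightarrow> norm (z x t b) \<le> B * (t / b) powr 0"
proof -
  obtain d t1 M where dM: "0 < d" "t0 < t1" "0 \<le> M" "(x0, t1) \<in> \<Omega>"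
    "\<And>x r b. dist x x0 \<le> d \<Longrightarrow> 0 \<le> r \<Longrightarrow> r \<le> \<phi> t1 \<Longrightarrow> 0 \<le> b \<Longrightarrow> b \<le> t1 \<Longrightarrow> norm (w1 x r b) \<le> M"
    by (rule local_bound[OF w12_continuous(1) p(1)]) blast
  define A where "A = (\<phi> (t0/2))\<^sup>2"
  define E where "E = (2 * \<phi> t1)\<^sup>2"
  define K where "K = hypF g 1 * (A powr (- g) + E powr (- g))"
  have F1: "0 \<le> hypF g 1" by (rule hypF_nonneg[OF g]) auto
  have A: "A > 0" using phi_pos[OF l, of "t0/2"] p by (simp add: A_def)
  have K: "K \<ge> 0" using F1 by (simp add: K_def)
  show thesis
  proof (rule that[of d t1 "K * M"])
    show "norm (z x t b) \<le> K * M * (t / b) powr 0"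
      if a: "(x, t) \<in> \<Omega> \<inter> (near x0 d t1 \<inter> UNIV \<times> {t0/2<..})" "0 < b" "b \<le> t" for x t b
    proof -
      have tt: "t < t1" "dist x x0 < d" "t0/2 < t" using a by (auto simp: near_def)
      note ph = phi_R3[OF a(2,3)]
      have "\<phi> t \<le> \<phi> t1" using tt a by (intro phi_mono[OF l]) auto
      then have hi: "riem_S (\<phi> t) (\<phi> b) 0 \<le> E" 
      proof -
        have "(\<phi> t + \<phi> b)\<^sup>2 \<le> (2 * \<phi> t1)\<^sup>2"
          using ph \<open>\<phi> t \<le> \<phi> t1\<close> by (intro power_mono) auto
        then show ?thesis by (simp add: riem_S_def E_def)
      qed
      have "\<phi> (t0/2) \<le> \<phi> t" using tt p by (intro phi_mono[OF l]) auto
      then have lo: "A \<le> riem_S (\<phi> t) (\<phi> b) 0" unfolding riem_S_def A_def using ph phi_nonneg[OF l] by (simp add: power_mono)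
      have "riem_S (\<phi> t) (\<phi> b) 0 powr (- g) \<le> A powr (- g) + E powr (- g)"
      proof (cases "g \<ge> 0")
        case True
        then have "riem_S (\<phi> t) (\<phi> b) 0 powr (- g) \<le> A powr (- g)" using lo A by (intro powr_mono2') auto
        then show ?thesis by (simp add: add_increasing2)
      next
        case False
        then have "riem_S (\<phi> t) (\<phi> b) 0 powr (- g) \<le> E powr (- g)" using lo hi A by (intro powr_mono2) auto
        then show ?thesis by (simp add: add_increasing)
      qed
      then have "\<bar>riem g (\<phi> t) (\<phi> b) 0\<bar> \<le> K"
        unfolding K_def using riem_bound[OF g ph(1,2), of 0] ph F1 by (auto intro: order_trans mult_left_mono)
      moreover have "norm (w1 x 0 b) \<le> M" using a tt phi_nonneg[OF l] by (intro dM(5)) auto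
      ultimately have "norm (z x t b) \<le> K * M" unfolding z_def norm_scaleR using K by (intro mult_mono) auto
      then show ?thesis using a by simp
    qed
  qed (use K dM in auto)
qed

lemma near_pos_mem: "0 < d \<Longrightarrow> t0 < t1 \<Longrightarrow> 0 < t0 \<Longrightarrow> (x0, t0) \<in> near x0 d t1 \<inter> UNIV \<times> {t0/2<..}"
  by (simp add: near_def)

lemma open_near_pos: "open (near x0 d t1 \<inter> UNIV \<times> {t0/2<..})"
  by (intro open_Int open_near open_Times) auto

lemma z_integrable:
  assumes "(x, t) \<in> \<Omega>" "0 < t"
  shows "set_integrable lborel {0<..t} (z x t)"
proof -
  obtain d t1 B where B: "0 < d" "t < t1" "0 \<le> B"
    "\<And>x' t' b. (x', t') \<in> \<Omega> \<inter> (near x d t1 \<inter> UNIV \<times> {t/2<..}) \<Longrightarrow> 0 < b \<Longrightarrow> b \<le> t' \<Longrightarrow> norm (z x' t' b) \<le> B * (t' / b) powr 0"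
    by (rule z_local[OF assms]) blast
  have mem: "(x, t) \<in> \<Omega> \<inter> (near x d t1 \<inter> UNIV \<times> {t/2<..})"
    using assms near_pos_mem[OF B(1,2) assms(2), of x] by simp
  show ?thesis
    by (rule local_integrable[where N = "near x d t1 \<inter> UNIV \<times> {t/2<..}", OF z_continuous zero_less_one B(4) mem])
qed

definition Z :: "(real^'n) \<times> real \<Rightarrow> complex" where
  "Z = (\<lambda>(x, t). LINT b:{0<..t}|lborel. z x t b)"

lemma Z_continuous: "continuous_on V Z"
proof (rule continuous_on_local)
  fix p assume "p \<in> V"
  then obtain x0 t0 where p: "p = (x0, t0)" "(x0, t0) \<in> \<Omega>" "0 < t0" by (cases p) (auto simp: upper_halfspace_def)
  obtain d t1 B where B: "0 < d" "t0 < t1" "0 \<le> B"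
    "\<And>x t b. (x, t) \<in> \<Omega> \<inter> (near x0 d t1 \<inter> UNIV \<times> {t0/2<..}) \<Longrightarrow> 0 < b \<Longrightarrow> b \<le> t \<Longrightarrow> norm (z x t b) \<le> B * (t / b) powr 0"
    by (rule z_local[OF p(2,3)]) blast
  have "continuous_on (\<Omega> \<inter> (near x0 d t1 \<inter> UNIV \<times> {t0/2<..})) Z"
    unfolding Z_def
    by (rule local_integral_continuous[OF z_continuous zero_less_one B(4)])
  then have "continuous_on (V \<inter> (near x0 d t1 \<inter> UNIV \<times> {t0/2<..})) Z"
    by (rule continuous_on_subset) auto
  then show "\<exists>W. open W \<and> p \<in> W \<and> continuous_on (V \<inter> W) Z"
    using open_near_pos[of x0 d t1 t0] near_pos_mem[OF B(1,2) p(3), of x0] p(1)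
    by (intro exI[of _ "near x0 d t1 \<inter> UNIV \<times> {t0/2<..}"]) simp
qed

lemma rhs_integrable:
  assumes "(x, t) \<in> V"
  shows "set_integrable lborel {0..t} (rhs_integrand l w x t)"
    and "(LINT b:{0..t}|lborel. rhs_integrand l w x t b) = Z (x, t)"
proof -
  have a: "(x, t) \<in> \<Omega>" "0 < t" using assms by (auto simp: upper_halfspace_def)
  have t: "0 \<le> t" using a by simp
  have e: "b \<in> {0<..t} \<Longrightarrow> rhs_integrand l w x t b = z x t b" for b
    by (simp add: rhs_integrand_eq z_def)
  have "set_integrable lborel {0<..t} (rhs_integrand l w x t)"
    using z_integrable[OF a] by (subst set_integrable_cong[OF refl refl, of _ _ "z x t"]) (use e in auto)
  then show "set_integrable lborel {0..t} (rhs_integrand l w x t)"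
    unfolding set_integral_add_point(1)[OF t] .
  show "(LINT b:{0..t}|lborel. rhs_integrand l w x t b) = Z (x, t)"
    unfolding set_integral_add_point(2)[OF t] Z_def
    by simp (rule set_lebesgue_integral_cong; use e in auto)
qed

lemma f_continuous: "continuous_on V (\<lambda>(x, t). f x t)"
proof -
  have "continuous_on V (\<lambda>p. (\<lambda>(x, t, b). w x 0 b) (fst p, snd p, snd p))"
    by (rule continuous_on_compose2[OF H0_continuous[OF w_continuous]])
       (auto intro!: continuous_intros simp: R3_def upper_halfspace_def)
  then show ?thesis
    by (rule continuous_on_eq) (use init in auto)
qed

lemma transform_rhs_eq: "(x, t) \<in> V \<Longrightarrow> transform_rhs l f w (x, t) = f x t + (c_const l * t powr l) *\<^sub>R Z (x, t)"
  using rhs_integrable(2) by (auto simp: transform_rhs_def upper_halfspace_def deriv_phi[OF l] powr_half_sq[OF l])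

lemma transform_rhs_continuous: "continuous_on V (transform_rhs l f w)"
proof -
  have "continuous_on V (\<lambda>p. (\<lambda>(x, t). f x t) p + (c_const l * snd p powr l) *\<^sub>R Z p)"
    by (intro continuous_intros f_continuous Z_continuous) (auto simp: upper_halfspace_def)
  then show ?thesis
    by (rule continuous_on_eq) (use transform_rhs_eq in auto)
qed

lemma transform_rhs_locally_integrable: "locally_integrable_on V (transform_rhs l f w)"
  unfolding locally_integrable_on_def set_integrable_def
proof (intro allI impI)
  fix K assume "compact K \<and> K \<subseteq> V"
  then show "integrable lborel (\<lambda>p. indicator K p *\<^sub>R transform_rhs l f w p)"
    using continuous_on_subset[OF transform_rhs_continuous] by (intro borel_integrable_compact) auto
qed

end

section \<open>The time derivative\<close>

text \<open>
  On the triangle \<open>h\<close> is bounded by \<open>B (t/b)\<^sup>e\<close>, which is integrable because \<open>e < 1\<close>.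
\<close>

lemma triangle_fubini:
  fixes h :: "real \<Rightarrow> real \<Rightarrow> complex"
  assumes h: "continuous_on {(s, b). 0 < b \<and> b \<le> s \<and> s \<le> t} (\<lambda>(s, b). h s b)"
    and bnd: "\<And>s b. 0 < b \<Longrightarrow> b \<le> s \<Longrightarrow> s \<le> t \<Longrightarrow> norm (h s b) \<le> B * (s / b) powr e"
    and e: "0 \<le> e" "e < 1" and B: "0 \<le> B" and t: "0 \<le> t"
  shows "(LINT b:{0<..t}|lborel. (LINT s:{b..t}|lborel. h s b)) = (LINT s:{0<..t}|lborel. (LINT b:{0<..s}|lborel. h s b))"
proof -
  let ?D = "{(s, b). 0 < b \<and> b \<le> s \<and> s \<le> t}"
  let ?F = "\<lambda>(s, b). indicator ?D (s, b) *\<^sub>R h s b"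
  let ?w = "\<lambda>b. indicator {0<..t} b * (t / b) powr e"
  have D: "?D \<in> sets borel"
  proof -
    have "?D = ({z. 0 < snd z} \<inter> {z. snd z \<le> fst z}) \<inter> {z. fst z \<le> t}" by auto
    moreover have "{z::real\<times>real. 0 < snd z} \<in> sets borel" by (intro borel_open open_Collect_less continuous_intros)
    moreover have "{z::real\<times>real. snd z \<le> fst z} \<in> sets borel" by (intro borel_closed closed_Collect_le continuous_intros)
    moreover have "{z::real\<times>real. fst z \<le> t} \<in> sets borel" by (intro borel_closed closed_Collect_le continuous_intros)
    ultimately show ?thesis by (simp only: sets.Int)
  qed
  have "(\<lambda>z. indicator ?D z *\<^sub>R (\<lambda>(s, b). h s b) z) \<in> borel_measurable borel"
    by (rule borel_measurable_continuous_on_indicator[OF D h])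
  moreover have "(\<lambda>z. indicator ?D z *\<^sub>R (\<lambda>(s, b). h s b) z) = ?F" by auto
  ultimately have Fm: "?F \<in> borel_measurable (lborel \<Otimes>\<^sub>M lborel)" by (simp add: lborel_prod)
  have w: "has_bochner_integral lborel ?w (t / (1 - e))" by (rule has_bochner_integral_powr_ratio[OF e(2) t])
  let ?W = "\<lambda>(s, b). indicator {0<..t} s * (B * ?w b)"
  have Wi: "integrable (lborel \<Otimes>\<^sub>M lborel) ?W"
  proof (rule lborel_pair.Fubini_integrable)
    show "?W \<in> borel_measurable (lborel \<Otimes>\<^sub>M lborel)" by measurable
    have Ws: "(LINT b|lborel. norm (?W (s, b))) = indicator {0<..t} s * (B * (t / (1 - e)))" for s :: real
    proof -
      have "norm (?W (s, b)) = indicator {0<..t} s * (B * ?w b)" for b using B by simp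
      then show ?thesis using has_bochner_integral_integral_eq[OF w] by simp
    qed
    show "integrable lborel (\<lambda>s. LINT b|lborel. norm (?W (s, b)))"
      unfolding Ws by (intro integrable_mult_left integrable_real_indicator) (use t in auto)
    have wi: "integrable lborel ?w" using w by (rule integrable.intros)
    show "AE s in lborel. integrable lborel (\<lambda>b. ?W (s, b))"
      unfolding case_prod_conv by (intro AE_I2 integrable_mult_right wi)
  qed
  have Fi: "integrable (lborel \<Otimes>\<^sub>M lborel) ?F"
  proof (rule Bochner_Integration.integrable_bound[OF Wi Fm])
    have "norm (?F z) \<le> norm (?W z)" for z
    proof -
      obtain s b where z: "z = (s, b)" by (cases z)
      show ?thesis
      proof (cases "(s, b) \<in> ?D")
        case True
        then have sb: "0 < b" "b \<le> s" "s \<le> t" by auto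
        have "norm (h s b) \<le> B * (s / b) powr e" by (rule bnd[OF sb])
        also have "\<dots> \<le> B * (t / b) powr e"
          using sb B e by (intro mult_left_mono powr_mono2 divide_right_mono) auto
        finally show ?thesis using sb True B by (simp add: z)
      qed (simp add: z)
    qed
    then show "AE z in lborel \<Otimes>\<^sub>M lborel. norm (?F z) \<le> norm (?W z)" by (intro AE_I2)
  qed
  have "(LINT b:{0<..t}|lborel. (LINT s:{b..t}|lborel. h s b)) = (LINT b|lborel. (LINT s|lborel. ?F (s, b)))"
    unfolding set_lebesgue_integral_def
  proof (rule Bochner_Integration.integral_cong[OF refl])
    fix b :: real
    show "indicat_real {0<..t} b *\<^sub>R (LINT s|lborel. indicat_real {b..t} s *\<^sub>R h s b) = (LINT s|lborel. ?F (s, b))"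
      by (subst integral_scaleR_right[symmetric], rule Bochner_Integration.integral_cong) (auto simp: indicator_def)
  qed
  also have "\<dots> = (LINT s|lborel. (LINT b|lborel. ?F (s, b)))"
    using lborel_pair.Fubini_integral[of "\<lambda>s b. ?F (s, b)"] Fi by simp
  also have "\<dots> = (LINT s:{0<..t}|lborel. (LINT b:{0<..s}|lborel. h s b))"
    unfolding set_lebesgue_integral_def
  proof (rule Bochner_Integration.integral_cong[OF refl])
    fix s :: real
    show "(LINT b|lborel. ?F (s, b)) = indicat_real {0<..t} s *\<^sub>R (LINT b|lborel. indicat_real {0<..s} b *\<^sub>R h s b)"
      by (subst integral_scaleR_right[symmetric], rule Bochner_Integration.integral_cong) (auto simp: indicator_def)
  qed
  finally show ?thesis .
qed

context wave_setting begin

definition vt :: "real^'n \<Rightarrow> real \<Rightarrow> real \<Rightarrow> complex" where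
  "vt x t b = t powr (l / 2) *\<^sub>R epd_t g (\<phi> b) (\<lambda>r. w x r b) (\<phi> t)"

definition vtt :: "real^'n \<Rightarrow> real \<Rightarrow> real \<Rightarrow> complex" where
  "vtt x t b = t powr l *\<^sub>R (epd g (\<phi> b) (\<lambda>r. w2 x r b) (\<phi> t) + z x t b)"

lemma slice_derivs:
  assumes "(x, T) \<in> \<Omega>" "0 < b" "b \<le> T" "r \<in> {0..\<phi> T}"
  shows "((\<lambda>r. w x r b) has_vector_derivative w1 x r b) (at r within {0..\<phi> T})"
    and "((\<lambda>r. w1 x r b) has_vector_derivative w2 x r b) (at r within {0..\<phi> T})"
proof -
  have q: "(x, r, b) \<in> Q" using assms by (intro Q_R3) auto
  show "((\<lambda>r. w x r b) has_vector_derivative w1 x r b) (at r within {0..\<phi> T})"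
    "((\<lambda>r. w1 x r b) has_vector_derivative w2 x r b) (at r within {0..\<phi> T})"
    by (rule has_vector_derivative_within_subset[OF w_deriv[OF q]]
         has_vector_derivative_within_subset[OF w1_deriv[OF q]]; auto)+
qed

lemma chain_phi:
  assumes "0 < b" "b \<le> t" "t \<le> T"
    and "(h has_vector_derivative y) (at (\<phi> t) within {\<phi> b..\<phi> T})"
  shows "((\<lambda>t. h (\<phi> t)) has_vector_derivative t powr (l / 2) *\<^sub>R y) (at t within {b..T})"
proof -
  have "(\<phi> has_vector_derivative t powr (l / 2)) (at t within {b..T})"
    using phi_deriv[OF l, of t] assms by (simp add: has_real_derivative_iff_has_vector_derivative)
  moreover have "(h has_vector_derivative y) (at (\<phi> t) within \<phi> ` {b..T})"
    by (rule has_vector_derivative_within_subset[OF assms(4)]) (use assms phi_mono[OF l] in auto)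
  ultimately show ?thesis using vector_diff_chain_within by (fastforce simp: o_def)
qed

lemma
  assumes "(x, T) \<in> \<Omega>" "0 < b" "b \<le> t" "t \<le> T"
  shows v_deriv: "((\<lambda>t. v x t b) has_vector_derivative vt x t b) (at t within {b..T})"
    and vt_deriv: "((\<lambda>t. vt x t b) has_vector_derivative vtt x t b) (at t within {b..T})"
proof -
  have t: "t > 0" and bT: "b \<le> T" using assms by auto
  have ph: "0 < \<phi> b" "\<phi> b \<le> \<phi> t" "\<phi> t \<le> \<phi> T" using phi_R3[OF assms(2,3)] phi_mono[OF l, of t T] assms by auto
  note G = slice_derivs[OF assms(1,2) bT]
  have c2: "continuous_on {0..\<phi> T} (\<lambda>r. w2 x r b)"
    by (rule slice_continuous[OF w12_continuous(2) assms(1,2) bT])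
  show "((\<lambda>t. v x t b) has_vector_derivative vt x t b) (at t within {b..T})"
    unfolding v_def vt_def
    by (rule chain_phi[OF assms(2-4) epd_deriv[OF g ph G(1)]])
  have d: "(epd_t g (\<phi> b) (\<lambda>r. w x r b) has_vector_derivative
        epd g (\<phi> b) (\<lambda>r. w2 x r b) (\<phi> t) + z x t b - (2 * g / \<phi> t) *\<^sub>R epd_t g (\<phi> b) (\<lambda>r. w x r b) (\<phi> t))
        (at (\<phi> t) within {\<phi> b..\<phi> T})"
    unfolding z_def by (rule epd_t_deriv[OF g ph G c2])
  have e: "t powr (l / 2) *\<^sub>R (t powr (l / 2) *\<^sub>R (E + z x t b - (2 * g / \<phi> t) *\<^sub>R Y)) + (2 * g / \<phi> t * t powr l) *\<^sub>R Y
     = t powr l *\<^sub>R (E + z x t b)" for E Y :: complex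
  proof -
    have "t powr (l / 2) * t powr (l / 2) = t powr l" by (simp add: powr_add[symmetric])
    then have "t powr (l / 2) *\<^sub>R (t powr (l / 2) *\<^sub>R (E + z x t b - (2 * g / \<phi> t) *\<^sub>R Y)) = t powr l *\<^sub>R (E + z x t b - (2 * g / \<phi> t) *\<^sub>R Y)"
      by (simp only: scaleR_scaleR)
    then show ?thesis by (simp add: scaleR_conv_of_real algebra_simps)
  qed
  have "((\<lambda>t. vt x t b) has_vector_derivative
      t powr (l / 2) *\<^sub>R (t powr (l / 2) *\<^sub>R (epd g (\<phi> b) (\<lambda>r. w2 x r b) (\<phi> t) + z x t b - (2 * g / \<phi> t) *\<^sub>R epd_t g (\<phi> b) (\<lambda>r. w x r b) (\<phi> t)))
      + (2 * g / \<phi> t * t powr l) *\<^sub>R epd_t g (\<phi> b) (\<lambda>r. w x r b) (\<phi> t)) (at t within {b..T})"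
    unfolding vt_def
    by (rule has_vector_derivative_scaleR[OF phi_deriv2[OF l t] chain_phi[OF assms(2-4) d]])
  then show "((\<lambda>t. vt x t b) has_vector_derivative vtt x t b) (at t within {b..T})"
    unfolding e vtt_def .
qed

lemma v_initial [simp]: "v x b b = 0"
  by (simp add: v_def)

lemma vt_initial:
  assumes "(x, b) \<in> \<Omega>" "0 < b"
  shows "c_const l *\<^sub>R vt x b b = f x b"
proof -
  have "c_const l *\<^sub>R vt x b b = (c_const l * (b powr (l / 2) * (4 * (\<phi> b)\<^sup>2) powr (- g))) *\<^sub>R w x 0 b"
    by (simp add: vt_def epd_t_initial)
  then show ?thesis unfolding c_const_normalization[OF l assms(2)] using init[OF assms(1)] by simp
qed

lemma epd_continuous:
  assumes "continuous_on Q (\<lambda>(x, r, b). H x r b)"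
  shows "continuous_on R3 (\<lambda>(x, t, b). epd g (\<phi> b) (\<lambda>r. H x r b) (\<phi> t))"
  unfolding epd_def by (rule kint_continuous[OF riem_continuous(1)[OF g] assms])

lemma phi_R3_continuous:
  "continuous_on R3 (\<lambda>p. \<phi> (fst (snd p)))" "continuous_on R3 (\<lambda>p. \<phi> (snd (snd p)))"
  by (rule continuous_on_compose2[OF phi_continuous[OF l]]; force simp: R3_def intro!: continuous_intros)+

lemma powr_R3_continuous: "continuous_on R3 (\<lambda>p. fst (snd p) powr e)"
  by (intro continuous_intros) (auto simp: R3_def)

lemma vt_continuous: "continuous_on R3 (\<lambda>(x, t, b). vt x t b)"
proof -
  have c1: "continuous_on R3 (\<lambda>p. (4 * \<phi> (fst (snd p)) * \<phi> (snd (snd p))) powr (- g))"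
  proof (intro continuous_on_powr continuous_intros phi_R3_continuous ballI)
    fix p assume "p \<in> R3"
    then have "0 < snd (snd p)" "snd (snd p) \<le> fst (snd p)" by (auto simp: R3_def)
    from phi_R3[OF this] show "4 * \<phi> (fst (snd p)) * \<phi> (snd (snd p)) \<noteq> 0" by simp
  qed
  have "continuous_on R3 (\<lambda>p. (\<lambda>(x, r, b). w x r b) (fst p, \<phi> (fst (snd p)) - \<phi> (snd (snd p)), snd (snd p)))"
  proof (rule continuous_on_compose2[OF w_continuous])
    show "continuous_on R3 (\<lambda>p. (fst p, \<phi> (fst (snd p)) - \<phi> (snd (snd p)), snd (snd p)))"
      by (intro continuous_intros phi_R3_continuous)
    show "(\<lambda>p. (fst p, \<phi> (fst (snd p)) - \<phi> (snd (snd p)), snd (snd p))) ` R3 \<subseteq> Q"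
    proof (rule image_subsetI)
      fix p assume "p \<in> R3"
      then have p: "(fst p, fst (snd p)) \<in> \<Omega>" "0 < snd (snd p)" "snd (snd p) \<le> fst (snd p)" by (auto simp: R3_def)
      show "(fst p, \<phi> (fst (snd p)) - \<phi> (snd (snd p)), snd (snd p)) \<in> Q"
        by (rule Q_R3[OF p]) (use phi_R3[OF p(2,3)] in auto)
    qed
  qed
  then have c2: "continuous_on R3 (\<lambda>p. w (fst p) (\<phi> (fst (snd p)) - \<phi> (snd (snd p))) (snd (snd p)))" by simp
  note c3 = kint_continuous[OF riem_continuous(2)[OF g] w_continuous, unfolded case_prod_unfold]
  show ?thesis
    unfolding vt_def epd_t_def case_prod_unfold
    by (intro continuous_on_scaleR continuous_on_add powr_R3_continuous c1 c2 c3)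
qed

lemma vtt_continuous: "continuous_on R3 (\<lambda>(x, t, b). vtt x t b)"
  unfolding vtt_def case_prod_unfold
  by (intro continuous_on_scaleR continuous_on_add powr_R3_continuous
        epd_continuous[OF w12_continuous(2), unfolded case_prod_unfold] z_continuous[unfolded case_prod_unfold])

text \<open>
  In terms of \<open>b\<close> the singularity \<open>(\<tau>/q)\<^sup>\<kappa>\<close> is \<open>(t/b)\<^sup>e\<close> with \<open>e = (l + 2) \<kappa> / 2\<close>. One needs
  \<open>\<kappa> > 0\<close>, \<open>\<kappa> \<ge> g\<close> and \<open>e < 1\<close>; as \<open>(l + 2) g / 2 = l/4\<close>, this is possible exactly for \<open>l < 4\<close>.
\<close>

lemma vt_bound:
  assumes "l < 4"
  obtains C e where "C \<ge> 0" "0 \<le> e" "e < 1" "\<And>x t b M. (x, t) \<in> \<Omega> \<Longrightarrow> 0 < b \<Longrightarrow> b \<le> t \<Longrightarrow>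
    (\<And>r. r \<in> {0..\<phi> t} \<Longrightarrow> norm (w x r b) \<le> M) \<Longrightarrow> norm (vt x t b) \<le> C * M * (t / b) powr e"
proof -
  \<comment> \<open>The second entry keeps \<open>\<kappa>\<close> positive; it gives \<open>e = 1/2\<close>.\<close>
  define \<kappa> where "\<kappa> = max g (1 / (l + 2))"
  define e where "e = (l + 2) / 2 * \<kappa>"
  have l2: "l + 2 > 0" using l by simp
  have \<kappa>: "0 < \<kappa>" "g \<le> \<kappa>" using l2 by (auto simp: \<kappa>_def less_max_iff_disj)
  have e: "0 \<le> e" "e < 1"
  proof -
    show "0 \<le> e" using \<kappa> l2 by (simp add: e_def)
    have "\<kappa> < 2 / (l + 2)"
    proof -
      have "gam l = (l / 2) / (l + 2)" by (simp add: gam_def)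
      also have "\<dots> < 2 / (l + 2)" using assms l2 by (intro divide_strict_right_mono) auto
      finally show ?thesis using l2 by (simp add: \<kappa>_def divide_strict_right_mono)
    qed
    then have "e < (l + 2) / 2 * (2 / (l + 2))" unfolding e_def using l2 by (intro mult_strict_left_mono) auto
    also have "(l + 2) / 2 * (2 / (l + 2)) = 1" using l by simp
    finally show "e < 1" .
  qed
  obtain C where C: "C \<ge> 0" "\<And>q \<tau> M G. 0 < q \<Longrightarrow> q \<le> \<tau> \<Longrightarrow> continuous_on {0..\<tau> - q} G \<Longrightarrow>
     (\<And>r. r \<in> {0..\<tau> - q} \<Longrightarrow> norm (G r) \<le> M) \<Longrightarrow> norm (epd_t g q G \<tau>) \<le> C * M * \<tau> powr (- 2 * g) * (\<tau> / q) powr \<kappa>"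
    by (rule riem_t_integral_bound[OF g \<kappa>]) blast
  define D where "D = (2 / (l + 2)) powr (- l / (l + 2))"
  show thesis
  proof (rule that[of "C * D" e])
    show "C * D \<ge> 0" using C by (simp add: D_def)
    fix x t b M assume a: "(x, t) \<in> \<Omega>" "0 < b" "b \<le> t" "\<And>r. r \<in> {0..\<phi> t} \<Longrightarrow> norm (w x r b) \<le> M"
    have t: "t > 0" using a by simp
    have "norm (epd_t g (\<phi> b) (\<lambda>r. w x r b) (\<phi> t)) \<le> C * M * \<phi> t powr (- 2 * g) * (\<phi> t / \<phi> b) powr \<kappa>"
    proof (rule C(2))
      show "continuous_on {0..\<phi> t - \<phi> b} (\<lambda>r. w x r b)"
        by (rule continuous_on_subset[OF slice_continuous[OF w_continuous a(1-3)]]) (use phi_R3[OF a(2,3)] in auto)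
    qed (use phi_R3[OF a(2,3)] a(4) in auto)
    also have "\<dots> = C * M * (D * t powr (- l / 2)) * (t / b) powr e"
      unfolding phi_powr[OF l t] phi_ratio[OF l t a(2)] D_def e_def ..
    finally have "norm (vt x t b) \<le> t powr (l / 2) * (C * M * (D * t powr (- l / 2)) * (t / b) powr e)"
      unfolding vt_def by (simp add: mult_left_mono)
    also have "\<dots> = (t powr (l / 2) * t powr (- l / 2)) * (C * D * M * (t / b) powr e)" by (simp only: mult_ac)
    also have "t powr (l / 2) * t powr (- l / 2) = 1" using t by (simp add: powr_add[symmetric])
    finally show "norm (vt x t b) \<le> C * D * M * (t / b) powr e" by simp
  qed (use e in auto)
qed

text \<open>
  Up to \<open>c\<^sub>l\<close>, the time derivative of the transform for \<open>l < 4\<close>.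
\<close>

definition G :: "real^'n \<Rightarrow> real \<Rightarrow> complex" where
  "G x t = (LINT b:{0<..t}|lborel. vt x t b)"

lemma vt_local:
  assumes "l < 4"
  obtains e where "0 \<le> e" "e < 1" "\<And>x0 t0. (x0, t0) \<in> \<Omega> \<Longrightarrow> \<exists>d t1 B. 0 < d \<and> t0 < t1 \<and> 0 \<le> B \<and> (x0, t1) \<in> \<Omega> \<and>
    (\<forall>x t b. dist x x0 < d \<longrightarrow> t < t1 \<longrightarrow> (x, t) \<in> \<Omega> \<longrightarrow> 0 < b \<longrightarrow> b \<le> t \<longrightarrow> norm (vt x t b) \<le> B * (t / b) powr e)"
proof -
  obtain C e where C: "C \<ge> 0" "0 \<le> e" "e < 1" "\<And>x t b M. (x, t) \<in> \<Omega> \<Longrightarrow> 0 < b \<Longrightarrow> b \<le> t \<Longrightarrow>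
    (\<And>r. r \<in> {0..\<phi> t} \<Longrightarrow> norm (w x r b) \<le> M) \<Longrightarrow> norm (vt x t b) \<le> C * M * (t / b) powr e"
    by (rule vt_bound[OF assms]) blast
  show thesis
  proof (rule that[OF C(2,3)])
    fix x0 t0 assume p: "(x0, t0) \<in> \<Omega>"
    obtain d t1 M where dM: "0 < d" "t0 < t1" "0 \<le> M" "(x0, t1) \<in> \<Omega>"
      "\<And>x r b. dist x x0 \<le> d \<Longrightarrow> 0 \<le> r \<Longrightarrow> r \<le> \<phi> t1 \<Longrightarrow> 0 \<le> b \<Longrightarrow> b \<le> t1 \<Longrightarrow> norm (w x r b) \<le> M"
      by (rule local_bound[OF w_continuous p]) blast
    have "norm (vt x t b) \<le> C * M * (t / b) powr e"
      if a: "dist x x0 < d" "t < t1" "(x, t) \<in> \<Omega>" "0 < b" "b \<le> t" for x t b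
    proof (rule C(4)[OF a(3-5)])
      fix r assume r: "r \<in> {0..\<phi> t}"
      have "\<phi> t \<le> \<phi> t1" using a by (intro phi_mono[OF l]) auto
      then show "norm (w x r b) \<le> M" using a r by (intro dM(5)) auto
    qed
    then show "\<exists>d t1 B. 0 < d \<and> t0 < t1 \<and> 0 \<le> B \<and> (x0, t1) \<in> \<Omega> \<and>
      (\<forall>x t b. dist x x0 < d \<longrightarrow> t < t1 \<longrightarrow> (x, t) \<in> \<Omega> \<longrightarrow> 0 < b \<longrightarrow> b \<le> t \<longrightarrow> norm (vt x t b) \<le> B * (t / b) powr e)"
      using dM C(1) by (intro exI[of _ d] exI[of _ t1] exI[of _ "C * M"]) simp
  qed
qed

text \<open>
  Write \<open>v\<close> as the integral of \<open>v\<^sub>t\<close> from \<open>b\<close>, where it vanishes, to \<open>t\<close> and exchange the integrals over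
  \<open>b\<close> and the time variable.
\<close>

lemma u_primitive:
  assumes l4: "l < 4" and p: "(x, T) \<in> \<Omega>"
  shows "continuous_on {0..T} (G x)"
    and "\<And>t. t \<in> {0..T} \<Longrightarrow> (LINT b:{0<..t}|lborel. v x t b) = integral {0..t} (G x)"
proof -
  obtain e where e: "0 \<le> e" "e < 1" "\<And>x0 t0. (x0, t0) \<in> \<Omega> \<Longrightarrow> \<exists>d t1 B. 0 < d \<and> t0 < t1 \<and> 0 \<le> B \<and> (x0, t1) \<in> \<Omega> \<and>
    (\<forall>x t b. dist x x0 < d \<longrightarrow> t < t1 \<longrightarrow> (x, t) \<in> \<Omega> \<longrightarrow> 0 < b \<longrightarrow> b \<le> t \<longrightarrow> norm (vt x t b) \<le> B * (t / b) powr e)"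
    by (rule vt_local[OF l4]) blast
  obtain d t1 B where B: "0 < d" "T < t1" "0 \<le> B"
    "\<And>x' t b. dist x' x < d \<Longrightarrow> t < t1 \<Longrightarrow> (x', t) \<in> \<Omega> \<Longrightarrow> 0 < b \<Longrightarrow> b \<le> t \<Longrightarrow> norm (vt x' t b) \<le> B * (t / b) powr e"
    using e(3)[OF p] by blast
  have bnd: "norm (vt x t b) \<le> B * (t / b) powr e" if "0 < b" "b \<le> t" "t \<le> T" for t b
    by (rule B(4)) (use that B \<Omega>_back[OF p, of t] in auto)
  let ?S = "{x} \<times> {0..T}"
  have sub: "{(x', t, b). (x', t) \<in> ?S \<and> 0 < b \<and> b \<le> t} \<subseteq> R3"
    using \<Omega>_back[OF p] by (auto simp: R3_def)
  note c = continuous_on_subset[OF vt_continuous sub]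
  have "continuous_on ?S (\<lambda>(x, t). LINT b:{0<..t}|lborel. vt x t b)"
    by (rule param_continuous[where S = ?S and h = vt and B = B and a = e, OF c _ e(2)]) (use bnd in auto)
  then have "continuous_on {0..T} (\<lambda>t. (\<lambda>(x, t). LINT b:{0<..t}|lborel. vt x t b) (x, t))"
    by (rule continuous_on_compose2) (auto intro!: continuous_intros)
  then show cG: "continuous_on {0..T} (G x)" by (simp add: G_def[abs_def])
  fix t assume t: "t \<in> {0..T}"
  have cvt: "continuous_on {b..t} (\<lambda>s. vt x s b)" if "0 < b" for b
  proof -
    have "continuous_on {b..t} (\<lambda>s. (\<lambda>(x, t, b). vt x t b) (x, s, b))"
      by (rule continuous_on_compose2[OF vt_continuous])
         (use that t \<Omega>_back[OF p] in \<open>auto intro!: continuous_intros simp: R3_def\<close>)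
    then show ?thesis by simp
  qed
  have vi: "v x t b = (LINT s:{b..t}|lborel. vt x s b)" if b: "b \<in> {0<..t}" for b
  proof -
    have "(LINT s:{b..t}|lborel. vt x s b) = v x t b - v x b b"
      unfolding set_lebesgue_integral_def
    proof (rule integral_FTC_atLeastAtMost)
      show "b \<le> t" using b by simp
      show "((\<lambda>t. v x t b) has_vector_derivative vt x s b) (at s within {b..t})" if "b \<le> s" "s \<le> t" for s
        by (rule has_vector_derivative_within_subset[OF v_deriv[OF p]]) (use b t that in auto)
      show "continuous_on {b..t} (\<lambda>s. vt x s b)" using cvt b by simp
    qed
    then show ?thesis by simp
  qed
  have "(LINT b:{0<..t}|lborel. v x t b) = (LINT b:{0<..t}|lborel. (LINT s:{b..t}|lborel. vt x s b))"
    by (rule set_lebesgue_integral_cong) (use vi in auto)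
  also have "\<dots> = (LINT s:{0<..t}|lborel. G x s)"
    unfolding G_def
  proof (rule triangle_fubini[OF _ _ e(1,2) B(3)])
    show "continuous_on {(s, b). 0 < b \<and> b \<le> s \<and> s \<le> t} (\<lambda>(s, b). vt x s b)"
    proof -
      have "continuous_on {(s, b). 0 < b \<and> b \<le> s \<and> s \<le> t} (\<lambda>q. (\<lambda>(x, t, b). vt x t b) (x, fst q, snd q))"
        by (rule continuous_on_compose2[OF vt_continuous])
           (use t \<Omega>_back[OF p] in \<open>auto intro!: continuous_intros simp: R3_def\<close>)
      then show ?thesis by (simp add: case_prod_unfold)
    qed
  qed (use bnd t in auto)
  also have "\<dots> = (LINT s:{0..t}|lborel. G x s)" using t by (simp add: set_integral_add_point(2))
  also have "\<dots> = integral {0..t} (G x)"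
    by (intro set_borel_integral_eq_integral borel_integrable_atLeastAtMost' continuous_on_subset[OF cG]) (use t in auto)
  finally show "(LINT b:{0<..t}|lborel. v x t b) = integral {0..t} (G x)" .
qed

text \<open>
  Since \<open>u\<close> is a primitive of \<open>c G\<close> on an interval \<open>[0, T]\<close> with \<open>T > t\<close>, the derivative exists also at
  \<open>t = 0\<close>, one-sidedly.
\<close>

lemma u_t:
  assumes l4: "l < 4"
  defines "ut \<equiv> \<lambda>(x, t). c_const l *\<^sub>R G x t"
  shows "\<And>x t. (x, t) \<in> \<Omega> \<Longrightarrow> ((\<lambda>s. transform l w (x, s)) has_vector_derivative ut (x, t)) (at t within {0..})"
    and "continuous_on \<Omega> ut" and "vanishes_initially \<Omega> ut"
proof -
  fix x t assume p: "(x, t) \<in> \<Omega>"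
  obtain T where T: "t < T" "(x, T) \<in> \<Omega>" by (rule \<Omega>_later[OF p])
  have t0: "0 \<le> t" by (rule \<Omega>_nonneg[OF p])
  note pr = u_primitive[OF l4 T(2)]
  have "((\<lambda>t. integral {0..t} (G x)) has_vector_derivative G x t) (at t within {0..T})"
    by (rule integral_has_vector_derivative[OF pr(1)]) (use T t0 in auto)
  then have d: "((\<lambda>t. c_const l *\<^sub>R integral {0..t} (G x)) has_vector_derivative ut (x, t)) (at t within {0..T})"
    unfolding ut_def by (auto intro!: derivative_eq_intros)
  have at: "at t within {0..T} = at t within {0..}"
    by (rule at_within_nhd[of _ "{..<T}"]) (use T in auto)
  show "((\<lambda>s. transform l w (x, s)) has_vector_derivative ut (x, t)) (at t within {0..})"
  proof (rule has_vector_derivative_transform_within[OF d[unfolded at], of "T - t"])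
    fix s :: real assume s: "s \<in> {0..}" "dist s t < T - t"
    then have sT: "s \<in> {0..T}" by (auto simp: dist_real_def)
    have "transform l w (x, s) = c_const l *\<^sub>R (LINT b:{0<..s}|lborel. v x s b)"
    proof (cases "s = 0")
      case False
      then have "(x, s) \<in> \<Omega>" using \<Omega>_back[OF T(2), of s] sT by simp
      then show ?thesis by (rule u_eq(1))
    next
      case True
      show ?thesis
        unfolding transform_def case_prod_conv set_integral_add_point(2)[OF sT[unfolded atLeastAtMost_iff, THEN conjunct1]]
        by (simp add: True set_lebesgue_integral_def)
    qed
    then show "c_const l *\<^sub>R integral {0..s} (G x) = transform l w (x, s)" by (simp add: pr(2)[OF sT])
  qed (use T t0 in auto)
next
  obtain e where e: "0 \<le> e" "e < 1" "\<And>x0 t0. (x0, t0) \<in> \<Omega> \<Longrightarrow> \<exists>d t1 B. 0 < d \<and> t0 < t1 \<and> 0 \<le> B \<and> (x0, t1) \<in> \<Omega> \<and>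
    (\<forall>x t b. dist x x0 < d \<longrightarrow> t < t1 \<longrightarrow> (x, t) \<in> \<Omega> \<longrightarrow> 0 < b \<longrightarrow> b \<le> t \<longrightarrow> norm (vt x t b) \<le> B * (t / b) powr e)"
    by (rule vt_local[OF l4]) blast
  have loc: "\<exists>d t1 B. 0 < d \<and> t0 < t1 \<and> continuous_on (\<Omega> \<inter> near x0 d t1) ut \<and>
      (\<forall>x t. (x, t) \<in> \<Omega> \<inter> near x0 d t1 \<longrightarrow> norm (ut (x, t)) \<le> B * t)" if p: "(x0, t0) \<in> \<Omega>" for x0 t0
  proof -
    obtain d t1 B where B: "0 < d" "t0 < t1" "0 \<le> B"
      "\<And>x t b. dist x x0 < d \<Longrightarrow> t < t1 \<Longrightarrow> (x, t) \<in> \<Omega> \<Longrightarrow> 0 < b \<Longrightarrow> b \<le> t \<Longrightarrow> norm (vt x t b) \<le> B * (t / b) powr e"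
      using e(3)[OF p] by blast
    have bnd: "norm (vt x t b) \<le> B * (t / b) powr e" if "(x, t) \<in> \<Omega> \<inter> near x0 d t1" "0 < b" "b \<le> t" for x t b
      by (rule B(4)) (use that in \<open>auto simp: near_def\<close>)
    have "continuous_on (\<Omega> \<inter> near x0 d t1) (\<lambda>(x, t). LINT b:{0<..t}|lborel. vt x t b)"
      by (rule local_integral_continuous[OF vt_continuous e(2) bnd])
    then have "continuous_on (\<Omega> \<inter> near x0 d t1) ut"
      unfolding ut_def G_def case_prod_unfold by (intro continuous_intros)
    moreover have "norm (ut (x, t)) \<le> (\<bar>c_const l\<bar> * B / (1 - e)) * t" if "(x, t) \<in> \<Omega> \<inter> near x0 d t1" for x t
    proof -
      have "norm (G x t) \<le> B * t / (1 - e)"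
        unfolding G_def by (rule local_integral_bound[OF vt_continuous e(2) bnd that])
      then have "norm (ut (x, t)) \<le> \<bar>c_const l\<bar> * (B * t / (1 - e))"
        unfolding ut_def by (simp only: case_prod_conv norm_scaleR) (rule mult_left_mono, auto)
      then show ?thesis by simp
    qed
    ultimately show ?thesis using B by blast
  qed
  show "continuous_on \<Omega> ut"
  proof (rule continuous_on_local)
    fix p assume "p \<in> \<Omega>"
    then obtain x0 t0 where p: "p = (x0, t0)" "(x0, t0) \<in> \<Omega>" by (cases p) auto
    then obtain d t1 where d: "0 < d" "t0 < t1" "continuous_on (\<Omega> \<inter> near x0 d t1) ut" using loc by blast
    then show "\<exists>W. open W \<and> p \<in> W \<and> continuous_on (\<Omega> \<inter> W) ut"
      using open_near by (intro exI[of _ "near x0 d t1"]) (auto simp: p near_def)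
  qed
  show "vanishes_initially \<Omega> ut"
    by (rule vanishes_initially_I) (use loc in blast)
qed

end

section \<open>Spatial derivatives and slices in b\<close>

lemma Ck_along_slice:
  fixes h :: "'a::real_normed_vector \<times> 'c::real_normed_vector \<Rightarrow> 'b::real_normed_vector"
  shows "Ck_along ((\<lambda>e. (e, 0)) ` D) k UNIV h \<Longrightarrow> Ck_along D k UNIV (\<lambda>y. h (y, t))"
proof (induction k arbitrary: h)
  case 0
  then show ?case by (auto intro!: continuous_on_compose2[of UNIV h] continuous_intros)
next
  case (Suc k)
  have o1: "dir_open ((\<lambda>e. (e, 0)) ` D) (UNIV :: ('a \<times> 'c) set)" and o2: "dir_open D (UNIV :: 'a set)"
    by (rule dir_open_open; simp)+
  note S = Suc.prems[unfolded Ck_along_Suc_iff[OF o1]]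
  have c: "continuous_on UNIV (\<lambda>y. h (y, t))"
    by (rule continuous_on_compose2[of UNIV h]) (use S in \<open>auto intro!: continuous_intros\<close>)
  have d: "(\<lambda>s. h (p + s *\<^sub>R e, t)) differentiable at 0" if "e \<in> D" for e p
  proof -
    have "(\<lambda>s. h ((p, t) + s *\<^sub>R (e, 0))) differentiable at 0" using S that by blast
    then show ?thesis by simp
  qed
  have "partial e (\<lambda>y. h (y, t)) = (\<lambda>y. partial (e, 0) h (y, t))" for e
    by (simp add: fun_eq_iff partial_within_def)
  moreover have "Ck_along D k UNIV (\<lambda>y. partial (e, 0) h (y, t))" if "e \<in> D" for e
    by (rule Suc.IH) (use S that in auto)
  ultimately show ?case unfolding Ck_along_Suc_iff[OF o2] using c d by simp
qed

lemma fold_partial_slice: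
  fixes h :: "'a::real_normed_vector \<times> 'c::real_normed_vector \<Rightarrow> 'b::real_normed_vector"
  shows "foldr partial (map (\<lambda>e. (e, 0)) es) h (x, t) = foldr partial es (\<lambda>y. h (y, t)) x"
proof (induction es arbitrary: x)
  case (Cons e es)
  have "partial (e, 0) H (x, t) = partial e (\<lambda>y. H (y, t)) x" for H :: "'a \<times> 'c \<Rightarrow> 'b"
    by (simp add: partial_within_def)
  then show ?case using Cons by simp
qed simp

lemma Ck_along_fst:
  fixes h :: "'a::real_normed_vector \<Rightarrow> 'b::real_normed_vector" and S :: "('a \<times> 'c::real_normed_vector) set"
  assumes S: "open S" and T: "open T" and "fst ` S \<subseteq> T"
  shows "Ck_along D k T h \<Longrightarrow> Ck_along ((\<lambda>e. (e, 0)) ` D) k S (\<lambda>p. h (fst p))"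
proof (induction k arbitrary: h)
  case 0
  then show ?case using assms by (auto intro!: continuous_on_compose2[of T h] continuous_intros)
next
  case (Suc k)
  note H = Suc.prems[unfolded Ck_along_Suc_iff[OF dir_open_open[OF T]]]
  have c: "continuous_on S (\<lambda>p. h (fst p))"
    by (rule continuous_on_compose2[of T h]) (use H assms in \<open>auto intro!: continuous_intros\<close>)
  have "partial (e, 0) (\<lambda>p. h (fst p)) = (\<lambda>p::'a \<times> 'c. partial e h (fst p))" for e
    by (simp add: fun_eq_iff partial_within_def)
  moreover have "Ck_along ((\<lambda>e. (e, 0)) ` D) k S (\<lambda>p. partial e h (fst p))" if "e \<in> D" for e
    by (rule Suc.IH) (use H that in auto)
  moreover have "(\<lambda>s. h (fst (p + s *\<^sub>R (e, 0 :: 'c)))) differentiable at 0" if "e \<in> D" "p \<in> S" for e p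
  proof -
    have "fst p \<in> T" using assms that by auto
    then show ?thesis using H that by simp
  qed
  ultimately show ?case unfolding Ck_along_Suc_iff[OF dir_open_open[OF S]] using c by auto
qed

lemma dist_partial_fold:
  "foldr (\<lambda>i. dist_partial (E i)) is T h = (-1) ^ length is * T (foldr partial (rev (map E is)) h)"
proof (induction "is" arbitrary: h)
  case (Cons i "is")
  have "foldr (\<lambda>i. dist_partial (E i)) (i # is) T h = - foldr (\<lambda>i. dist_partial (E i)) is T (partial (E i) h)"
    by (simp add: dist_partial_def)
  also have "\<dots> = - ((-1) ^ length is * T (foldr partial (rev (map E is)) (partial (E i) h)))"
    by (simp only: Cons)
  finally show ?case by simp
qed simp

lemma compact_uniform_bound:
  assumes K: "compact K" and loc: "\<And>p. p \<in> K \<Longrightarrow> \<exists>W B. open W \<and> p \<in> W \<and> (\<forall>q\<in>K \<inter> W. R q (B::real))"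
    and mono: "\<And>q B B'. R q B \<Longrightarrow> B \<le> B' \<Longrightarrow> R q B'"
  shows "\<exists>B\<ge>0. \<forall>q\<in>K. R q B"
proof -
  obtain W B where WB: "\<And>p. p \<in> K \<Longrightarrow> open (W p) \<and> p \<in> W p \<and> (\<forall>q\<in>K \<inter> W p. R q (B p))"
    using loc by metis
  obtain C where C: "C \<subseteq> K" "finite C" "K \<subseteq> (\<Union>p\<in>C. W p)"
    by (rule compactE_image[OF K, of K W]) (use WB in auto)
  have le: "B p \<le> Max (insert 0 (B ` C))" if "p \<in> C" for p using C(2) that by (intro Max_ge) auto
  show ?thesis
  proof (intro exI[of _ "Max (insert 0 (B ` C))"] conjI ballI)
    show "0 \<le> Max (insert 0 (B ` C))" using C(2) by (intro Max_ge) auto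
    fix q assume q: "q \<in> K"
    then obtain p where p: "p \<in> C" "q \<in> W p" using C by blast
    then have "R q (B p)" using WB[of p] C q by blast
    then show "R q (Max (insert 0 (B ` C)))" by (rule mono[OF _ le[OF p(1)]])
  qed
qed

context wave_setting begin

abbreviation "ax \<equiv> \<lambda>i. axis i 1 :: real^'n"

definition Ot :: "real \<Rightarrow> (real^'n) set" where "Ot t = {x. (x, t) \<in> \<Omega>}"

lemma open_Ot: "0 < t \<Longrightarrow> open (Ot t)"
proof -
  assume t: "0 < t"
  have "Ot t = (\<lambda>x. (x, t)) -` V" using t by (auto simp: Ot_def upper_halfspace_def)
  then show ?thesis
    by (simp only:) (rule open_vimage[OF open_V], intro continuous_intros)
qed

definition vd :: "'n list \<Rightarrow> real^'n \<Rightarrow> real \<Rightarrow> real \<Rightarrow> complex" where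
  "vd is x t b = epd g (\<phi> b) (\<lambda>r. wd is x r b) (\<phi> t)"

lemma vd_continuous: "length is \<le> m \<Longrightarrow> continuous_on R3 (\<lambda>(x, t, b). vd is x t b)"
  unfolding vd_def by (rule epd_continuous[OF wd_continuous])

lemma vd_deriv:
  assumes x: "x \<in> Ot t" and b: "0 < b" "b \<le> t" and len: "length is < m"
  shows "((\<lambda>s. vd is (x + s *\<^sub>R ax i) t b) has_vector_derivative vd (i # is) x t b) (at 0)"
proof -
  have t: "0 < t" using b by simp
  obtain d where d: "d > 0" "\<And>s. \<bar>s\<bar> < d \<Longrightarrow> x + s *\<^sub>R ax i \<in> Ot t"
    using dir_open_open[OF open_Ot[OF t], of "{ax i}"] x unfolding dir_open_def by blast
  let ?U = "{-d<..<d}" and ?R = "\<phi> t - \<phi> b"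
  have U: "s \<in> ?U \<Longrightarrow> (x + s *\<^sub>R ax i, t) \<in> \<Omega>" for s using d(2)[of s] by (auto simp: Ot_def)
  note ph = phi_R3[OF b]
  have "((\<lambda>s. integral (cbox 0 ?R) (\<lambda>r. riem g (\<phi> t) (\<phi> b) r *\<^sub>R wd is (x + s *\<^sub>R ax i) r b)) has_vector_derivative
     integral (cbox 0 ?R) (\<lambda>r. riem g (\<phi> t) (\<phi> b) r *\<^sub>R wd (i # is) (x + 0 *\<^sub>R ax i) r b)) (at 0 within ?U)"
  proof (rule leibniz_rule_vector_derivative)
    fix s r assume s: "s \<in> ?U" and r: "r \<in> cbox 0 ?R"
    have q: "(x + s *\<^sub>R ax i, r, b) \<in> Q" by (rule Q_R3[OF U[OF s] b]) (use r ph in auto)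
    have "((\<lambda>s. wd is (x + s *\<^sub>R ax i) r b) has_vector_derivative wd (i # is) (x + s *\<^sub>R ax i) r b) (at s within ?U)"
      by (rule has_vector_derivative_line_shift) (rule wd_deriv[OF len q])
    then show "((\<lambda>s. riem g (\<phi> t) (\<phi> b) r *\<^sub>R wd is (x + s *\<^sub>R ax i) r b) has_vector_derivative
        riem g (\<phi> t) (\<phi> b) r *\<^sub>R wd (i # is) (x + s *\<^sub>R ax i) r b) (at s within ?U)"
      by (auto intro!: derivative_eq_intros)
  next
    fix s assume s: "s \<in> ?U"
    show "(\<lambda>r. riem g (\<phi> t) (\<phi> b) r *\<^sub>R wd is (x + s *\<^sub>R ax i) r b) integrable_on cbox 0 ?R"
      using integrable_continuous_real[OF slice_kernel_continuous[OF riem_continuous(1)[OF g] wd_continuous U[OF s] b, of "is"]] len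
      by simp
  next
    show "continuous_on (?U \<times> cbox 0 ?R) (\<lambda>(s, r). riem g (\<phi> t) (\<phi> b) r *\<^sub>R wd (i # is) (x + s *\<^sub>R ax i) r b)"
      unfolding case_prod_unfold
    proof (intro continuous_on_scaleR)
      show "continuous_on (?U \<times> cbox 0 ?R) (\<lambda>p. riem g (\<phi> t) (\<phi> b) (snd p))"
        by (rule riem_dom_compose[OF riem_continuous(1)[OF g]]) (use ph in \<open>auto intro!: continuous_intros\<close>)
      have "continuous_on (?U \<times> cbox 0 ?R) (\<lambda>p. (\<lambda>(x, r, b). wd (i # is) x r b) (x + fst p *\<^sub>R ax i, snd p, b))"
      proof (rule continuous_on_compose2[OF wd_continuous])
        show "length (i # is) \<le> m" using len by simp
        show "continuous_on (?U \<times> cbox 0 ?R) (\<lambda>p. (x + fst p *\<^sub>R ax i, snd p, b))" by (intro continuous_intros)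
        show "(\<lambda>p. (x + fst p *\<^sub>R ax i, snd p, b)) ` (?U \<times> cbox 0 ?R) \<subseteq> Q"
        proof (rule image_subsetI)
          fix p assume p: "p \<in> ?U \<times> cbox 0 ?R"
          show "(x + fst p *\<^sub>R ax i, snd p, b) \<in> Q"
            by (rule Q_R3[OF U b]) (use p ph in \<open>auto simp: mem_Times_iff\<close>)
        qed
      qed
      then show "continuous_on (?U \<times> cbox 0 ?R) (\<lambda>p. wd (i # is) (x + fst p *\<^sub>R ax i) (snd p) b)" by simp
    qed
  qed (use d in auto)
  moreover have "at 0 within ?U = at (0::real)"
    by (rule at_within_open) (use d in auto)
  ultimately show ?thesis by (simp add: vd_def epd_def)
qed

definition DN :: "(real^'n) set" where "DN = range ax"

lemma vd_Ck:
  assumes b: "0 < b" "b \<le> t"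
  shows "length is + j \<le> m \<Longrightarrow> Ck_along DN j (Ot t) (\<lambda>x. vd is x t b)"
proof (induction j arbitrary: "is")
  case (0 "is")
  have "continuous_on (Ot t) (\<lambda>x. (\<lambda>(x, t, b). vd is x t b) (x, t, b))"
    by (rule continuous_on_compose2[OF vd_continuous]) (use 0 b in \<open>auto intro!: continuous_intros simp: Ot_def R3_def\<close>)
  then show ?case by simp
next
  case (Suc j)
  have o: "dir_open DN (Ot t)" using b by (intro dir_open_open open_Ot) auto
  have d: "((\<lambda>s. vd is (x + s *\<^sub>R ax i) t b) has_vector_derivative vd (i # is) x t b) (at 0)" if "x \<in> Ot t" for x i
    by (rule vd_deriv[OF that b]) (use Suc.prems in simp)
  have "continuous_on (Ot t) (\<lambda>x. vd is x t b)" using Ck_along_continuous[OF Suc.IH] Suc.prems by auto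
  moreover have "(\<lambda>s. vd is (x + s *\<^sub>R ax i) t b) differentiable at 0" if "x \<in> Ot t" for x i
    using d[OF that, of i] by (auto simp: has_vector_derivative_def differentiable_def)
  moreover have "Ck_along DN j (Ot t) (partial (ax i) (\<lambda>x. vd is x t b))" for i
  proof (rule Ck_along_cong[OF o])
    show "Ck_along DN j (Ot t) (\<lambda>x. vd (i # is) x t b)" by (rule Suc.IH) (use Suc.prems in simp)
    show "vd (i # is) p t b = partial (ax i) (\<lambda>x. vd is x t b) p" if "p \<in> Ot t" for p
      using partial_eqI[OF d[OF that]] by simp
  qed
  ultimately show ?case unfolding Ck_along_Suc_iff[OF o] unfolding DN_def by blast
qed

lemma vd_fold:
  assumes b: "0 < b" "b \<le> t"
  shows "length is \<le> m \<Longrightarrow> x \<in> Ot t \<Longrightarrow> foldr partial (map ax is) (\<lambda>x. v x t b) x = vd is x t b"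
proof (induction "is" arbitrary: x)
  case Nil
  then show ?case by (simp add: vd_def v_def wd_Nil)
next
  case (Cons i "is")
  have o: "dir_open DN (Ot t)" using b by (intro dir_open_open open_Ot) auto
  have "foldr partial (map ax (i # is)) (\<lambda>x. v x t b) x = partial (ax i) (foldr partial (map ax is) (\<lambda>x. v x t b)) x"
    by simp
  also have "\<dots> = partial (ax i) (\<lambda>x. vd is x t b) x"
    by (rule partial_cong_on(1)[OF o Cons.prems(2)]) (use Cons in \<open>auto simp: DN_def\<close>)
  also have "\<dots> = vd (i # is) x t b"
    by (rule partial_eqI[OF vd_deriv[OF Cons.prems(2) b]]) (use Cons.prems in simp)
  finally show ?case .
qed

definition vw2 :: "real^'n \<Rightarrow> real \<Rightarrow> real \<Rightarrow> complex" where
  "vw2 x t b = epd g (\<phi> b) (\<lambda>r. w2 x r b) (\<phi> t)"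

text \<open>
  The equation for \<open>w\<close> holds for \<open>r > 0\<close>, and the single point \<open>r = 0\<close> is negligible. Hence \<open>A\<close> may be
  applied to \<open>v\<close> under the integral.
\<close>

lemma vw2_eq:
  assumes x: "(x, t) \<in> \<Omega>" and b: "0 < b" "b \<le> t"
  shows "(\<Sum>\<alpha>\<in>multi_indices m. a \<alpha> x * vd (multi_list \<alpha>) x t b) = vw2 x t b"
proof -
  let ?R = "\<phi> t - \<phi> b"
  note ph = phi_R3[OF b]
  have i: "(\<lambda>r. riem g (\<phi> t) (\<phi> b) r *\<^sub>R wd (multi_list \<alpha>) x r b) integrable_on {0..?R}" if "\<alpha> \<in> multi_indices m" for \<alpha>
    by (rule integrable_continuous_real[OF slice_kernel_continuous[OF riem_continuous(1)[OF g] wd_continuous[OF multi_list_le[OF that]] x b]])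
  have "(\<Sum>\<alpha>\<in>multi_indices m. a \<alpha> x * vd (multi_list \<alpha>) x t b)
     = (\<Sum>\<alpha>\<in>multi_indices m. integral {0..?R} (\<lambda>r. a \<alpha> x * (riem g (\<phi> t) (\<phi> b) r *\<^sub>R wd (multi_list \<alpha>) x r b)))"
    unfolding vd_def epd_def by (simp only: integral_mult_right)
  also have "\<dots> = integral {0..?R} (\<lambda>r. \<Sum>\<alpha>\<in>multi_indices m. a \<alpha> x * (riem g (\<phi> t) (\<phi> b) r *\<^sub>R wd (multi_list \<alpha>) x r b))"
    by (rule integral_sum[symmetric, OF finite_multi_indices]) (intro integrable_on_mult_right i)
  also have "\<dots> = vw2 x t b" unfolding vw2_def epd_def
  proof (rule integral_spike[of "{0}"])
    fix r assume r: "r \<in> {0..?R} - {0}"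
    have "w2 x r b = (\<Sum>\<alpha>\<in>multi_indices m. a \<alpha> x * wd (multi_list \<alpha>) x r b)"
      by (rule w2_eq[OF x]) (use r ph \<Omega>_back[OF x b] in auto)
    then show "riem g (\<phi> t) (\<phi> b) r *\<^sub>R w2 x r b
        = (\<Sum>\<alpha>\<in>multi_indices m. a \<alpha> x * (riem g (\<phi> t) (\<phi> b) r *\<^sub>R wd (multi_list \<alpha>) x r b))"
      by (simp add: scaleR_sum_right)
  qed simp
  finally show ?thesis .
qed

lemma vw2_continuous: "continuous_on R3 (\<lambda>(x, t, b). vw2 x t b)"
  unfolding vw2_def by (rule epd_continuous[OF w12_continuous(2)])

lemma vtt_eq: "vtt x t b = t powr l *\<^sub>R (vw2 x t b + z x t b)"
  by (simp add: vtt_def vw2_def)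

text \<open>
  Testing the slice of \<open>H\<close> at a fixed \<open>b\<close>, extended by zero to \<open>t < b\<close>, with \<open>\<theta>\<close>. It is \<open>0\<close>
  for \<open>b \<le> 0\<close>, so that it can be integrated over the whole line.
\<close>

definition J :: "(real^'n \<Rightarrow> real \<Rightarrow> real \<Rightarrow> complex) \<Rightarrow> ((real^'n) \<times> real \<Rightarrow> complex) \<Rightarrow> real \<Rightarrow> complex" where
  "J H \<theta> b = (LINT p|lborel. indicator {p. 0 < b \<and> b \<le> snd p} p *\<^sub>R (H (fst p) (snd p) b * \<theta> p))"

definition supported :: "((real^'n) \<times> real) set \<Rightarrow> ((real^'n) \<times> real \<Rightarrow> complex) \<Rightarrow> bool" where
  "supported K \<theta> \<longleftrightarrow> continuous_on UNIV \<theta> \<and> (\<forall>p. p \<notin> K \<longrightarrow> \<theta> p = 0)"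

lemma supported_zero: "supported K \<theta> \<Longrightarrow> p \<notin> K \<Longrightarrow> \<theta> p = 0"
  unfolding supported_def by blast

lemma J_integrable:
  assumes K: "compact K" "K \<subseteq> V" and \<theta>: "supported K \<theta>"
    and H: "continuous_on R3 (\<lambda>(x, t, b). H x t b :: complex)" and b: "0 < b"
  shows "integrable lborel (\<lambda>p. indicator {p. 0 < b \<and> b \<le> snd p} p *\<^sub>R (H (fst p) (snd p) b * \<theta> p))"
proof -
  let ?C = "K \<inter> {p. b \<le> snd p}"
  have cl: "closed {p :: (real^'n) \<times> real. b \<le> snd p}" by (intro closed_Collect_le continuous_intros)
  have C: "compact ?C" by (rule compact_Int_closed[OF K(1) cl])
  have "continuous_on ?C (\<lambda>p. (\<lambda>(x, t, b). H x t b) (fst p, snd p, b))"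
    by (rule continuous_on_compose2[OF H]) (use K b in \<open>auto intro!: continuous_intros simp: R3_def\<close>)
  then have "continuous_on ?C (\<lambda>p. H (fst p) (snd p) b * \<theta> p)"
    using \<theta> by (auto intro!: continuous_intros simp: supported_def intro: continuous_on_subset)
  then have "integrable lborel (\<lambda>p. indicator ?C p *\<^sub>R (H (fst p) (snd p) b * \<theta> p))"
    by (rule borel_integrable_compact[OF C])
  moreover have "(\<lambda>p. indicator ?C p *\<^sub>R (H (fst p) (snd p) b * \<theta> p)) = (\<lambda>p. indicator {p. 0 < b \<and> b \<le> snd p} p *\<^sub>R (H (fst p) (snd p) b * \<theta> p))"
    using \<theta> b by (auto simp: fun_eq_iff supported_def indicator_def)
  ultimately show ?thesis by simp
qed

text \<open>
  The slices are uniformly bounded on the support of \<open>\<theta>\<close>, so that the double integral converges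
  absolutely.
\<close>

lemma J_fubini:
  assumes K: "compact K" "K \<subseteq> V" and \<theta>: "supported K \<theta>"
    and H: "continuous_on R3 (\<lambda>(x, t, b). H x t b :: complex)"
    and B: "\<And>x t b. (x, t) \<in> K \<Longrightarrow> 0 < b \<Longrightarrow> b \<le> t \<Longrightarrow> norm (H x t b) \<le> B"
  shows "integrable lborel (J H \<theta>)"
    and "(LINT b|lborel. J H \<theta> b) = (LINT p|lborel. (LINT b:{0<..snd p}|lborel. H (fst p) (snd p) b) * \<theta> p)"
proof -
  let ?D = "{(b, p). p \<in> K \<and> 0 < b \<and> b \<le> snd p}"
  let ?F = "\<lambda>(b, p). indicator ?D (b, p) *\<^sub>R (H (fst p) (snd p) b * \<theta> p)"
  have D: "?D \<in> sets borel"
  proof -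
    have e: "?D = (UNIV \<times> K \<inter> {z. 0 < fst z}) \<inter> {z. fst z \<le> snd (snd z)}" by auto
    have "UNIV \<times> K \<in> sets borel" using K by (intro borel_closed closed_Times compact_imp_closed) auto
    moreover have "{z::real\<times>(real^'n)\<times>real. 0 < fst z} \<in> sets borel" by (intro borel_open open_Collect_less continuous_intros)
    moreover have "{z::real\<times>(real^'n)\<times>real. fst z \<le> snd (snd z)} \<in> sets borel" by (intro borel_closed closed_Collect_le continuous_intros)
    ultimately show ?thesis unfolding e by (intro sets.Int)
  qed
  have "continuous_on ?D (\<lambda>z. (\<lambda>(x, t, b). H x t b) (fst (snd z), snd (snd z), fst z))"
    by (rule continuous_on_compose2[OF H]) (use K in \<open>auto intro!: continuous_intros simp: R3_def\<close>)
  moreover have "continuous_on ?D (\<lambda>z. \<theta> (snd z))"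
    by (rule continuous_on_compose2[of UNIV \<theta>]) (use \<theta> in \<open>auto simp: supported_def intro!: continuous_intros\<close>)
  ultimately have c: "continuous_on ?D (\<lambda>z. H (fst (snd z)) (snd (snd z)) (fst z) * \<theta> (snd z))"
    by (auto intro!: continuous_on_mult)
  have "(\<lambda>z. indicator ?D z *\<^sub>R (H (fst (snd z)) (snd (snd z)) (fst z) * \<theta> (snd z))) \<in> borel_measurable borel"
    by (rule borel_measurable_continuous_on_indicator[OF D c])
  moreover have "(\<lambda>z. indicator ?D z *\<^sub>R (H (fst (snd z)) (snd (snd z)) (fst z) * \<theta> (snd z))) = ?F" by auto
  ultimately have Fm: "?F \<in> borel_measurable (lborel \<Otimes>\<^sub>M lborel)" by (simp add: lborel_prod)
  obtain M where M: "M \<ge> 0" "\<And>p. norm (\<theta> p) \<le> M"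
  proof -
    have "bounded (\<theta> ` K)"
      using K \<theta> by (intro compact_imp_bounded compact_continuous_image) (auto simp: supported_def intro: continuous_on_subset)
    then obtain M where "M > 0" "\<And>p. p \<in> K \<Longrightarrow> norm (\<theta> p) \<le> M" by (auto simp: bounded_pos)
    moreover have "norm (\<theta> p) \<le> M" for p
    proof (cases "p \<in> K")
      case False
      then have "\<theta> p = 0" using \<theta> unfolding supported_def by blast
      then show ?thesis using calculation(1) by simp
    qed (rule calculation(2))
    ultimately show thesis by (intro that[of M]) auto
  qed
  obtain T where T: "\<And>p. p \<in> K \<Longrightarrow> snd p \<le> T"
  proof -
    have "bounded (snd ` K)" using K by (intro compact_imp_bounded compact_continuous_image continuous_intros) auto
    then obtain T where "\<And>s. s \<in> snd ` K \<Longrightarrow> norm s \<le> T" unfolding bounded_iff by blast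
    then have "norm (snd p) \<le> T" if "p \<in> K" for p using that by blast
    then show thesis by (intro that[of T]) (auto simp: abs_le_iff)
  qed
  have "?D \<subseteq> {0..T} \<times> K" using T by force
  moreover have "bounded ({0..T} \<times> K)" using K by (intro bounded_Times compact_imp_bounded) auto
  ultimately have bD: "bounded ?D" using bounded_subset by blast
  have Wi: "integrable lborel (\<lambda>z. (\<bar>B\<bar> * M) * indicator ?D z)"
    using D emeasure_bounded_finite[OF bD] by (intro integrable_mult_right integrable_real_indicator) auto
  have Fi: "integrable (lborel \<Otimes>\<^sub>M lborel) ?F"
    unfolding lborel_prod
  proof (rule Bochner_Integration.integrable_bound[OF Wi])
    show "?F \<in> borel_measurable lborel" using Fm by (simp add: lborel_prod)
    have "norm (?F z) \<le> norm ((\<bar>B\<bar> * M) * indicator ?D z)" for z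
    proof -
      obtain b x t where z: "z = (b, x, t)" by (cases z)
      show ?thesis
      proof (cases "z \<in> ?D")
        case True
        then have "norm (H x t b) \<le> B" by (intro B) (auto simp: z)
        then have "norm (H x t b * \<theta> (x, t)) \<le> \<bar>B\<bar> * M"
          unfolding norm_mult using M by (intro mult_mono) auto
        then show ?thesis using True M by (simp add: z)
      qed (simp add: z)
    qed
    then show "AE z in lborel. norm (?F z) \<le> norm ((\<bar>B\<bar> * M) * indicator ?D z)" by (intro AE_I2)
  qed
  have Je: "J H \<theta> b = (LINT p|lborel. ?F (b, p))" for b
    unfolding J_def
    by (rule Bochner_Integration.integral_cong) (use \<theta> in \<open>auto simp: supported_def indicator_def\<close>)
  have Jf: "J H \<theta> = (\<lambda>b. LINT p|lborel. ?F (b, p))" by (rule ext) (rule Je)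
  show "integrable lborel (J H \<theta>)" unfolding Jf by (rule lborel_pair.integrable_fst'[OF Fi])
  have "(LINT b|lborel. J H \<theta> b) = (LINT b|lborel. (LINT p|lborel. ?F (b, p)))" by (simp only: Je)
  also have "\<dots> = (LINT p|lborel. (LINT b|lborel. ?F (b, p)))"
    using lborel_pair.Fubini_integral[of "\<lambda>b p. ?F (b, p)"] Fi by simp
  also have "\<dots> = (LINT p|lborel. (LINT b:{0<..snd p}|lborel. H (fst p) (snd p) b) * \<theta> p)"
  proof (rule Bochner_Integration.integral_cong[OF refl])
    fix p
    show "(LINT b|lborel. ?F (b, p)) = (LINT b:{0<..snd p}|lborel. H (fst p) (snd p) b) * \<theta> p"
    proof (cases "p \<in> K")
      case True
      have "(LINT b|lborel. ?F (b, p)) = (LINT b|lborel. (indicator {0<..snd p} b *\<^sub>R H (fst p) (snd p) b) * \<theta> p)"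
        by (rule Bochner_Integration.integral_cong) (use True in \<open>auto simp: indicator_def\<close>)
      also have "\<dots> = (LINT b|lborel. indicator {0<..snd p} b *\<^sub>R H (fst p) (snd p) b) * \<theta> p"
        by (rule integral_mult_left_zero)
      finally show ?thesis unfolding set_lebesgue_integral_def .
    next
      case False
      then show ?thesis using supported_zero[OF \<theta>] by simp
    qed
  qed
  finally show "(LINT b|lborel. J H \<theta> b) = (LINT p|lborel. (LINT b:{0<..snd p}|lborel. H (fst p) (snd p) b) * \<theta> p)" .
qed

lemma v_bounded:
  assumes K: "compact K" "K \<subseteq> V"
  obtains B where "\<And>x t b. (x, t) \<in> K \<Longrightarrow> 0 < b \<Longrightarrow> b \<le> t \<Longrightarrow> norm (v x t b) \<le> B"
proof -
  let ?R = "\<lambda>q B. \<forall>b. 0 < b \<longrightarrow> b \<le> snd q \<longrightarrow> norm (v (fst q) (snd q) b) \<le> B"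
  have ex: "\<exists>B\<ge>0. \<forall>q\<in>K. ?R q B"
  proof (rule compact_uniform_bound[OF K(1)])
    fix p assume "p \<in> K"
    then obtain x0 t0 where p: "p = (x0, t0)" "(x0, t0) \<in> \<Omega>" using K by (cases p) auto
    obtain d t1 B where B: "0 < d" "t0 < t1" "0 \<le> B"
      "\<And>x t b. (x, t) \<in> \<Omega> \<inter> near x0 d t1 \<Longrightarrow> 0 < b \<Longrightarrow> b \<le> t \<Longrightarrow> norm (v x t b) \<le> B * (t / b) powr 0"
      by (rule v_local[OF p(2)]) blast
    have "?R q B" if q: "q \<in> K \<inter> near x0 d t1" for q
    proof (intro allI impI)
      fix b assume b: "0 < b" "b \<le> snd q"
      have "(fst q, snd q) \<in> \<Omega> \<inter> near x0 d t1" using q K by auto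
      from B(4)[OF this b] show "norm (v (fst q) (snd q) b) \<le> B" using b by simp
    qed
    moreover have "p \<in> near x0 d t1" using B p by (simp add: near_def)
    ultimately show "\<exists>W B. open W \<and> p \<in> W \<and> (\<forall>q\<in>K \<inter> W. ?R q B)"
      by (intro exI[of _ "near x0 d t1"] exI[of _ B] conjI open_near ballI)
  next
    show "?R q B'" if "?R q B" "B \<le> B'" for q B B' using that by (auto intro: order_trans)
  qed
  then obtain B where B: "\<forall>q\<in>K. ?R q B" by blast
  show thesis
  proof (rule that)
    show "(x, t) \<in> K \<Longrightarrow> 0 < b \<Longrightarrow> b \<le> t \<Longrightarrow> norm (v x t b) \<le> B" for x t b
      using B[THEN bspec, of "(x, t)"] by simp
  qed
qed

lemma z_bounded:
  assumes K: "compact K" "K \<subseteq> V"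
  obtains B where "\<And>x t b. (x, t) \<in> K \<Longrightarrow> 0 < b \<Longrightarrow> b \<le> t \<Longrightarrow> norm (z x t b) \<le> B"
proof -
  let ?R = "\<lambda>q B. \<forall>b. 0 < b \<longrightarrow> b \<le> snd q \<longrightarrow> norm (z (fst q) (snd q) b) \<le> B"
  have ex: "\<exists>B\<ge>0. \<forall>q\<in>K. ?R q B"
  proof (rule compact_uniform_bound[OF K(1)])
    fix p assume "p \<in> K"
    then obtain x0 t0 where p: "p = (x0, t0)" "(x0, t0) \<in> \<Omega>" "0 < t0" using K by (cases p) (auto simp: upper_halfspace_def)
    obtain d t1 B where B: "0 < d" "t0 < t1" "0 \<le> B"
      "\<And>x t b. (x, t) \<in> \<Omega> \<inter> (near x0 d t1 \<inter> UNIV \<times> {t0/2<..}) \<Longrightarrow> 0 < b \<Longrightarrow> b \<le> t \<Longrightarrow> norm (z x t b) \<le> B * (t / b) powr 0"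
      by (rule z_local[OF p(2,3)]) blast
    let ?N = "near x0 d t1 \<inter> UNIV \<times> {t0/2<..}"
    have "?R q B" if q: "q \<in> K \<inter> ?N" for q
    proof (intro allI impI)
      fix b assume b: "0 < b" "b \<le> snd q"
      have "(fst q, snd q) \<in> \<Omega> \<inter> ?N" using q K by auto
      from B(4)[OF this b] show "norm (z (fst q) (snd q) b) \<le> B" using b by simp
    qed
    moreover have "p \<in> ?N" unfolding p(1) by (rule near_pos_mem[OF B(1,2) p(3)])
    ultimately show "\<exists>W B. open W \<and> p \<in> W \<and> (\<forall>q\<in>K \<inter> W. ?R q B)"
      by (intro exI[of _ ?N] exI[of _ B] conjI open_near_pos ballI)
  next
    show "?R q B'" if "?R q B" "B \<le> B'" for q B B' using that by (auto intro: order_trans)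
  qed
  then obtain B where B: "\<forall>q\<in>K. ?R q B" by blast
  show thesis
  proof (rule that)
    show "(x, t) \<in> K \<Longrightarrow> 0 < b \<Longrightarrow> b \<le> t \<Longrightarrow> norm (z x t b) \<le> B" for x t b
      using B[THEN bspec, of "(x, t)"] by simp
  qed
qed

end

section \<open>The equation in the sense of distributions\<close>

context wave_setting begin

lemma
  assumes K: "compact K" "K \<subseteq> V" and \<theta>: "supported K \<theta>"
    and H: "continuous_on R3 (\<lambda>(x, t, b). H x t b :: complex)" and b: "0 < b"
  shows J_iterated_xt: "J H \<theta> b = (LINT x|lborel. (LINT t|lborel. indicator {b..} t *\<^sub>R (H x t b * \<theta> (x, t))))"
    and J_iterated_tx: "J H \<theta> b = (LINT t|lborel. (LINT x|lborel. indicator {b..} t *\<^sub>R (H x t b * \<theta> (x, t))))"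
    and J_inner_integrable: "integrable lborel (\<lambda>x. LINT t|lborel. indicator {b..} t *\<^sub>R (H x t b * \<theta> (x, t)))"
proof -
  let ?f = "\<lambda>x t. indicator {b..} t *\<^sub>R (H x t b * \<theta> (x, t))"
  have e: "(\<lambda>p. indicator {p. 0 < b \<and> b \<le> snd p} p *\<^sub>R (H (fst p) (snd p) b * \<theta> p)) = (\<lambda>(x, t). ?f x t)"
    using b by (auto simp: fun_eq_iff indicator_def)
  have i: "integrable (lborel \<Otimes>\<^sub>M lborel) (\<lambda>(x, t). ?f x t)"
    unfolding lborel_prod e[symmetric] by (rule J_integrable[OF K \<theta> H b])
  have J: "J H \<theta> b = integral\<^sup>L (lborel \<Otimes>\<^sub>M lborel) (\<lambda>(x, t). ?f x t)"
    unfolding J_def e lborel_prod ..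
  show "J H \<theta> b = (LINT x|lborel. (LINT t|lborel. ?f x t))"
    unfolding J using lborel_pair.integral_fst'[OF i] by simp
  show "J H \<theta> b = (LINT t|lborel. (LINT x|lborel. ?f x t))"
    unfolding J using lborel_pair.integral_snd[OF i] by simp
  show "integrable lborel (\<lambda>x. LINT t|lborel. ?f x t)"
    using lborel_pair.integrable_fst'[OF i] by simp
qed

lemma open_fst_\<Omega>: "open (fst ` \<Omega>)"
proof -
  have "fst ` \<Omega> = fst ` V"
  proof (intro equalityI subsetI)
    fix x assume "x \<in> fst ` \<Omega>"
    then obtain t where p: "(x, t) \<in> \<Omega>" by auto
    obtain t1 where t1: "t < t1" "(x, t1) \<in> \<Omega>" by (rule \<Omega>_later[OF p])
    have "(x, t1) \<in> V" using t1 \<Omega>_nonneg[OF p] by (simp add: upper_halfspace_def)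
    then show "x \<in> fst ` V" by (rule image_eqI[rotated]) simp
  qed auto
  then show ?thesis using open_image_fst[OF open_V] by simp
qed

context
  fixes \<psi> :: "(real^'n) \<times> real \<Rightarrow> complex"
  assumes psi: "\<psi> \<in> test_functions V"
begin

definition K where "K = closure {p. \<psi> p \<noteq> 0}"
definition D1 where "D1 = partial (0, 1) \<psi>"
definition D2 where "D2 = partial (0, 1) D1"

lemma K: "compact K" "K \<subseteq> V" "closed K"
  using psi by (auto simp: test_functions_def K_def)

lemma psi_Ck: "Ck_along Basis k UNIV \<psi>"
  using psi by (simp add: test_functions_def smooth_on_def)

lemma psi_0: "p \<notin> K \<Longrightarrow> \<psi> p = 0"
  unfolding K_def using closure_subset[of "{p. \<psi> p \<noteq> 0}"] by auto

lemma dir_open_UNIV: "dir_open D UNIV"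
  by (rule dir_open_open) simp

lemma psi_derivs:
  shows "supported K \<psi>" "supported K D1" "supported K D2"
    and "\<And>x t T. ((\<lambda>t. \<psi> (x, t)) has_vector_derivative D1 (x, t)) (at t within T)"
    and "\<And>x t T. ((\<lambda>t. D1 (x, t)) has_vector_derivative D2 (x, t)) (at t within T)"
proof -
  have B: "(0, 1) \<in> (Basis :: ((real^'n) \<times> real) set)" by (auto simp: Basis_prod_def)
  note s0 = psi_Ck[of "Suc (Suc 0)", unfolded Ck_along_Suc_iff[OF dir_open_UNIV, of _ "Suc 0"]]
  have s1: "Ck_along Basis (Suc 0) UNIV D1" and d1: "\<forall>p\<in>UNIV. (\<lambda>s. \<psi> (p + s *\<^sub>R (0, 1))) differentiable at 0"
    using s0 B unfolding D1_def by blast+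
  note s1' = s1[unfolded Ck_along_Suc_iff[OF dir_open_UNIV]]
  have s2: "Ck_along Basis 0 UNIV D2" and d2: "\<forall>p\<in>UNIV. (\<lambda>s. D1 (p + s *\<^sub>R (0, 1))) differentiable at 0"
    using s1' B unfolding D2_def by blast+
  note c = Ck_along_continuous[OF psi_Ck] Ck_along_continuous[OF s1] Ck_along_continuous[OF s2]
  note d = bspec[OF d1 UNIV_I] bspec[OF d2 UNIV_I]
  have v1: "D1 p = 0" if "p \<notin> K" for p
    unfolding D1_def by (rule partial_vanish[of "- K"]) (use K psi_0 that in auto)
  have v2: "D2 p = 0" if "p \<notin> K" for p
    unfolding D2_def by (rule partial_vanish[of "- K"]) (use K v1 that in auto)
  show "supported K \<psi>" "supported K D1" "supported K D2"
    unfolding supported_def using c psi_0 v1 v2 by blast+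
  have line: "((\<lambda>t. h (x, t)) has_vector_derivative partial (0, 1) h (x, t)) (at t within T)"
    if "\<And>p. (\<lambda>s. h (p + s *\<^sub>R (0, 1))) differentiable at 0" for h :: "(real^'n) \<times> real \<Rightarrow> complex" and x t T
  proof -
    have "((\<lambda>t. h ((x, 0) + t *\<^sub>R (0, 1))) has_vector_derivative partial (0, 1) h ((x, 0) + t *\<^sub>R (0, 1))) (at t within T)"
      by (rule has_vector_derivative_line_shift[OF has_partial[OF that]])
    then show ?thesis by simp
  qed
  show "((\<lambda>t. \<psi> (x, t)) has_vector_derivative D1 (x, t)) (at t within T)" for x t T
    unfolding D1_def by (rule line[OF d(1)])
  show "((\<lambda>t. D1 (x, t)) has_vector_derivative D2 (x, t)) (at t within T)" for x t T
    unfolding D2_def by (rule line[OF d(2)])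
qed

definition tl\<psi> :: "(real^'n) \<times> real \<Rightarrow> complex" where
  "tl\<psi> p = of_real (snd p powr l) * \<psi> p"
definition h :: "('n \<Rightarrow> nat) \<Rightarrow> (real^'n) \<times> real \<Rightarrow> complex" where
  "h \<alpha> p = a \<alpha> (fst p) * tl\<psi> p"
text \<open>
  The function that the transposed derivatives \<open>\<partial>\<^sup>\<alpha>\<close> produce from \<open>a\<^sub>\<alpha> t\<^sup>l \<psi>\<close>; the order of the
  derivatives is reversed.
\<close>

definition chi :: "('n \<Rightarrow> nat) \<Rightarrow> (real^'n) \<times> real \<Rightarrow> complex" where
  "chi \<alpha> = foldr partial (map (\<lambda>e. (e, 0)) (rev (map ax (multi_list \<alpha>)))) (h \<alpha>)"

lemma tl\<psi>_supported: "supported K tl\<psi>"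
  unfolding supported_def
proof
  show "\<forall>p. p \<notin> K \<longrightarrow> tl\<psi> p = 0" by (intro allI impI) (simp add: tl\<psi>_def psi_0)
  show "continuous_on UNIV tl\<psi>"
  proof (rule continuous_on_zero_extend[OF open_V K(3,2)])
    show "continuous_on V tl\<psi>"
      unfolding tl\<psi>_def
      by (intro continuous_intros continuous_on_subset[OF Ck_along_continuous[OF psi_Ck[of 0]]])
         (auto simp: upper_halfspace_def)
  qed (simp add: tl\<psi>_def psi_0)
qed

lemma h_0: "p \<notin> K \<Longrightarrow> h \<alpha> p = 0"
  by (simp add: h_def tl\<psi>_def psi_0)

text \<open>
  On the domain the function is a product of functions smooth in \<open>x\<close>, with \<open>t\<^sup>l\<close> constant in the
  \<open>x\<close>-directions; off the support of \<open>\<psi>\<close> it vanishes, whatever the values of \<open>a\<^sub>\<alpha>\<close> there.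
\<close>

lemma h_Ck:
  assumes \<alpha>: "\<alpha> \<in> multi_indices m"
  shows "Ck_along ((\<lambda>e. (e, 0)) ` DN) k UNIV (h \<alpha>)"
proof (rule Ck_along_local[OF dir_open_UNIV])
  let ?D = "(\<lambda>e. (e, 0)) ` DN :: ((real^'n) \<times> real) set"
  have DB: "DN \<subseteq> Basis" "?D \<subseteq> Basis" by (auto simp: DN_def Basis_prod_def axis_in_Basis_iff)
  fix p :: "(real^'n) \<times> real"
  show "\<exists>W. open W \<and> p \<in> W \<and> Ck_along ?D k (UNIV \<inter> W) (h \<alpha>)"
  proof (cases "p \<in> V")
    case True
    have oV: "dir_open ?D V" by (rule dir_open_open[OF open_V])
    have "Ck_along Basis k (fst ` \<Omega>) (a \<alpha>)" using coeff[OF \<alpha>] by (simp add: smooth_on_def)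
    then have "Ck_along DN k (fst ` \<Omega>) (a \<alpha>)"
      by (rule Ck_along_subset[OF dir_open_open[OF open_fst_\<Omega>] dir_open_open[OF open_fst_\<Omega>] subset_refl DB(1)])
    then have 1: "Ck_along ?D k V (\<lambda>p. a \<alpha> (fst p))"
      by (rule Ck_along_fst[OF open_V open_fst_\<Omega>, rotated]) auto
    have 2: "Ck_along ?D k V (\<lambda>p. of_real (snd p powr l) :: complex)"
      by (rule Ck_along_const_dir[OF oV]) (auto intro!: continuous_intros simp: upper_halfspace_def)
    have 3: "Ck_along ?D k V \<psi>"
      by (rule Ck_along_subset[OF dir_open_UNIV oV _ DB(2) psi_Ck]) simp
    have "Ck_along ?D k V (\<lambda>p. a \<alpha> (fst p) * (of_real (snd p powr l) * \<psi> p))"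
      by (rule Ck_along_mult[OF oV 1 Ck_along_mult[OF oV 2 3]])
    then have "Ck_along ?D k (UNIV \<inter> V) (h \<alpha>)" by (simp add: h_def[abs_def] tl\<psi>_def)
    then show ?thesis using True open_V by blast
  next
    case False
    then have p: "p \<in> - K" using K by auto
    have o: "open (- K)" using K by auto
    have "Ck_along ?D k (- K) (h \<alpha>)"
      by (rule Ck_along_cong[OF dir_open_open[OF o] _ Ck_along_const_dir[OF dir_open_open[OF o], of "\<lambda>_. 0"]])
         (use h_0 in auto)
    then show ?thesis using p o by (intro exI[of _ "- K"]) simp
  qed
qed

lemma h_supported: "\<alpha> \<in> multi_indices m \<Longrightarrow> supported K (h \<alpha>)"
  unfolding supported_def using Ck_along_continuous[OF h_Ck] h_0 by blast

lemma chi_supported: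
  assumes \<alpha>: "\<alpha> \<in> multi_indices m"
  shows "supported K (chi \<alpha>)"
proof -
  let ?es = "map (\<lambda>e. (e, 0)) (rev (map ax (multi_list \<alpha>))) :: ((real^'n) \<times> real) list"
  have "Ck_along ((\<lambda>e. (e, 0)) ` DN) (length ?es - length ?es) UNIV (foldr partial ?es (h \<alpha>))"
    by (rule Ck_along_fold[OF dir_open_UNIV h_Ck[OF \<alpha>]]) (auto simp: DN_def)
  then have "continuous_on UNIV (chi \<alpha>)" unfolding chi_def by (rule Ck_along_continuous)
  moreover have "chi \<alpha> p = 0" if "p \<notin> K" for p
    unfolding chi_def by (rule fold_partial_vanish[OF K(3) h_0 that])
  ultimately show ?thesis unfolding supported_def by blast
qed

lemma dist_operator_eq:
  "dist_mult (\<lambda>(x, t). of_real (t powr l)) (dist_diff_op m a T) \<psi>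
    = (\<Sum>\<alpha>\<in>multi_indices m. (-1) ^ length (multi_list \<alpha>) * T (chi \<alpha>))"
proof -
  have "(\<lambda>p. (case p of (x, t) \<Rightarrow> a \<alpha> x) * ((case p of (x, t) \<Rightarrow> of_real (t powr l)) * \<psi> p)) = h \<alpha>" for \<alpha>
    by (auto simp: fun_eq_iff h_def tl\<psi>_def)
  then show ?thesis
    by (simp add: dist_mult_def dist_diff_op_def multi_pow_eq dist_partial_fold chi_def rev_map o_def)
qed

text \<open>
  Integration by parts in \<open>x\<close> at fixed \<open>t \<ge> b\<close>, where \<open>v\<close> is \<open>m\<close> times differentiable in \<open>x\<close>.
\<close>

lemma weak_x:
  assumes \<alpha>: "\<alpha> \<in> multi_indices m" and b: "0 < b"
  shows "(-1) ^ length (multi_list \<alpha>) * J v (chi \<alpha>) b = J (vd (multi_list \<alpha>)) (h \<alpha>) b"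
proof -
  let ?L = "multi_list \<alpha>"
  have len: "length ?L \<le> m" by (rule multi_list_le[OF \<alpha>])
  have inner: "(-1) ^ length ?L * (LINT x|lborel. indicator {b..} t *\<^sub>R (v x t b * chi \<alpha> (x, t)))
      = (LINT x|lborel. indicator {b..} t *\<^sub>R (vd ?L x t b * h \<alpha> (x, t)))" for t
  proof (cases "b \<le> t")
    case True
    have t: "0 < t" using b True by simp
    let ?K = "{x. (x, t) \<in> K}" and ?es = "map ax ?L"
    have Kt: "?K = fst ` (K \<inter> {p. snd p = t})" by force
    have cK: "compact ?K" unfolding Kt
      by (intro compact_continuous_image compact_Int_closed K closed_Collect_eq continuous_intros)
    have sub: "?K \<subseteq> Ot t" using K by (auto simp: Ot_def)
    have "(LINT x|lborel. foldr partial ?es (\<lambda>x. v x t b) x * h \<alpha> (x, t))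
       = (-1) ^ length ?es * (LINT x|lborel. v x t b * foldr partial (rev ?es) (\<lambda>x. h \<alpha> (x, t)) x)"
    proof (rule integral_by_parts_fold[OF open_Ot[OF t] cK sub])
      show "Ck_along DN m (Ot t) (\<lambda>x. v x t b)"
        using vd_Ck[OF b True, of "[]" m] by (simp add: vd_def v_def wd_Nil)
      show "Ck_along DN m UNIV (\<lambda>x. h \<alpha> (x, t))" by (rule Ck_along_slice[OF h_Ck[OF \<alpha>]])
    qed (use len h_0 in \<open>auto simp: DN_def\<close>)
    moreover have "foldr partial ?es (\<lambda>x. v x t b) x * h \<alpha> (x, t) = vd ?L x t b * h \<alpha> (x, t)" for x
    proof (cases "x \<in> Ot t")
      case True
      then show ?thesis using vd_fold[OF b \<open>b \<le> t\<close> len] by simp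
    next
      case False
      then have "(x, t) \<notin> K" using sub by blast
      then show ?thesis by (simp add: h_0)
    qed
    moreover have "foldr partial (rev ?es) (\<lambda>x. h \<alpha> (x, t)) x = chi \<alpha> (x, t)" for x
      unfolding chi_def fold_partial_slice ..
    ultimately have "(LINT x|lborel. vd ?L x t b * h \<alpha> (x, t)) = (-1) ^ length ?L * (LINT x|lborel. v x t b * chi \<alpha> (x, t))"
      by simp
    then show ?thesis using True by simp
  qed simp
  have "(-1) ^ length ?L * J v (chi \<alpha>) b
    = (LINT t|lborel. (-1) ^ length ?L * (LINT x|lborel. indicator {b..} t *\<^sub>R (v x t b * chi \<alpha> (x, t))))"
    unfolding J_iterated_tx[OF K(1,2) chi_supported[OF \<alpha>] v_continuous b] by (rule integral_mult_right_zero[symmetric])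
  also have "\<dots> = J (vd ?L) (h \<alpha>) b"
    unfolding inner J_iterated_tx[OF K(1,2) h_supported[OF \<alpha>] vd_continuous[OF len] b] ..
  finally show ?thesis .
qed

lemma weak_x_sum:
  assumes b: "0 < b"
  shows "(\<Sum>\<alpha>\<in>multi_indices m. (-1) ^ length (multi_list \<alpha>) * J v (chi \<alpha>) b) = J vw2 tl\<psi> b"
proof -
  have "(\<Sum>\<alpha>\<in>multi_indices m. (-1) ^ length (multi_list \<alpha>) * J v (chi \<alpha>) b)
      = (\<Sum>\<alpha>\<in>multi_indices m. J (vd (multi_list \<alpha>)) (h \<alpha>) b)"
    by (rule sum.cong[OF refl]) (rule weak_x[OF _ b])
  also have "\<dots> = (LINT p|lborel. (\<Sum>\<alpha>\<in>multi_indices m.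
      indicator {p. 0 < b \<and> b \<le> snd p} p *\<^sub>R (vd (multi_list \<alpha>) (fst p) (snd p) b * h \<alpha> p)))"
    unfolding J_def
    by (rule Bochner_Integration.integral_sum[symmetric])
       (intro J_integrable[OF K(1,2) h_supported vd_continuous b] multi_list_le)
  also have "\<dots> = J vw2 tl\<psi> b"
    unfolding J_def
  proof (rule Bochner_Integration.integral_cong[OF refl])
    fix p :: "(real^'n) \<times> real"
    obtain x t where p: "p = (x, t)" by (cases p)
    show "(\<Sum>\<alpha>\<in>multi_indices m. indicator {p. 0 < b \<and> b \<le> snd p} p *\<^sub>R (vd (multi_list \<alpha>) (fst p) (snd p) b * h \<alpha> p))
       = indicator {p. 0 < b \<and> b \<le> snd p} p *\<^sub>R (vw2 (fst p) (snd p) b * tl\<psi> p)"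
    proof (cases "p \<in> K \<and> b \<le> t")
      case True
      then have "(x, t) \<in> \<Omega>" using K p by auto
      from vw2_eq[OF this b] True
      have "vw2 x t b * tl\<psi> (x, t) = (\<Sum>\<alpha>\<in>multi_indices m. a \<alpha> x * vd (multi_list \<alpha>) x t b) * tl\<psi> (x, t)" by simp
      also have "\<dots> = (\<Sum>\<alpha>\<in>multi_indices m. vd (multi_list \<alpha>) x t b * h \<alpha> (x, t))"
        unfolding sum_distrib_right by (intro sum.cong refl) (simp add: h_def mult_ac)
      finally show ?thesis using True b by (simp add: p)
    next
      case False
      show ?thesis
      proof (cases "b \<le> t")
        case True
        then have "p \<notin> K" using False by simp
        then show ?thesis by (simp add: h_0 tl\<psi>_def psi_0)
      qed (simp add: p)
    qed
  qed
  finally show ?thesis .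
qed

text \<open>
  Integration by parts in \<open>t\<close> from \<open>b\<close> to a time \<open>T\<close> beyond the support of \<open>\<psi>\<close> above \<open>x\<close> with
  \<open>(x, T)\<close> still in the domain. At \<open>T\<close> the test function vanishes; at \<open>b\<close> the function \<open>v\<close> vanishes and
  only \<open>v\<^sub>t \<psi>\<close> survives.
\<close>

lemma weak_t_slice:
  assumes b: "0 < b"
  shows "(LINT t|lborel. indicator {b..} t *\<^sub>R (v x t b * D2 (x, t)))
    = vt x b b * \<psi> (x, b) + (LINT t|lborel. indicator {b..} t *\<^sub>R (vtt x t b * \<psi> (x, t)))"
proof (cases "\<exists>t\<ge>b. (x, t) \<in> K")
  case False
  have z: "\<psi> (x, t) = 0 \<and> D2 (x, t) = 0" if "b \<le> t" for t
  proof -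
    have "(x, t) \<notin> K" using False that by blast
    then show ?thesis using supported_zero[OF psi_derivs(1)] supported_zero[OF psi_derivs(3)] by blast
  qed
  have e: "indicator {b..} t *\<^sub>R (v x t b * D2 (x, t)) = 0" "indicator {b..} t *\<^sub>R (vtt x t b * \<psi> (x, t)) = 0" for t
    using z[of t] by (cases "b \<le> t"; auto)+
  show ?thesis unfolding e using z[of b] by simp
next
  case True
  let ?S = "snd ` (K \<inter> {p. fst p = x})"
  have cS: "compact ?S"
    by (intro compact_continuous_image compact_Int_closed K closed_Collect_eq continuous_intros)
  have mem: "t \<in> ?S \<longleftrightarrow> (x, t) \<in> K" for t by force
  have "?S \<noteq> {}" using True mem by blast
  then obtain s where s: "s \<in> ?S" "\<And>t. t \<in> ?S \<Longrightarrow> t \<le> s"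
    using compact_attains_sup[OF cS] by blast
  have sb: "b \<le> s" using True s(2) mem by (meson order_trans)
  have "(x, s) \<in> \<Omega>" using s(1) mem K by blast
  then obtain T where T: "s < T" "(x, T) \<in> \<Omega>" by (rule \<Omega>_later)
  have bT: "b \<le> T" using sb T by simp
  have z: "\<psi> (x, t) = 0 \<and> D1 (x, t) = 0 \<and> D2 (x, t) = 0" if "T \<le> t" for t
  proof -
    have "(x, t) \<notin> K" using s(2)[of t] mem[of t] that T by auto
    then show ?thesis using psi_derivs(1-3)[THEN supported_zero] by blast
  qed
  have cut: "indicator {b..} t *\<^sub>R (c * q) = indicator {b..T} t *\<^sub>R (c * q)" if "T \<le> t \<Longrightarrow> q = 0" for t and c q :: complex
    using that by (auto simp: indicator_def)
  have cR: "continuous_on {b..T} (\<lambda>t. H x t b)" if "continuous_on R3 (\<lambda>(x, t, b). H x t b)" for H :: "real^'n \<Rightarrow> real \<Rightarrow> real \<Rightarrow> complex"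
  proof -
    have "continuous_on {b..T} (\<lambda>t. (\<lambda>(x, t, b). H x t b) (x, t, b))"
      by (rule continuous_on_compose2[OF that]) (use b \<Omega>_back[OF T(2)] in \<open>auto intro!: continuous_intros simp: R3_def\<close>)
    then show ?thesis by simp
  qed
  have c\<theta>: "continuous_on {b..T} (\<lambda>t. \<theta> (x, t))" if "supported K \<theta>" for \<theta>
    by (rule continuous_on_compose2[of UNIV \<theta>]) (use that in \<open>auto simp: supported_def intro!: continuous_intros\<close>)
  note c1 = continuous_on_mult[OF cR[OF v_continuous] c\<theta>[OF psi_derivs(3)]]
  note c2 = continuous_on_mult[OF cR[OF vtt_continuous] c\<theta>[OF psi_derivs(1)]]
  have i1: "set_integrable lborel {b..T} (\<lambda>t. v x t b * D2 (x, t))" by (rule borel_integrable_atLeastAtMost'[OF c1])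
  have i2: "set_integrable lborel {b..T} (\<lambda>t. vtt x t b * \<psi> (x, t))" by (rule borel_integrable_atLeastAtMost'[OF c2])
  have "(LINT t|lborel. indicator {b..T} t *\<^sub>R (v x t b * D2 (x, t) - vtt x t b * \<psi> (x, t)))
     = (v x T b * D1 (x, T) - vt x T b * \<psi> (x, T)) - (v x b b * D1 (x, b) - vt x b b * \<psi> (x, b))"
  proof (rule integral_FTC_atLeastAtMost[OF bT])
    fix t assume t: "b \<le> t" "t \<le> T"
    have "((\<lambda>t. v x t b * D1 (x, t) - vt x t b * \<psi> (x, t)) has_vector_derivative
       (v x t b * D2 (x, t) + vt x t b * D1 (x, t)) - (vt x t b * D1 (x, t) + vtt x t b * \<psi> (x, t))) (at t within {b..T})"
      by (intro has_vector_derivative_diff has_vector_derivative_mult v_deriv[OF T(2) b t] vt_deriv[OF T(2) b t] psi_derivs(4,5))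
    then show "((\<lambda>t. v x t b * D1 (x, t) - vt x t b * \<psi> (x, t)) has_vector_derivative
       v x t b * D2 (x, t) - vtt x t b * \<psi> (x, t)) (at t within {b..T})" by simp
  next
    show "continuous_on {b..T} (\<lambda>t. v x t b * D2 (x, t) - vtt x t b * \<psi> (x, t))"
      by (rule continuous_on_diff[OF c1 c2])
  qed
  also have "\<dots> = vt x b b * \<psi> (x, b)" using z[of T] by simp
  finally have "(LINT t|lborel. indicator {b..T} t *\<^sub>R (v x t b * D2 (x, t))) - (LINT t|lborel. indicator {b..T} t *\<^sub>R (vtt x t b * \<psi> (x, t)))
     = vt x b b * \<psi> (x, b)"
    using Bochner_Integration.integral_diff[OF i1[unfolded set_integrable_def] i2[unfolded set_integrable_def]]
    by (simp add: scaleR_diff_right)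
  note main = this
  have e1: "indicator {b..} t *\<^sub>R (v x t b * D2 (x, t)) = indicator {b..T} t *\<^sub>R (v x t b * D2 (x, t))" for t
    by (rule cut) (use z in blast)
  have e2: "indicator {b..} t *\<^sub>R (vtt x t b * \<psi> (x, t)) = indicator {b..T} t *\<^sub>R (vtt x t b * \<psi> (x, t))" for t
    by (rule cut) (use z in blast)
  show ?thesis unfolding e1 e2 using main by (simp add: diff_eq_eq)
qed

lemma weak_t:
  assumes b: "0 < b"
  shows "c_const l *\<^sub>R J v D2 b = (LINT x|lborel. f x b * \<psi> (x, b)) + c_const l *\<^sub>R (J vw2 tl\<psi> b + J z tl\<psi> b)"
proof -
  let ?A = "\<lambda>x. LINT t|lborel. indicator {b..} t *\<^sub>R (v x t b * D2 (x, t))"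
  let ?B = "\<lambda>x. LINT t|lborel. indicator {b..} t *\<^sub>R (vtt x t b * \<psi> (x, t))"
  note iA = J_inner_integrable[OF K(1,2) psi_derivs(3) v_continuous b]
  note iB = J_inner_integrable[OF K(1,2) psi_derivs(1) vtt_continuous b]
  have "J v D2 b - J vtt \<psi> b = (LINT x|lborel. ?A x) - (LINT x|lborel. ?B x)"
    unfolding J_iterated_xt[OF K(1,2) psi_derivs(3) v_continuous b] J_iterated_xt[OF K(1,2) psi_derivs(1) vtt_continuous b] ..
  also have "\<dots> = (LINT x|lborel. ?A x - ?B x)"
    by (rule Bochner_Integration.integral_diff[OF iA iB, symmetric])
  also have "\<dots> = (LINT x|lborel. vt x b b * \<psi> (x, b))"
    unfolding weak_t_slice[OF b] by simp
  finally have "c_const l *\<^sub>R J v D2 b - c_const l *\<^sub>R J vtt \<psi> b = (LINT x|lborel. c_const l *\<^sub>R (vt x b b * \<psi> (x, b)))"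
    by (simp add: scaleR_diff_right[symmetric])
  also have "\<dots> = (LINT x|lborel. f x b * \<psi> (x, b))"
  proof (rule Bochner_Integration.integral_cong[OF refl])
    fix x
    show "c_const l *\<^sub>R (vt x b b * \<psi> (x, b)) = f x b * \<psi> (x, b)"
    proof (cases "(x, b) \<in> K")
      case True
      then have "c_const l *\<^sub>R vt x b b = f x b" using K b by (intro vt_initial) auto
      then show ?thesis by (metis mult_scaleR_left)
    qed (simp add: psi_0)
  qed
  finally have 1: "c_const l *\<^sub>R J v D2 b = (LINT x|lborel. f x b * \<psi> (x, b)) + c_const l *\<^sub>R J vtt \<psi> b"
    by (simp add: diff_eq_eq)
  have "J vtt \<psi> b = (LINT p|lborel. indicator {p. 0 < b \<and> b \<le> snd p} p *\<^sub>R (vw2 (fst p) (snd p) b * tl\<psi> p)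
      + indicator {p. 0 < b \<and> b \<le> snd p} p *\<^sub>R (z (fst p) (snd p) b * tl\<psi> p))"
    unfolding J_def
    by (rule Bochner_Integration.integral_cong[OF refl])
       (simp add: vtt_eq tl\<psi>_def scaleR_conv_of_real algebra_simps)
  also have "\<dots> = J vw2 tl\<psi> b + J z tl\<psi> b"
    unfolding J_def
    by (rule Bochner_Integration.integral_add[OF J_integrable[OF K(1,2) tl\<psi>_supported vw2_continuous b]
          J_integrable[OF K(1,2) tl\<psi>_supported z_continuous b]])
  finally show ?thesis unfolding 1 by simp
qed

text \<open>
  For \<open>b \<le> 0\<close> both sides vanish, so the identity can be integrated over all real \<open>b\<close>.
\<close>

lemma slice_identity:
  "c_const l *\<^sub>R (J v D2 b - (\<Sum>\<alpha>\<in>multi_indices m. (-1) ^ length (multi_list \<alpha>) * J v (chi \<alpha>) b))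
    = (LINT x|lborel. f x b * \<psi> (x, b)) + c_const l *\<^sub>R J z tl\<psi> b"
proof (cases "0 < b")
  case True
  show ?thesis
    unfolding weak_x_sum[OF True] scaleR_diff_right weak_t[OF True] by (simp add: scaleR_add_right)
next
  case False
  then have J0: "J H \<theta> b = 0" for H \<theta> by (simp add: J_def)
  have "\<psi> (x, b) = 0" for x
    using False K(2) psi_0[of "(x, b)"] by (auto simp: upper_halfspace_def)
  then show ?thesis by (simp add: J0)
qed

lemma regular_dist_u:
  assumes \<theta>: "supported K \<theta>"
  shows "regular_dist V (transform l w) \<theta> = c_const l *\<^sub>R (LINT b|lborel. J v \<theta> b)" and "integrable lborel (J v \<theta>)"
proof -
  obtain B where B: "\<And>x t b. (x, t) \<in> K \<Longrightarrow> 0 < b \<Longrightarrow> b \<le> t \<Longrightarrow> norm (v x t b) \<le> B"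
    by (rule v_bounded[OF K(1,2)]) blast
  note J = J_fubini[OF K(1,2) \<theta> v_continuous B]
  show "integrable lborel (J v \<theta>)" by (rule J(1))
  have "regular_dist V (transform l w) \<theta> = (LINT p|lborel. c_const l *\<^sub>R ((LINT b:{0<..snd p}|lborel. v (fst p) (snd p) b) * \<theta> p))"
    unfolding regular_dist_def set_lebesgue_integral_def[of _ V]
  proof (rule Bochner_Integration.integral_cong[OF refl])
    fix p :: "(real^'n) \<times> real"
    show "indicat_real V p *\<^sub>R (transform l w p * \<theta> p) = c_const l *\<^sub>R ((LINT b:{0<..snd p}|lborel. v (fst p) (snd p) b) * \<theta> p)"
    proof (cases "p \<in> K")
      case True
      then have "p \<in> V" using K by blast
      then show ?thesis using u_eq(1)[of "fst p" "snd p"] by simp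
    next
      case False
      then show ?thesis using supported_zero[OF \<theta>] by simp
    qed
  qed
  also have "\<dots> = c_const l *\<^sub>R (LINT p|lborel. (LINT b:{0<..snd p}|lborel. v (fst p) (snd p) b) * \<theta> p)"
    by (rule integral_scaleR_right)
  also have "(LINT p|lborel. (LINT b:{0<..snd p}|lborel. v (fst p) (snd p) b) * \<theta> p) = (LINT b|lborel. J v \<theta> b)"
    by (rule J(2)[symmetric])
  finally show "regular_dist V (transform l w) \<theta> = c_const l *\<^sub>R (LINT b|lborel. J v \<theta> b)" .
qed

lemma regular_dist_rhs:
  "regular_dist V (transform_rhs l f w) \<psi> = (LINT b|lborel. LINT x|lborel. f x b * \<psi> (x, b)) + c_const l *\<^sub>R (LINT b|lborel. J z tl\<psi> b)"
  "integrable lborel (\<lambda>b. LINT x|lborel. f x b * \<psi> (x, b))" "integrable lborel (J z tl\<psi>)"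
proof -
  obtain B where B: "\<And>x t b. (x, t) \<in> K \<Longrightarrow> 0 < b \<Longrightarrow> b \<le> t \<Longrightarrow> norm (z x t b) \<le> B"
    by (rule z_bounded[OF K(1,2)]) blast
  note J = J_fubini[OF K(1,2) tl\<psi>_supported z_continuous B]
  show "integrable lborel (J z tl\<psi>)" by (rule J(1))
  let ?f = "\<lambda>(x, t). f x t * \<psi> (x, t)"
  have cf: "continuous_on UNIV ?f"
  proof (rule continuous_on_zero_extend[OF open_V K(3,2)])
    have "continuous_on V (\<lambda>p. (\<lambda>(x, t). f x t) p * \<psi> p)"
      by (intro continuous_intros f_continuous continuous_on_subset[OF Ck_along_continuous[OF psi_Ck[of 0]]]) auto
    then show "continuous_on V ?f" by (simp add: case_prod_unfold)
  qed (auto simp: psi_0)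
  have fi: "integrable lborel ?f"
    by (rule integrable_compact_support[OF K(1) cf]) (auto simp: psi_0)
  then have fi2: "integrable (lborel \<Otimes>\<^sub>M lborel) ?f" by (simp add: lborel_prod)
  have If: "(LINT p|lborel. ?f p) = (LINT b|lborel. LINT x|lborel. f x b * \<psi> (x, b))"
    using lborel_pair.integral_snd[OF fi2] by (simp add: lborel_prod)
  show "integrable lborel (\<lambda>b. LINT x|lborel. f x b * \<psi> (x, b))"
    by (rule lborel_pair.integrable_snd[OF fi2])
  let ?z = "\<lambda>p. c_const l *\<^sub>R (Z p * tl\<psi> p)"
  have cz: "continuous_on UNIV ?z"
  proof (rule continuous_on_zero_extend[OF open_V K(3,2)])
    show "continuous_on V ?z"
      using tl\<psi>_supported by (auto intro!: continuous_intros Z_continuous intro: continuous_on_subset simp: supported_def)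
  qed (simp add: supported_zero[OF tl\<psi>_supported])
  have zi: "integrable lborel ?z"
    by (rule integrable_compact_support[OF K(1) cz]) (simp add: supported_zero[OF tl\<psi>_supported])
  have "regular_dist V (transform_rhs l f w) \<psi> = (LINT p|lborel. ?f p + ?z p)"
    unfolding regular_dist_def set_lebesgue_integral_def[of _ V]
  proof (rule Bochner_Integration.integral_cong[OF refl])
    fix p :: "(real^'n) \<times> real"
    obtain x t where p: "p = (x, t)" by (cases p)
    show "indicat_real V p *\<^sub>R (transform_rhs l f w p * \<psi> p) = ?f p + ?z p"
    proof (cases "p \<in> K")
      case True
      then have "p \<in> V" using K by blast
      then show ?thesis using transform_rhs_eq[of x t]
        by (simp add: p tl\<psi>_def scaleR_conv_of_real algebra_simps)
    next
      case False
      then show ?thesis by (simp add: p psi_0 tl\<psi>_def)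
    qed
  qed
  also have "\<dots> = (LINT p|lborel. ?f p) + (LINT p|lborel. ?z p)"
    by (rule Bochner_Integration.integral_add[OF fi zi])
  also have "(LINT p|lborel. ?z p) = c_const l *\<^sub>R (LINT p|lborel. Z p * tl\<psi> p)"
    by (rule integral_scaleR_right)
  also have "(LINT p|lborel. Z p * tl\<psi> p) = (LINT b|lborel. J z tl\<psi> b)"
    unfolding Z_def case_prod_unfold by (rule J(2)[symmetric])
  also note If
  finally show "regular_dist V (transform_rhs l f w) \<psi> = (LINT b|lborel. LINT x|lborel. f x b * \<psi> (x, b)) + c_const l *\<^sub>R (LINT b|lborel. J z tl\<psi> b)" .
qed

text \<open>
  The slice identity is integrated over \<open>b\<close>; by Fubini's theorem its terms become the pairings of
  \<open>u\<close> and of the right-hand side.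
\<close>

lemma weak_equation:
  "dist_partial (0, 1) (dist_partial (0, 1) (regular_dist V (transform l w))) \<psi>
     - dist_mult (\<lambda>(x, t). of_real (t powr l)) (dist_diff_op m a (regular_dist V (transform l w))) \<psi>
     = regular_dist V (transform_rhs l f w) \<psi>"
proof -
  let ?s = "\<lambda>\<alpha>. (-1) ^ length (multi_list \<alpha>) :: complex"
  have 1: "dist_partial (0, 1) (dist_partial (0, 1) (regular_dist V (transform l w))) \<psi> = regular_dist V (transform l w) D2"
    by (simp add: dist_partial_def D1_def D2_def)
  have i2: "integrable lborel (J v D2)" by (rule regular_dist_u(2)[OF psi_derivs(3)])
  have ic: "integrable lborel (\<lambda>b. \<Sum>\<alpha>\<in>multi_indices m. ?s \<alpha> * J v (chi \<alpha>) b)"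
    by (intro Bochner_Integration.integrable_sum integrable_mult_right regular_dist_u(2) chi_supported)
  have "dist_partial (0, 1) (dist_partial (0, 1) (regular_dist V (transform l w))) \<psi>
     - dist_mult (\<lambda>(x, t). of_real (t powr l)) (dist_diff_op m a (regular_dist V (transform l w))) \<psi>
    = c_const l *\<^sub>R (LINT b|lborel. J v D2 b) - (\<Sum>\<alpha>\<in>multi_indices m. ?s \<alpha> * (c_const l *\<^sub>R (LINT b|lborel. J v (chi \<alpha>) b)))"
    unfolding 1 dist_operator_eq regular_dist_u(1)[OF psi_derivs(3)]
    by (intro arg_cong2[of _ _ _ _ minus] refl sum.cong) (simp add: regular_dist_u(1)[OF chi_supported])
  also have "(\<Sum>\<alpha>\<in>multi_indices m. ?s \<alpha> * (c_const l *\<^sub>R (LINT b|lborel. J v (chi \<alpha>) b)))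
     = c_const l *\<^sub>R (\<Sum>\<alpha>\<in>multi_indices m. (LINT b|lborel. ?s \<alpha> * J v (chi \<alpha>) b))"
    by (simp add: scaleR_sum_right)
  also have "(\<Sum>\<alpha>\<in>multi_indices m. (LINT b|lborel. ?s \<alpha> * J v (chi \<alpha>) b))
     = (LINT b|lborel. (\<Sum>\<alpha>\<in>multi_indices m. ?s \<alpha> * J v (chi \<alpha>) b))"
    by (rule Bochner_Integration.integral_sum[symmetric]) (intro integrable_mult_right regular_dist_u(2) chi_supported)
  also have "c_const l *\<^sub>R (LINT b|lborel. J v D2 b) - c_const l *\<^sub>R (LINT b|lborel. (\<Sum>\<alpha>\<in>multi_indices m. ?s \<alpha> * J v (chi \<alpha>) b))
     = (LINT b|lborel. c_const l *\<^sub>R (J v D2 b - (\<Sum>\<alpha>\<in>multi_indices m. ?s \<alpha> * J v (chi \<alpha>) b)))"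
  proof -
    have "(LINT b|lborel. c_const l *\<^sub>R (J v D2 b - (\<Sum>\<alpha>\<in>multi_indices m. ?s \<alpha> * J v (chi \<alpha>) b)))
      = c_const l *\<^sub>R (LINT b|lborel. J v D2 b - (\<Sum>\<alpha>\<in>multi_indices m. ?s \<alpha> * J v (chi \<alpha>) b))"
      by (rule integral_scaleR_right)
    also note Bochner_Integration.integral_diff[OF i2 ic]
    finally show ?thesis by (simp only: scaleR_diff_right)
  qed
  also have "\<dots> = (LINT b|lborel. (LINT x|lborel. f x b * \<psi> (x, b)) + c_const l *\<^sub>R J z tl\<psi> b)"
    unfolding slice_identity ..
  also have "\<dots> = (LINT b|lborel. LINT x|lborel. f x b * \<psi> (x, b)) + (LINT b|lborel. c_const l *\<^sub>R J z tl\<psi> b)"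
    by (rule Bochner_Integration.integral_add[OF regular_dist_rhs(2) integrable_scaleR_right[OF regular_dist_rhs(3)]])
  also have "\<dots> = regular_dist V (transform_rhs l f w) \<psi>"
    unfolding regular_dist_rhs(1) by simp
  finally show ?thesis .
qed

end

end


theorem corollary1p4:
  fixes l :: real and m :: nat
    and \<Omega> :: "((real^'n) \<times> real) set"
    and a :: "('n \<Rightarrow> nat) \<Rightarrow> real^'n \<Rightarrow> complex"
    and f :: "real^'n \<Rightarrow> real \<Rightarrow> complex"
    and w :: "real^'n \<Rightarrow> real \<Rightarrow> real \<Rightarrow> complex"
  assumes l: "l > -2"
    and dom: "halfspace_domain \<Omega>"
    and backward: "backward_time_connected \<Omega>"
    and coeff: "\<And>\<alpha>. \<alpha> \<in> multi_indices m \<Longrightarrow> smooth_on (fst ` \<Omega>) (a \<alpha>)"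
    and reg: "\<And>x0 t0. (x0, t0) \<in> \<Omega> \<Longrightarrow> t0 > 0 \<Longrightarrow>
               \<exists>U. open U \<and> x0 \<in> U \<and> Cm20_on m (U \<times> {0..phi l t0} \<times> {0..t0}) w"
    and pde: "\<And>x r b. (x, r) \<in> phi_image l \<Omega> \<Longrightarrow> (x, b) \<in> \<Omega> \<Longrightarrow>
               partial 1 (partial 1 (\<lambda>r. w x r b)) r - diff_op m a (\<lambda>y. w y r b) x = 0"
    and init: "\<And>x b. (x, b) \<in> \<Omega> \<Longrightarrow> w x 0 b = f x b"
  shows "let u = transform l w; V = \<Omega> \<inter> upper_halfspace in
      (\<forall>p\<in>\<Omega>. transform_exists l w p) \<and>
      continuous_on \<Omega> u \<and>
      (\<forall>(x, t)\<in>V. set_integrable lborel {0..t} (rhs_integrand l w x t)) \<and>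
      locally_integrable_on V (transform_rhs l f w) \<and>
      (\<forall>\<psi>\<in>test_functions V.
         dist_partial (0, 1) (dist_partial (0, 1) (regular_dist V u)) \<psi>
         - dist_mult (\<lambda>(x, t). of_real (t powr l)) (dist_diff_op m a (regular_dist V u)) \<psi>
         = regular_dist V (transform_rhs l f w) \<psi>) \<and>
      vanishes_initially \<Omega> u \<and>
      (l < 4 \<longrightarrow>
         (\<exists>u\<^sub>t. (\<forall>(x, t)\<in>\<Omega>. ((\<lambda>s. u (x, s)) has_vector_derivative u\<^sub>t (x, t)) (at t within {0..})) \<and>
               continuous_on \<Omega> u\<^sub>t \<and> vanishes_initially \<Omega> u\<^sub>t))"
proof -
  interpret wave_setting l m \<Omega> a f w
    by (unfold_locales; fact assms)
  have ut: "\<exists>u\<^sub>t. (\<forall>(x, t)\<in>\<Omega>. ((\<lambda>s. transform l w (x, s)) has_vector_derivative u\<^sub>t (x, t)) (at t within {0..})) \<and>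
               continuous_on \<Omega> u\<^sub>t \<and> vanishes_initially \<Omega> u\<^sub>t" if "l < 4"
    using u_t[OF that] by (intro exI[of _ "\<lambda>(x, t). c_const l *\<^sub>R G x t"]) blast
  show ?thesis
    unfolding Let_def
    using transform_exists u_continuous rhs_integrable(1) transform_rhs_locally_integrable weak_equation u_vanishes ut
    by blast
qed

end
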